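(* Let $K$ be a field, $n$ a positive integer, $E$ a graph with finitely many vertices, and $v$ and $w$ vertices in $E$ (they may be the same). Let $e_1, e_2, \ldots, e_n$ be distinct edges in $E$ with $s(e_i) = v$ and $r(e_i) = w$ for all $1\le i\le n$. Let $P=(p_{i,j})$ be a unit of $M_n(L_K(E))$ with $wP=Pw$ and $P^{-1} = (q_{i, j})$. Then the following statements hold: (i) There exists a unique homomorphism $\varphi_P:L_K(E)\to L_K(E)$ of $K$-algebras satisfying $$\varphi _P(u)=u,\quad \varphi _P(e)=e\quad\text{and}\quad \varphi _P(e^* )=e^*$$ for all $u\in E^0$ and $e\in E^1\setminus \{ e_1,\ldots ,e_n\}$, and $$\varphi_P(e_i) = \sum^n_{k=1}e_kp_{k,i}\quad\text{and}\quad \varphi_P(e^*_i) = \sum^n_{k=1}q_{i,k}e^*_k$$ for all $1\le i\le n$. (ii) If $\varphi _P(p_{i,j})=p_{i,j}$ for all $1\le i, j\le n$, then $\varphi _P$ is an isomorphism and $\varphi _P^{-1}=\varphi _{P^{-1}}$, where $\varphi_{P^{-1}}$ denotes the homomorphism obtained in (i) with $P^{-1}$ in place of $P$.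
   Context: A (directed) graph $E=(E^0,E^1,s,r)$ consists of two disjoint sets $E^0$ (vertices) and $E^1$ (edges) with maps $s,r:E^1\to E^0$ (source and range). A vertex $v$ is regular if $0<|s^{-1}(v)|<\infty$. For a field $K$, the Leavitt path algebra $L_K(E)$ is the $K$-algebra generated by the union of $E^0$ and two disjoint copies $E^1$ and $\{e^*\mid e\in E^1\}$ of $E^1$, subject to the following relations for all $v,w\in E^0$ and $e,f\in E^1$: (1) $vw=\delta_{v,w}w$; (2) $s(e)e=e=e\,r(e)$ and $e^*s(e)=e^*=r(e)e^*$; (3) $e^*f=\delta_{e,f}r(e)$; (4) $v=\sum_{e\in s^{-1}(v)}ee^*$ for every regular vertex $v$. If $E^0$ is finite, $L_K(E)$ is unital with identity $1=\sum_{v\in E^0}v$. For $a\in L_K(E)$ and a matrix $P=(p_{i,j})\in M_n(L_K(E))$, $aP=(ap_{i,j})$ and $Pa=(p_{i,j}a)$ (entrywise multiplication). *)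

theory Defs
  imports
    "HOL-Library.Poly_Mapping"
    "HOL-Algebra.QuotRing"
    "Graph_Theory.Digraph"
    "Jordan_Normal_Form.Matrix"
begin

section \<open>Free associative algebras\<close>

text \<open>
  The convolution product of finitely supported functions on the monoid of words is the product
  of the free associative \<open>'k\<close>-algebra. Lists are wrapped, so that no additive structure is put
  on the type of lists itself.
\<close>

datatype 'x word = Word (letters: "'x list")

instantiation word :: (type) monoid_add
begin

definition zero_word :: "'a word" where
  "zero_word = Word []"

definition plus_word :: "'a word \<Rightarrow> 'a word \<Rightarrow> 'a word" where
  "plus_word a b = Word (letters a @ letters b)"

instance
  by standard (simp_all add: zero_word_def plus_word_def)

end

type_synonym ('x, 'k) free_alg = "'x word \<Rightarrow>\<^sub>0 'k"

text \<open>
  Algebras are not assumed to be unital: the free algebra on \<open>X\<close> is spanned by the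
  nonempty words in \<open>X\<close>.
\<close>

definition free_carrier :: "'x set \<Rightarrow> ('x, 'k::field) free_alg set" where
  "free_carrier X = {p. \<forall>u \<in> Poly_Mapping.keys p. letters u \<noteq> [] \<and> set (letters u) \<subseteq> X}"

definition free_gen :: "'x \<Rightarrow> ('x, 'k::field) free_alg" where
  "free_gen x = Poly_Mapping.single (Word [x]) 1"

definition free_scale :: "'k::field \<Rightarrow> ('x, 'k) free_alg \<Rightarrow> ('x, 'k) free_alg" where
  "free_scale c p = Poly_Mapping.map ((*) c) p"

inductive_set free_ideal :: "'x set \<Rightarrow> ('x, 'k::field) free_alg set \<Rightarrow> ('x, 'k) free_alg set"
  for X R where
  base: "r \<in> R \<Longrightarrow> r \<in> free_ideal X R"
| zero: "0 \<in> free_ideal X R"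
| add: "p \<in> free_ideal X R \<Longrightarrow> q \<in> free_ideal X R \<Longrightarrow> p + q \<in> free_ideal X R"
| scale: "p \<in> free_ideal X R \<Longrightarrow> free_scale c p \<in> free_ideal X R"
| mult_left: "a \<in> free_carrier X \<Longrightarrow> p \<in> free_ideal X R \<Longrightarrow> a * p \<in> free_ideal X R"
| mult_right: "a \<in> free_carrier X \<Longrightarrow> p \<in> free_ideal X R \<Longrightarrow> p * a \<in> free_ideal X R"


section \<open>Leavitt path algebras\<close>

definition regular_vertex :: "('v, 'e) pre_digraph \<Rightarrow> 'v \<Rightarrow> bool" where
  "regular_vertex E v \<longleftrightarrow> v \<in> verts E \<and> out_arcs E v \<noteq> {} \<and> finite (out_arcs E v)"

datatype ('v, 'e) lpa_letter = Vertex 'v | Edge 'e | Ghost 'e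

definition lpa_letters :: "('v, 'e) pre_digraph \<Rightarrow> ('v, 'e) lpa_letter set" where
  "lpa_letters E = Vertex ` verts E \<union> Edge ` arcs E \<union> Ghost ` arcs E"

inductive_set lpa_relators :: "('v, 'e) pre_digraph \<Rightarrow> (('v, 'e) lpa_letter, 'k::field) free_alg set"
  for E where
  vertices: "v \<in> verts E \<Longrightarrow> w \<in> verts E \<Longrightarrow>
    free_gen (Vertex v) * free_gen (Vertex w)
      - (if v = w then free_gen (Vertex w) else 0) \<in> lpa_relators E"
| tail_edge: "e \<in> arcs E \<Longrightarrow>
    free_gen (Vertex (tail E e)) * free_gen (Edge e) - free_gen (Edge e) \<in> lpa_relators E"
| edge_head: "e \<in> arcs E \<Longrightarrow>
    free_gen (Edge e) * free_gen (Vertex (head E e)) - free_gen (Edge e) \<in> lpa_relators E"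
| ghost_tail: "e \<in> arcs E \<Longrightarrow>
    free_gen (Ghost e) * free_gen (Vertex (tail E e)) - free_gen (Ghost e) \<in> lpa_relators E"
| head_ghost: "e \<in> arcs E \<Longrightarrow>
    free_gen (Vertex (head E e)) * free_gen (Ghost e) - free_gen (Ghost e) \<in> lpa_relators E"
| CK1: "e \<in> arcs E \<Longrightarrow> f \<in> arcs E \<Longrightarrow>
    free_gen (Ghost e) * free_gen (Edge f)
      - (if e = f then free_gen (Vertex (head E e)) else 0) \<in> lpa_relators E"
| CK2: "regular_vertex E v \<Longrightarrow>
    free_gen (Vertex v) - (\<Sum>e\<in>out_arcs E v. free_gen (Edge e) * free_gen (Ghost e)) \<in> lpa_relators E"

definition lpa_rel :: "('v, 'e) pre_digraph \<Rightarrow> (('v, 'e) lpa_letter, 'k::field) free_alg rel" where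
  "lpa_rel E = {(p, q). p \<in> free_carrier (lpa_letters E) \<and> q \<in> free_carrier (lpa_letters E) \<and>
      p - q \<in> free_ideal (lpa_letters E) (lpa_relators E)}"

type_synonym ('v, 'e, 'k) lpa_elem = "(('v, 'e) lpa_letter, 'k) free_alg set"

text \<open>
  The record has a field for a unit, but in general Leavitt path algebras are not unital; the field
  is meaningful only if \<open>verts E\<close> is finite.
\<close>

definition lpa :: "('v, 'e) pre_digraph \<Rightarrow> ('k::field, ('v, 'e, 'k) lpa_elem) module" where
  "lpa E = \<lparr>
     carrier = free_carrier (lpa_letters E) // lpa_rel E,
     monoid.mult = (\<lambda>A B. \<Union>a\<in>A. \<Union>b\<in>B. lpa_rel E `` {a * b}),
     one = lpa_rel E `` {\<Sum>v\<in>verts E. free_gen (Vertex v)},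
     ring.zero = lpa_rel E `` {0},
     add = (\<lambda>A B. \<Union>a\<in>A. \<Union>b\<in>B. lpa_rel E `` {a + b}),
     smult = (\<lambda>c A. \<Union>a\<in>A. lpa_rel E `` {free_scale c a}) \<rparr>"

definition lpa_gen :: "('v, 'e) pre_digraph \<Rightarrow> ('v, 'e) lpa_letter \<Rightarrow> ('v, 'e, 'k::field) lpa_elem" where
  "lpa_gen E x = lpa_rel E `` {free_gen x}"


section \<open>Algebra homomorphisms and matrix rings\<close>

text \<open>
  Homomorphisms are unital, as in the library. For the maps considered below this is no
  restriction: they fix all vertices, hence also their sum, which is the unit.
\<close>

definition alg_hom :: "('k, 'a, 'm) module_scheme \<Rightarrow> ('k, 'b, 'n) module_scheme \<Rightarrow> ('a \<Rightarrow> 'b) set" where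
  "alg_hom A B = {h \<in> Ring.ring_hom A B. \<forall>c. \<forall>x \<in> carrier A. h (c \<odot>\<^bsub>A\<^esub> x) = c \<odot>\<^bsub>B\<^esub> h x}"

definition alg_iso :: "('k, 'a, 'm) module_scheme \<Rightarrow> ('k, 'b, 'n) module_scheme \<Rightarrow> ('a \<Rightarrow> 'b) set" where
  "alg_iso A B = alg_hom A B \<inter> ring_iso A B"

text \<open>
  Only the underlying type of matrices is taken from the library: its matrix operations are those
  of a type class, and here the entries come from a ring record.
\<close>

definition mat_ring :: "nat \<Rightarrow> ('a, 'm) ring_scheme \<Rightarrow> 'a mat ring" where
  "mat_ring n R = \<lparr>
     carrier = {A \<in> carrier_mat n n. \<forall>i<n. \<forall>j<n. A $$ (i, j) \<in> carrier R},
     monoid.mult = (\<lambda>A B. mat n n (\<lambda>(i, j). \<Oplus>\<^bsub>R\<^esub>k\<in>{..<n}. A $$ (i, k) \<otimes>\<^bsub>R\<^esub> B $$ (k, j))),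
     one = mat n n (\<lambda>(i, j). if i = j then \<one>\<^bsub>R\<^esub> else \<zero>\<^bsub>R\<^esub>),
     ring.zero = mat n n (\<lambda>_. \<zero>\<^bsub>R\<^esub>),
     add = (\<lambda>A B. mat n n (\<lambda>(i, j). A $$ (i, j) \<oplus>\<^bsub>R\<^esub> B $$ (i, j))) \<rparr>"


section \<open>The endomorphisms \<open>\<phi>\<^sub>P\<close>\<close>

text \<open>
  The distinguished edges are \<open>e 0, \<dots>, e (n - 1)\<close>, matching the indexing of matrices. Functions
  out of \<open>lpa E\<close> are taken to be undefined outside its carrier, so that \<open>\<phi>\<^sub>P\<close> can be unique.
\<close>

definition is_lpa_phi ::
  "('v, 'e) pre_digraph \<Rightarrow> nat \<Rightarrow> (nat \<Rightarrow> 'e) \<Rightarrow> ('v, 'e, 'k::field) lpa_elem mat \<Rightarrow>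
    (('v, 'e, 'k) lpa_elem \<Rightarrow> ('v, 'e, 'k) lpa_elem) \<Rightarrow> bool" where
  "is_lpa_phi E n e P \<phi> \<longleftrightarrow>
     (let L = lpa E; Q = inv\<^bsub>mat_ring n L\<^esub> P in
      \<phi> \<in> extensional (carrier L) \<and> \<phi> \<in> alg_hom L L \<and>
      (\<forall>u \<in> verts E. \<phi> (lpa_gen E (Vertex u)) = lpa_gen E (Vertex u)) \<and>
      (\<forall>f \<in> arcs E - e ` {..<n}. \<phi> (lpa_gen E (Edge f)) = lpa_gen E (Edge f) \<and>
         \<phi> (lpa_gen E (Ghost f)) = lpa_gen E (Ghost f)) \<and>
      (\<forall>i<n. \<phi> (lpa_gen E (Edge (e i))) =
           (\<Oplus>\<^bsub>L\<^esub>k\<in>{..<n}. lpa_gen E (Edge (e k)) \<otimes>\<^bsub>L\<^esub> P $$ (k, i)) \<and>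
         \<phi> (lpa_gen E (Ghost (e i))) =
           (\<Oplus>\<^bsub>L\<^esub>k\<in>{..<n}. Q $$ (i, k) \<otimes>\<^bsub>L\<^esub> lpa_gen E (Ghost (e k)))))"

definition lpa_phi ::
  "('v, 'e) pre_digraph \<Rightarrow> nat \<Rightarrow> (nat \<Rightarrow> 'e) \<Rightarrow> ('v, 'e, 'k::field) lpa_elem mat \<Rightarrow>
    ('v, 'e, 'k) lpa_elem \<Rightarrow> ('v, 'e, 'k) lpa_elem" where
  "lpa_phi E n e P = (THE \<phi>. is_lpa_phi E n e P \<phi>)"

end

theory Submission
  imports Defs "HOL-Library.Function_Algebras"
begin

text \<open>
  The images of the generators under \<open>\<phi>\<^sub>P\<close> satisfy the defining relations again, which gives (i).
  In (ii), \<open>\<phi>\<^sub>P\<close> fixes the entries of \<open>P\<close>, hence those of \<open>P\<^sup>-\<^sup>1\<close>, so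
  \<open>\<phi>\<^sub>P \<circ> \<phi>\<^sub>Q\<close> with \<open>Q = P\<^sup>-\<^sup>1\<close> fixes all generators and \<open>\<phi>\<^sub>P\<close> is surjective. Injectivity holds for every
  surjective endomorphism that fixes the vertices. A nonzero element of the kernel can be multiplied
  by edges and ghost edges into an element \<open>c a + \<Sum> k\<^sub>\<alpha> \<alpha>\<close> of the kernel with \<open>c \<noteq> 0\<close>, where the
  \<open>\<alpha>\<close> are closed paths at the vertex \<open>a\<close>. If the number of terms is minimal, every vertex that can be
  reached from \<open>a\<close> emits exactly one edge, for otherwise conjugation by a path would remove a term.
  Then the \<open>\<alpha>\<close> are powers of a cycle without exit, the corner at \<open>a\<close> is the algebra of Laurent
  polynomials in this cycle, and its image is finite-dimensional by the relation just found. This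
  contradicts surjectivity, since the powers of a cycle are linearly independent, as the grading shows.
\<close>

section \<open>Leavitt families in a ring\<close>

text \<open>The obstacle in (ii) is an asymmetry. The hypothesis concerns
  \<open>\<phi>\<^sub>P\<close> and makes \<open>\<phi>\<^sub>P \<circ> \<phi>\<^sub>Q\<close> the
  identity, but the other composite would require \<open>\<phi>\<^sub>Q\<close> to fix the entries
  of P, which is clear only once \<open>\<phi>\<^sub>P\<close> is known to be injective. A
  surjective endomorphism of an infinite-dimensional algebra may well have a kernel, and graded
  uniqueness does not help, because the entries of P need not be homogeneous of degree 0. A
  dimension count on a cycle without exit takes its place. Two further points shape the development.
  \<open>lpa E\<close> is a record of cosets; the calculations are done in a type of class
  \<open>ring\<close> instead, where the algebra is only a subset \<open>L\<close>, and the results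
  are carried over to the record at the end. And relations alone cannot show that something is
  nonzero: that a vertex is not a combination of longer paths is read off from a graded
  representation on boundary paths.\<close>

locale leavitt_family = wf_digraph E + vector_space scale
  for E :: "('v, 'e) pre_digraph" and scale :: "'k::field \<Rightarrow> 'a::ring \<Rightarrow> 'a" (infixr "*s" 75) +
  fixes V :: "'v \<Rightarrow> 'a" and D G :: "'e \<Rightarrow> 'a"
  assumes finite_verts: "finite (verts E)"
    and scale_mult_left: "(c *s x) * y = c *s (x * y)"
    and scale_mult_right: "x * (c *s y) = c *s (x * y)"
    and V_V: "u \<in> verts E \<Longrightarrow> u' \<in> verts E \<Longrightarrow> V u * V u' = (if u = u' then V u else 0)"
    and tail_D: "f \<in> arcs E \<Longrightarrow> V (tail E f) * D f = D f"
    and D_head: "f \<in> arcs E \<Longrightarrow> D f * V (head E f) = D f"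
    and G_tail: "f \<in> arcs E \<Longrightarrow> G f * V (tail E f) = G f"
    and head_G: "f \<in> arcs E \<Longrightarrow> V (head E f) * G f = G f"
    and G_D: "f \<in> arcs E \<Longrightarrow> f' \<in> arcs E \<Longrightarrow> G f * D f' = (if f = f' then V (head E f) else 0)"
    and CK: "u \<in> verts E \<Longrightarrow> out_arcs E u \<noteq> {} \<Longrightarrow> finite (out_arcs E u) \<Longrightarrow>
      (\<Sum>f\<in>out_arcs E u. D f * G f) = V u"
begin

lemma V_D: "u \<in> verts E \<Longrightarrow> f \<in> arcs E \<Longrightarrow> V u * D f = (if u = tail E f then D f else 0)"
  using tail_D[of f] V_V[of u "tail E f"]
  by (metis mult.assoc mult_zero_left tail_in_verts)

lemma D_V: "u \<in> verts E \<Longrightarrow> f \<in> arcs E \<Longrightarrow> D f * V u = (if u = head E f then D f else 0)"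
  using D_head[of f] V_V[of "head E f" u]
  by (metis mult.assoc mult_zero_right head_in_verts)

lemma V_G: "u \<in> verts E \<Longrightarrow> f \<in> arcs E \<Longrightarrow> V u * G f = (if u = head E f then G f else 0)"
  using head_G[of f] V_V[of u "head E f"]
  by (metis mult.assoc mult_zero_left head_in_verts)

lemma G_V: "u \<in> verts E \<Longrightarrow> f \<in> arcs E \<Longrightarrow> G f * V u = (if u = tail E f then G f else 0)"
  using G_tail[of f] V_V[of "tail E f" u]
  by (metis mult.assoc mult_zero_right tail_in_verts)

lemma V_V_assoc: "u \<in> verts E \<Longrightarrow> u' \<in> verts E \<Longrightarrow> V u * (V u' * x) = (if u = u' then V u * x else 0)"
  using V_V[of u u'] by (metis mult.assoc mult_zero_left)

lemma V_D_assoc: "u \<in> verts E \<Longrightarrow> f \<in> arcs E \<Longrightarrow> V u * (D f * x) = (if u = tail E f then D f * x else 0)"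
  using V_D[of u f] by (metis mult.assoc mult_zero_left)

lemma D_V_assoc: "u \<in> verts E \<Longrightarrow> f \<in> arcs E \<Longrightarrow> D f * (V u * x) = (if u = head E f then D f * x else 0)"
  using D_V[of u f] by (metis mult.assoc mult_zero_left)

lemma V_G_assoc: "u \<in> verts E \<Longrightarrow> f \<in> arcs E \<Longrightarrow> V u * (G f * x) = (if u = head E f then G f * x else 0)"
  using V_G[of u f] by (metis mult.assoc mult_zero_left)

lemma G_V_assoc: "u \<in> verts E \<Longrightarrow> f \<in> arcs E \<Longrightarrow> G f * (V u * x) = (if u = tail E f then G f * x else 0)"
  using G_V[of u f] by (metis mult.assoc mult_zero_left)

lemma G_D_assoc: "f \<in> arcs E \<Longrightarrow> f' \<in> arcs E \<Longrightarrow>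
    G f * (D f' * x) = (if f = f' then V (head E f) * x else 0)"
  using G_D[of f f'] by (metis mult.assoc mult_zero_left)

lemmas rels = V_V V_D D_V V_G G_V G_D V_V_assoc V_D_assoc D_V_assoc V_G_assoc G_V_assoc G_D_assoc
  mult.assoc scale_mult_left scale_mult_right

text \<open>Combinations of paths of length at most \<open>n\<close>. The bound drops when a first
  edge is split off, and the later inductions run on it. Composability of the edges is not demanded,
  since a product of edges that do not fit together is 0.\<close>

inductive path_sum :: "nat \<Rightarrow> 'a \<Rightarrow> bool" where
  zero: "path_sum n 0"
| vertex: "u \<in> verts E \<Longrightarrow> path_sum n (V u)"
| add: "path_sum n x \<Longrightarrow> path_sum n y \<Longrightarrow> path_sum n (x + y)"
| scale: "path_sum n x \<Longrightarrow> path_sum n (c *s x)"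
| edge: "f \<in> arcs E \<Longrightarrow> path_sum n x \<Longrightarrow> path_sum (Suc n) (D f * x)"

text \<open>Ghosts are appended on the right only, so these are the combinations of monomials "path
  times ghost path" with at most \<open>m\<close> ghosts. The length of the path part stays free:
  only the ghosts have to be counted.\<close>

inductive elem :: "nat \<Rightarrow> 'a \<Rightarrow> bool" where
  path: "path_sum n x \<Longrightarrow> elem m x"
| add: "elem m x \<Longrightarrow> elem m y \<Longrightarrow> elem m (x + y)"
| ghost: "f \<in> arcs E \<Longrightarrow> elem m x \<Longrightarrow> elem (Suc m) (x * G f)"

text \<open>The ambient ring is larger than the algebra generated by the family, and its unit, if
  there is one, is not the sum of the vertices. Hence all later statements are relative to this
  set.\<close>

definition L :: "'a set" where
  "L = {x. \<exists>m. elem m x}"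

section \<open>Closure of the spanned algebra under products, and its unit\<close>

lemma path_sum_mono: "path_sum n x \<Longrightarrow> n \<le> n' \<Longrightarrow> path_sum n' x"
proof (induction arbitrary: n' rule: path_sum.induct)
  case (edge f n x)
  then show ?case by (cases n') (auto intro: path_sum.edge)
qed (auto intro: path_sum.intros)

lemma elem_mono: "elem m x \<Longrightarrow> m \<le> m' \<Longrightarrow> elem m' x"
proof (induction arbitrary: m' rule: elem.induct)
  case (ghost f m x)
  then show ?case by (cases m') (auto intro: elem.ghost)
qed (auto intro: elem.intros)

lemma elem_scale: "elem m x \<Longrightarrow> elem m (c *s x)"
proof (induction rule: elem.induct)
  case (ghost f m x)
  then show ?case using elem.ghost[of f m "c *s x"] by (simp add: scale_mult_left)
qed (auto intro: elem.intros path_sum.scale simp: scale_right_distrib)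

lemma vertex_path_sum: "u \<in> verts E \<Longrightarrow> path_sum n x \<Longrightarrow> path_sum n (V u * x)"
proof (rotate_tac, induction rule: path_sum.induct)
  case (edge f n x)
  then show ?case by (auto simp: V_D_assoc intro: path_sum.intros)
qed (auto intro: path_sum.intros simp: V_V distrib_left scale_mult_right)

lemma path_sum_vertex: "u \<in> verts E \<Longrightarrow> path_sum n x \<Longrightarrow> path_sum n (x * V u)"
  by (rotate_tac, induction rule: path_sum.induct)
    (auto intro: path_sum.intros simp: V_V distrib_right scale_mult_left mult.assoc)

lemma path_sum_edge: "f \<in> arcs E \<Longrightarrow> path_sum n x \<Longrightarrow> path_sum (Suc n) (x * D f)"
proof (rotate_tac, induction rule: path_sum.induct)
  case (vertex u n)
  moreover have "path_sum (Suc n) (D f * V (head E f))"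
    using vertex by (intro path_sum.edge path_sum.vertex) auto
  ultimately show ?case by (auto simp: V_D D_head intro: path_sum.zero)
qed (auto intro: path_sum.intros simp: distrib_right scale_mult_left mult.assoc)

lemma elem_vertex: "u \<in> verts E \<Longrightarrow> elem m x \<Longrightarrow> elem m (x * V u)"
proof (rotate_tac, induction rule: elem.induct)
  case (path n x m)
  then show ?case by (auto intro: elem.path path_sum_vertex)
next
  case (ghost f m x)
  then show ?case using elem.path[OF path_sum.zero] by (auto simp: G_V mult.assoc intro: elem.intros)
qed (auto intro: elem.intros simp: distrib_right)

text \<open>The edge meets the last ghost and the two reduce to a vertex or to 0, or there is no
  ghost and the path becomes longer, which \<open>m\<close> does not see.\<close>

lemma elem_edge: "f \<in> arcs E \<Longrightarrow> elem m x \<Longrightarrow> elem m (x * D f)"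
proof (rotate_tac, induction rule: elem.induct)
  case (path n x m)
  then show ?case by (auto intro: elem.path path_sum_edge)
next
  case (ghost f' m x)
  then have "elem m (x * V (head E f'))" by (auto intro: elem_vertex)
  then have "elem (Suc m) (x * V (head E f'))" by (rule elem_mono) simp
  then show ?case using ghost elem.path[OF path_sum.zero] by (auto simp: G_D mult.assoc)
qed (auto intro: elem.intros simp: distrib_right)

lemma elem_V: "u \<in> verts E \<Longrightarrow> elem m (V u)"
  by (auto intro: elem.path path_sum.vertex)

lemma elem_D: "f \<in> arcs E \<Longrightarrow> elem m (D f)"
  using elem_edge[OF _ elem_V[of "tail E f" m], of f] by (simp add: V_D)

lemma elem_G: "f \<in> arcs E \<Longrightarrow> elem (Suc m) (G f)"
  using elem.ghost[OF _ elem_V[of "head E f" m], of f] by (simp add: V_G)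

lemma L_0 [simp, intro]: "0 \<in> L"
  unfolding L_def by (auto intro: elem.path path_sum.zero)

lemma L_V [simp, intro]: "u \<in> verts E \<Longrightarrow> V u \<in> L"
  unfolding L_def by (auto intro: elem_V)

lemma L_D [simp, intro]: "f \<in> arcs E \<Longrightarrow> D f \<in> L"
  unfolding L_def by (auto intro: elem_D)

lemma L_G [simp, intro]: "f \<in> arcs E \<Longrightarrow> G f \<in> L"
  unfolding L_def by (auto intro: elem_G)

lemma L_add [simp, intro]: "x \<in> L \<Longrightarrow> y \<in> L \<Longrightarrow> x + y \<in> L"
  unfolding L_def by (auto intro: elem.add elem_mono max.cobounded1 max.cobounded2)

lemma L_scale [simp, intro]: "x \<in> L \<Longrightarrow> c *s x \<in> L"
  unfolding L_def by (auto intro: elem_scale)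

lemma L_sum [intro]: "(\<And>i. i \<in> T \<Longrightarrow> g i \<in> L) \<Longrightarrow> (\<Sum>i\<in>T. g i) \<in> L"
  by (induction T rule: infinite_finite_induct) auto

text \<open>No multiplication formula for monomials is used: the right factor is consumed one
  generator at a time, through \<open>elem_vertex\<close>, \<open>elem_edge\<close> and
  \<open>elem.ghost\<close>.\<close>

lemma L_mult [simp, intro]:
  assumes "x \<in> L" "y \<in> L"
  shows "x * y \<in> L"
proof -
  have path: "x * y \<in> L" if "path_sum n y" "x \<in> L" for n x y
    using that
  proof (induction arbitrary: x rule: path_sum.induct)
    case (vertex u n)
    then show ?case by (auto simp: L_def intro: elem_vertex)
  next
    case (edge f n y)
    then have "x * D f \<in> L" by (auto simp: L_def intro: elem_edge)
    then show ?case using edge by (metis mult.assoc)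
  qed (auto simp: distrib_left scale_mult_right)
  have "elem m y \<Longrightarrow> x * y \<in> L" for m y
  proof (induction rule: elem.induct)
    case (ghost f m y)
    then show ?case by (auto simp: L_def mult.assoc[symmetric] intro: elem.ghost)
  qed (use path \<open>x \<in> L\<close> in \<open>auto simp: distrib_left\<close>)
  then show ?thesis using assms by (auto simp: L_def)
qed

lemma L_path_sum: "path_sum n x \<Longrightarrow> x \<in> L"
  unfolding L_def by (auto intro: elem.path)

lemma V_unit_right: "x \<in> L \<Longrightarrow> x * (\<Sum>u\<in>verts E. V u) = x"
proof -
  have V: "V u * (\<Sum>u\<in>verts E. V u) = V u" if "u \<in> verts E" for u
    using that finite_verts by (simp add: sum_distrib_left V_V sum.delta)
  have G: "G f * (\<Sum>u\<in>verts E. V u) = G f" if "f \<in> arcs E" for f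
    using that finite_verts by (simp add: sum_distrib_left G_V sum.delta)
  have P: "x * (\<Sum>u\<in>verts E. V u) = x" if "path_sum n x" for n x
    using that by induction (auto simp: V distrib_right scale_mult_left mult.assoc)
  have "elem m x \<Longrightarrow> x * (\<Sum>u\<in>verts E. V u) = x" for m
    by (induction rule: elem.induct) (auto simp: P G distrib_right mult.assoc)
  then show "x \<in> L \<Longrightarrow> x * (\<Sum>u\<in>verts E. V u) = x" by (auto simp: L_def)
qed

lemma V_unit_left: "x \<in> L \<Longrightarrow> (\<Sum>u\<in>verts E. V u) * x = x"
proof -
  have V: "(\<Sum>u\<in>verts E. V u) * V u = V u" if "u \<in> verts E" for u
    using that finite_verts by (simp add: sum_distrib_right V_V)
  have D: "(\<Sum>u\<in>verts E. V u) * (D f * y) = D f * y" if "f \<in> arcs E" for f y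
    using that finite_verts by (simp add: sum_distrib_right V_D_assoc)
  have P: "(\<Sum>u\<in>verts E. V u) * x = x" if "path_sum n x" for n x
    using that by induction (auto simp: V D distrib_left scale_mult_right)
  have "elem m x \<Longrightarrow> (\<Sum>u\<in>verts E. V u) * x = x" for m
    by (induction rule: elem.induct) (auto simp: P distrib_left mult.assoc[symmetric])
  then show "x \<in> L \<Longrightarrow> (\<Sum>u\<in>verts E. V u) * x = x" by (auto simp: L_def)
qed

lemma L_right_vertex:
  assumes "x \<in> L" "x \<noteq> 0"
  obtains u where "u \<in> verts E" "x * V u \<noteq> 0"
proof -
  have "(\<Sum>u\<in>verts E. x * V u) \<noteq> 0"
    using V_unit_right[OF assms(1)] assms(2) by (simp add: sum_distrib_left)
  then show ?thesis using that by (meson sum.not_neutral_contains_not_neutral)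
qed

text \<open>The terms are collected by their first edge. Each cofactor \<open>g f\<close> has a
  strictly smaller bound, as strong induction on \<open>n\<close> demands.\<close>

lemma path_sum_cases:
  assumes "path_sum n x"
  obtains k S g where "finite S" "S \<subseteq> arcs E" "\<forall>f\<in>S. \<exists>m<n. path_sum m (g f)"
    "x = (\<Sum>u\<in>verts E. k u *s V u) + (\<Sum>f\<in>S. D f * g f)"
proof -
  let ?Q = "\<lambda>n x. \<exists>k S g. finite S \<and> S \<subseteq> arcs E \<and> (\<forall>f\<in>S. \<exists>m<n. path_sum m (g f)) \<and>
    x = (\<Sum>u\<in>verts E. k u *s V u) + (\<Sum>f\<in>S. D f * g f)"
  have "?Q n x" using assms
  proof (induction rule: path_sum.induct)
    case (zero n)
    show ?case by (rule exI[of _ "\<lambda>_. 0"], rule exI[of _ "{}"]) auto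
  next
    case (vertex u n)
    show ?case
      using vertex finite_verts
      by (intro exI[of _ "\<lambda>u'. if u' = u then 1 else 0"] exI[of _ "{}"])
        (auto simp: if_distrib[of "\<lambda>c. c *s _"] cong: if_cong)
  next
    case (add n x y)
    obtain k S g where x: "finite S" "S \<subseteq> arcs E" "\<forall>f\<in>S. \<exists>m<n. path_sum m (g f)"
      "x = (\<Sum>u\<in>verts E. k u *s V u) + (\<Sum>f\<in>S. D f * g f)" using add by auto
    obtain k' S' g' where y: "finite S'" "S' \<subseteq> arcs E" "\<forall>f\<in>S'. \<exists>m<n. path_sum m (g' f)"
      "y = (\<Sum>u\<in>verts E. k' u *s V u) + (\<Sum>f\<in>S'. D f * g' f)" using add by auto
    \<comment> \<open>The two supports may differ; each cofactor is continued by 0 to their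
      union.\<close>
    let ?g = "\<lambda>f. (if f \<in> S then g f else 0) + (if f \<in> S' then g' f else 0)"
    have "\<exists>m<n. path_sum m (?g f)" if "f \<in> S \<union> S'" for f
    proof -
      have "path_sum (n - 1) (?g f)"
        using x(3) y(3) that 
        by (auto intro!: path_sum.add path_sum.zero path_sum_mono[of _ _ "n - 1"])
           (metis One_nat_def Suc_pred less_Suc_eq_le not_gr_zero not_less_zero path_sum_mono)+
      moreover have "n > 0" using x(3) y(3) that by auto
      ultimately show ?thesis by (intro exI[of _ "n - 1"]) auto
    qed
    moreover have "(\<Sum>f\<in>S \<union> S'. D f * ?g f) = (\<Sum>f\<in>S. D f * g f) + (\<Sum>f\<in>S'. D f * g' f)"
    proof -
      have "(\<Sum>f\<in>S. D f * g f) = (\<Sum>f\<in>S \<union> S'. D f * (if f \<in> S then g f else 0))"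
        using x(1) y(1) by (intro sum.mono_neutral_cong_left) auto
      moreover have "(\<Sum>f\<in>S'. D f * g' f) = (\<Sum>f\<in>S \<union> S'. D f * (if f \<in> S' then g' f else 0))"
        using x(1) y(1) by (intro sum.mono_neutral_cong_left) auto
      ultimately show ?thesis by (simp only: sum.distrib distrib_left)
    qed
    ultimately show ?case
      by (intro exI[of _ "\<lambda>u. k u + k' u"] exI[of _ "S \<union> S'"] exI[of _ ?g])
        (use x y in \<open>auto simp: scale_left_distrib sum.distrib algebra_simps\<close>)
  next
    case (scale n x c)
    then obtain k S g where x: "finite S" "S \<subseteq> arcs E" "\<forall>f\<in>S. \<exists>m<n. path_sum m (g f)"
      "x = (\<Sum>u\<in>verts E. k u *s V u) + (\<Sum>f\<in>S. D f * g f)" by auto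
    show ?case
      using x by (intro exI[of _ "\<lambda>u. c * k u"] exI[of _ S] exI[of _ "\<lambda>f. c *s g f"])
        (auto simp: scale_right_distrib scale_sum_right scale_mult_right, meson path_sum.scale)
  next
    case (edge f n x)
    then show ?case by (intro exI[of _ "\<lambda>_. 0"] exI[of _ "{f}"] exI[of _ "\<lambda>_. x"]) auto
  qed
  then show ?thesis using that by blast
qed

text \<open>The mirror image of \<open>path_sum_cases\<close>: the terms are collected by their last
  ghost, and those without ghosts are gathered in \<open>r\<close>.\<close>

lemma elem_cases:
  assumes "elem m x"
  obtains n r S g where "path_sum n r" "finite S" "S \<subseteq> arcs E" "\<forall>f\<in>S. \<exists>l<m. elem l (g f)"
    "x = r + (\<Sum>f\<in>S. g f * G f)"
proof -
  let ?Q = "\<lambda>m x. \<exists>n r S g. path_sum n r \<and> finite S \<and> S \<subseteq> arcs E \<and>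
    (\<forall>f\<in>S. \<exists>l<m. elem l (g f)) \<and> x = r + (\<Sum>f\<in>S. g f * G f)"
  have "?Q m x" using assms
  proof (induction rule: elem.induct)
    case (path n x m)
    then show ?case by (intro exI[of _ n] exI[of _ x] exI[of _ "{}"]) auto
  next
    case (add m x y)
    obtain n r S g where x: "path_sum n r" "finite S" "S \<subseteq> arcs E" "\<forall>f\<in>S. \<exists>l<m. elem l (g f)"
      "x = r + (\<Sum>f\<in>S. g f * G f)" using add by auto
    obtain n' r' S' g' where y: "path_sum n' r'" "finite S'" "S' \<subseteq> arcs E"
      "\<forall>f\<in>S'. \<exists>l<m. elem l (g' f)" "y = r' + (\<Sum>f\<in>S'. g' f * G f)" using add by auto
    let ?g = "\<lambda>f. (if f \<in> S then g f else 0) + (if f \<in> S' then g' f else 0)"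
    have "\<exists>l<m. elem l (?g f)" if "f \<in> S \<union> S'" for f
    proof -
      have "elem (m - 1) (?g f)"
        using x(4) y(4) that 
        by (auto intro!: elem.add elem.path[OF path_sum.zero] elem_mono[of _ _ "m - 1"])
           (metis One_nat_def Suc_pred less_Suc_eq_le not_gr_zero not_less_zero elem_mono)+
      moreover have "m > 0" using x(4) y(4) that by auto
      ultimately show ?thesis by (intro exI[of _ "m - 1"]) auto
    qed
    moreover have "(\<Sum>f\<in>S \<union> S'. ?g f * G f) = (\<Sum>f\<in>S. g f * G f) + (\<Sum>f\<in>S'. g' f * G f)"
    proof -
      have "(\<Sum>f\<in>S. g f * G f) = (\<Sum>f\<in>S \<union> S'. (if f \<in> S then g f else 0) * G f)"
        using x(2) y(2) by (intro sum.mono_neutral_cong_left) auto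
      moreover have "(\<Sum>f\<in>S'. g' f * G f) = (\<Sum>f\<in>S \<union> S'. (if f \<in> S' then g' f else 0) * G f)"
        using x(2) y(2) by (intro sum.mono_neutral_cong_left) auto
      ultimately show ?thesis by (simp only: sum.distrib distrib_right)
    qed
    moreover have "path_sum (max n n') (r + r')"
      using path_sum.add[OF path_sum_mono[OF x(1)] path_sum_mono[OF y(1)]] by simp
    ultimately show ?case
      by (intro exI[of _ "max n n'"] exI[of _ "r + r'"] exI[of _ "S \<union> S'"] exI[of _ ?g])
        (use x y in \<open>auto simp: algebra_simps\<close>)
  next
    case (ghost f m x)
    then show ?case by (intro exI[of _ 0] exI[of _ 0] exI[of _ "{f}"] exI[of _ "\<lambda>_. x"])
      (auto intro: path_sum.zero)
  qed
  then show ?thesis using that by blast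
qed

text \<open>Its span is the positive-degree part of the path algebra, the part that the grading
  keeps apart from the vertices.\<close>

definition paths_pos :: "'a set" where
  "paths_pos = {D f * y | f y n. f \<in> arcs E \<and> path_sum n y}"

definition path_mult :: "'e list \<Rightarrow> 'a \<Rightarrow> 'a" where
  "path_mult \<alpha> x = foldr (\<lambda>f y. D f * y) \<alpha> x"

lemma path_mult_simps [simp]:
  "path_mult [] x = x" "path_mult (f # \<alpha>) x = D f * path_mult \<alpha> x"
  by (simp_all add: path_mult_def)

lemma path_mult_append: "path_mult (\<alpha> @ \<beta>) x = path_mult \<alpha> (path_mult \<beta> x)"
  by (induction \<alpha>) auto

lemma path_mult_mult: "path_mult \<alpha> x * y = path_mult \<alpha> (x * y)"
  by (induction \<alpha>) (auto simp: mult.assoc)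

lemma span_map:
  assumes "\<And>x y. g (x + y) = g x + g y" "\<And>c x. g (c *s x) = c *s g x"
    and "\<And>b. b \<in> B \<Longrightarrow> g b \<in> span C" and "x \<in> span B"
  shows "g x \<in> span C"
proof -
  have "g 0 = 0" using assms(2)[of 0 0] by simp
  show ?thesis
    using assms(4) \<open>g 0 = 0\<close>
    by (induction x rule: span_induct_alt) (auto simp: assms(1-3) intro!: span_add span_scale span_zero)
qed

lemma span_image_explicit:
  assumes "x \<in> span (h ` T)"
  obtains S k where "finite S" "S \<subseteq> T" "x = (\<Sum>\<alpha>\<in>S. k \<alpha> *s h \<alpha>)"
proof -
  obtain t r where t: "finite t" "t \<subseteq> h ` T" "x = (\<Sum>b\<in>t. r b *s b)"
    using assms unfolding span_explicit by blast
  then obtain S where S: "S \<subseteq> T" "inj_on h S" "t = h ` S" by (meson subset_image_inj)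
  show ?thesis
    using that[of S "\<lambda>\<alpha>. r (h \<alpha>)"] S t by (auto simp: sum.reindex finite_image_iff)
qed

lemma paths_pos_span_edge: "path_sum n y \<Longrightarrow> f \<in> arcs E \<Longrightarrow> y * D f \<in> span paths_pos"
proof (induction rule: path_sum.induct)
  case (vertex u n)
  have "D f * V (head E f) \<in> paths_pos"
    unfolding paths_pos_def using vertex path_sum.vertex[of "head E f" 0] by auto
  then have "D f \<in> paths_pos" using vertex by (simp add: D_head)
  then show ?case using vertex by (auto simp: V_D intro: span_base span_zero)
next
  case (edge f' n x)
  then have "D f' * (x * D f) \<in> paths_pos"
    unfolding paths_pos_def by (auto intro: path_sum_edge)
  then show ?case by (simp add: mult.assoc span_base)
qed (auto simp: distrib_right scale_mult_left intro: span_zero span_add span_scale)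

lemma path_sum_right_vertex_span:
  "path_sum n y \<Longrightarrow> a \<in> verts E \<Longrightarrow> y * V a \<in> span ((\<lambda>\<beta>. path_mult \<beta> (V a)) ` {\<beta>. set \<beta> \<subseteq> arcs E})"
proof (induction rule: path_sum.induct)
  case (vertex u n)
  have "V a \<in> (\<lambda>\<beta>. path_mult \<beta> (V a)) ` {\<beta>. set \<beta> \<subseteq> arcs E}"
    by (intro image_eqI[of _ _ "[]"]) auto
  then show ?case using vertex by (auto simp: V_V intro: span_base span_zero)
next
  case (edge f n x)
  have "D f * (x * V a) \<in> span ((\<lambda>\<beta>. path_mult \<beta> (V a)) ` {\<beta>. set \<beta> \<subseteq> arcs E})"
  proof (rule span_map[where g = "\<lambda>x. D f * x"])
    fix b assume "b \<in> (\<lambda>\<beta>. path_mult \<beta> (V a)) ` {\<beta>. set \<beta> \<subseteq> arcs E}"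
    then obtain \<beta> where "b = path_mult \<beta> (V a)" "set \<beta> \<subseteq> arcs E" by auto
    then have "D f * b = path_mult (f # \<beta>) (V a)" "set (f # \<beta>) \<subseteq> arcs E" using edge by auto
    then show "D f * b \<in> span ((\<lambda>\<beta>. path_mult \<beta> (V a)) ` {\<beta>. set \<beta> \<subseteq> arcs E})"
      by (metis (mono_tags, lifting) imageI mem_Collect_eq span_base)
  qed (use edge in \<open>auto simp: distrib_left scale_mult_right\<close>)
  then show ?case by (simp add: mult.assoc)
qed (auto simp: distrib_right scale_mult_left intro: span_zero span_add span_scale)

text \<open>The words run over all nonempty lists of edges. One that is not a closed path at
  \<open>a\<close> has the value 0 here, so no path predicate enters the index set.\<close>

lemma paths_pos_corner_span:
  assumes "x \<in> span paths_pos" "a \<in> verts E"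
  shows "V a * (x * V a) \<in>
    span ((\<lambda>\<alpha>. V a * path_mult \<alpha> (V a)) ` {\<alpha>. \<alpha> \<noteq> [] \<and> set \<alpha> \<subseteq> arcs E})"
proof (rule span_map[where g = "\<lambda>x. V a * (x * V a)", OF _ _ _ assms(1)])
  fix b assume "b \<in> paths_pos"
  then obtain f y n where b: "b = D f * y" "f \<in> arcs E" "path_sum n y"
    unfolding paths_pos_def by blast
  have "V a * (D f * (y * V a)) \<in>
    span ((\<lambda>\<alpha>. V a * path_mult \<alpha> (V a)) ` {\<alpha>. \<alpha> \<noteq> [] \<and> set \<alpha> \<subseteq> arcs E})"
  proof (rule span_map[where g = "\<lambda>x. V a * (D f * x)"])
    show "y * V a \<in> span ((\<lambda>\<beta>. path_mult \<beta> (V a)) ` {\<beta>. set \<beta> \<subseteq> arcs E})"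
      using path_sum_right_vertex_span b assms(2) by blast
    fix b assume "b \<in> (\<lambda>\<beta>. path_mult \<beta> (V a)) ` {\<beta>. set \<beta> \<subseteq> arcs E}"
    then obtain \<beta> where "b = path_mult \<beta> (V a)" "set \<beta> \<subseteq> arcs E" by auto
    then have "V a * (D f * b) = V a * path_mult (f # \<beta>) (V a)" "set (f # \<beta>) \<subseteq> arcs E"
      using \<open>f \<in> arcs E\<close> by auto
    then show "V a * (D f * b) \<in>
      span ((\<lambda>\<alpha>. V a * path_mult \<alpha> (V a)) ` {\<alpha>. \<alpha> \<noteq> [] \<and> set \<alpha> \<subseteq> arcs E})"
      by (metis (mono_tags, lifting) imageI mem_Collect_eq span_base list.distinct(1))
  qed (auto simp: distrib_left scale_mult_right)
  then show "V a * (b * V a) \<in>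
      span ((\<lambda>\<alpha>. V a * path_mult \<alpha> (V a)) ` {\<alpha>. \<alpha> \<noteq> [] \<and> set \<alpha> \<subseteq> arcs E})"
    by (simp add: b mult.assoc)
qed (auto simp: distrib_left distrib_right scale_mult_right scale_mult_left)

lemma path_sum_mult: "path_sum n x \<Longrightarrow> path_sum n' y \<Longrightarrow> path_sum (n + n') (x * y)"
proof (induction rule: path_sum.induct)
  case (vertex u n)
  then show ?case by (auto intro: path_sum_mono[OF vertex_path_sum])
qed (auto simp: distrib_right scale_mult_left mult.assoc intro: path_sum.intros)

end

text \<open>The one consequence of the grading on which the injectivity proof rests: a vertex cannot
  be cancelled by paths of positive length. For the algebra itself it is established in
  \<open>lpa_graded_leavitt_family\<close>.\<close>

locale graded_leavitt_family = leavitt_family +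
  assumes vertex_not_paths_pos:
    "u \<in> verts E \<Longrightarrow> r \<in> span paths_pos \<Longrightarrow> c *s V u + r = 0 \<Longrightarrow> c = 0"
begin

section \<open>Reducing an element of an ideal to a vertex plus longer closed paths\<close>

lemma V_nonzero: "u \<in> verts E \<Longrightarrow> V u \<noteq> 0"
  using vertex_not_paths_pos[of u 0 1] by (auto simp: span_zero)

text \<open>After multiplication by \<open>G f\<close> on the left, the coefficient of the vertex
  \<open>tail E f\<close> stands alone against paths of positive length, so it vanishes. The
  remaining terms can be stripped of their first edge and fall under the induction hypothesis. This
  serves for infinite emitters, where \<open>CK\<close> says nothing.\<close>

lemma path_sum_edge_eq_0D:
  assumes "path_sum n r" "f \<in> arcs E" "r * V (tail E f) = r" "r * D f = 0"
  shows "r = 0"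
  using assms(1,3,4)
proof (induction n arbitrary: r rule: less_induct)
  case (less n)
  obtain k S g where S: "finite S" "S \<subseteq> arcs E" "\<forall>f\<in>S. \<exists>m<n. path_sum m (g f)"
    "r = (\<Sum>u\<in>verts E. k u *s V u) + (\<Sum>f\<in>S. D f * g f)"
    by (rule path_sum_cases[OF less.prems(1)], rule that)
  let ?b = "tail E f"
  have b: "?b \<in> verts E" using assms(2) by simp
  have sumV: "(\<Sum>u\<in>verts E. k u *s V u) * V ?b = k ?b *s V ?b"
    using finite_verts b
    by (simp add: sum_distrib_right scale_mult_left V_V if_distrib[of "\<lambda>x. _ *s x"] cong: if_cong)
  have "r * V ?b = (\<Sum>u\<in>verts E. k u *s V u) * V ?b + (\<Sum>f\<in>S. D f * (g f * V ?b))"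
    by (subst S(4)) (simp only: distrib_right sum_distrib_right mult.assoc)
  then have r: "r = k ?b *s V ?b + (\<Sum>f\<in>S. D f * (g f * V ?b))"
    by (simp only: sumV less.prems(2))
  have G: "G f' * (\<Sum>f\<in>S. D f * h f) = (if f' \<in> S then V (head E f') * h f' else 0)"
    if "f' \<in> arcs E" for f' h
  proof -
    have "G f' * (\<Sum>f\<in>S. D f * h f) = (\<Sum>f\<in>S. if f' = f then V (head E f) * h f else 0)"
      unfolding sum_distrib_left using that S(2) by (intro sum.cong) (auto simp: G_D_assoc)
    then show ?thesis using S(1) by (simp add: sum.delta)
  qed
  have "k ?b *s D f + (\<Sum>f'\<in>S. D f' * (g f' * D f)) = r * D f"
    using assms(2) b by (subst r) (simp add: distrib_right sum_distrib_right rels)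
  then have rf: "k ?b *s D f + (\<Sum>f'\<in>S. D f' * (g f' * D f)) = 0"
    by (simp only: less.prems(3))
  have "k ?b *s V (head E f) + (if f \<in> S then V (head E f) * (g f * D f) else 0) =
      G f * (k ?b *s D f + (\<Sum>f'\<in>S. D f' * (g f' * D f)))"
    using assms(2) by (simp add: distrib_left G scale_mult_right G_D)
  then have 0: "k ?b *s V (head E f) + (if f \<in> S then V (head E f) * (g f * D f) else 0) = 0"
    unfolding rf by simp
  have "(if f \<in> S then V (head E f) * (g f * D f) else 0) \<in> span paths_pos"
  proof (cases "f \<in> S")
    case True
    then obtain m where "path_sum m (g f)" using S(3) by blast
    then have "(V (head E f) * g f) * D f \<in> span paths_pos"
      using assms(2) by (intro paths_pos_span_edge[OF vertex_path_sum]) auto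
    then show ?thesis using True by (simp add: mult.assoc)
  qed (simp add: span_zero)
  then have k: "k ?b = 0" using 0 assms(2) by (intro vertex_not_paths_pos[of "head E f"]) auto
  have "D f' * (g f' * V ?b) = 0" if f': "f' \<in> S" for f'
  proof -
    let ?h = "V (head E f') * (g f' * V ?b)"
    have f'a: "f' \<in> arcs E" using f' S by auto
    obtain m where m: "m < n" "path_sum m (g f')" using S(3) f' by blast
    then have ps: "path_sum m ?h" using f'a b by (intro vertex_path_sum path_sum_vertex) auto
    have Gr: "G f' * r = ?h" using f'a f' by (subst r) (simp add: k G)
    have "?h * D f = 0" unfolding Gr[symmetric] using less.prems(3) by (simp add: mult.assoc)
    moreover have "?h * V ?b = ?h" using b by (simp add: mult.assoc V_V)
    ultimately have "?h = 0" using less.IH[OF m(1) ps] by blast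
    then have "D f' * ?h = 0" by simp
    then show ?thesis using f'a by (simp add: D_V_assoc)
  qed
  then show "r = 0" by (subst r) (simp add: k)
qed

text \<open>Right multiplication by an edge lowers the number of ghosts, so the difficulty lies in
  elements \<open>z\<close> killed by all edges. If \<open>z * V b\<close> is nonzero for such a
  \<open>z\<close>, then \<open>b\<close> is not regular, by \<open>CK\<close>. If \<open>b\<close>
  is a sink, multiplication by \<open>V b\<close> removes every ghost. If \<open>b\<close> is an
  infinite emitter, some edge at \<open>b\<close> differs from the finitely many ghosts of
  \<open>z\<close>; by \<open>path_sum_edge_eq_0D\<close> it forces \<open>z * V b\<close> to be 0
  after all.\<close>

lemma reduce_ghosts:
  assumes "elem m z" "z \<in> I" "z \<noteq> 0"
    and "\<And>x f. x \<in> I \<Longrightarrow> f \<in> arcs E \<Longrightarrow> x * D f \<in> I"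
    and "\<And>x u. x \<in> I \<Longrightarrow> u \<in> verts E \<Longrightarrow> x * V u \<in> I"
  obtains n r where "path_sum n r" "r \<in> I" "r \<noteq> 0"
proof -
  have "\<exists>n r. path_sum n r \<and> r \<in> I \<and> r \<noteq> 0"
    using assms(1-3)
  proof (induction m arbitrary: z rule: less_induct)
    case (less m)
    obtain n r S g where S: "path_sum n r" "finite S" "S \<subseteq> arcs E"
      "\<forall>f\<in>S. \<exists>l<m. elem l (g f)" "z = r + (\<Sum>f\<in>S. g f * G f)"
      by (rule elem_cases[OF less.prems(1)], rule that)
    have zL: "z \<in> L" using less.prems(1) by (auto simp: L_def)
    show ?case
    proof (cases "S = {}")
      case True
      then show ?thesis using S less.prems by auto
    next
      case False
      have zD: "z * D f = r * D f + (if f \<in> S then g f * V (head E f) else 0)" if "f \<in> arcs E" for f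
      proof -
        have "(\<Sum>f'\<in>S. g f' * G f') * D f = (\<Sum>f'\<in>S. if f' = f then g f' * V (head E f') else 0)"
          unfolding sum_distrib_right using that S(3)
          by (intro sum.cong) (auto simp: mult.assoc G_D)
        then show ?thesis using S(2) by (simp add: S(5) distrib_right sum.delta)
      qed
      show ?thesis
      proof (cases "\<exists>f\<in>arcs E. z * D f \<noteq> 0")
        case True
        then obtain f where f: "f \<in> arcs E" "z * D f \<noteq> 0" by blast
        obtain l where l: "l < m" using False S(4) by blast
        have "\<exists>l<m. elem l (z * D f)"
        proof (cases "f \<in> S")
          case True
          then obtain l where "l < m" "elem l (g f)" using S(4) by blast
          then have "elem l (r * D f + g f * V (head E f))"
            using f S(1) by (intro elem.add elem_vertex elem.path[OF path_sum_edge]) auto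
          then show ?thesis using True f \<open>l < m\<close> by (auto simp: zD)
        next
          case False
          then show ?thesis
            using f S(1) l by (intro exI[of _ l]) (auto simp: zD intro: elem.path path_sum_edge)
        qed
        then show ?thesis using less.IH[of _ "z * D f"] f less.prems assms(4) by blast
      next
        case nf: False
        obtain b where b: "b \<in> verts E" "z * V b \<noteq> 0"
          using L_right_vertex[OF zL less.prems(3)] by blast
        have "\<not> (out_arcs E b \<noteq> {} \<and> finite (out_arcs E b))"
        proof
          assume *: "out_arcs E b \<noteq> {} \<and> finite (out_arcs E b)"
          have "z * V b = (\<Sum>f\<in>out_arcs E b. (z * D f) * G f)"
            using CK[OF b(1)] * by (metis (no_types, lifting) mult.assoc sum.cong sum_distrib_left)
          also have "\<dots> = 0"
          proof (intro sum.neutral ballI)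
            fix f assume "f \<in> out_arcs E b"
            then have "z * D f = 0" using nf by auto
            then show "z * D f * G f = 0" by simp
          qed
          finally show False using b(2) by contradiction
        qed
        then consider "out_arcs E b = {}" | "infinite (out_arcs E b)" by blast
        then show ?thesis
        proof cases
          case 1
          have "g f * G f * V b = 0" if "f \<in> S" for f
          proof -
            have "f \<in> arcs E" using that S(3) by auto
            moreover have "tail E f \<noteq> b" using 1 calculation by auto
            ultimately show ?thesis using b(1) by (simp add: mult.assoc G_V)
          qed
          then have "z * V b = r * V b" by (simp add: S(5) distrib_right sum_distrib_right)
          then show ?thesis
            using b S(1) less.prems(2) assms(5)[of z b] path_sum_vertex[OF b(1) S(1)] by metis
        next
          case 2
          then obtain f where f: "f \<in> out_arcs E b" "f \<notin> S"
            using S(2) by (meson finite_subset subsetI)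
          have fa: "f \<in> arcs E" and ft: "tail E f = b" using f(1) by auto
          have "z * D f = 0" using nf fa by blast
          then have "r * D f = 0" using zD[OF fa] f(2) by simp
          moreover have "r * V b * D f = r * D f" using fa ft b(1) by (simp add: mult.assoc V_D)
          moreover have "r * V b * V b = r * V b" using b(1) by (simp add: mult.assoc V_V)
          ultimately have rb: "r * V b = 0"
            using path_sum_edge_eq_0D[OF path_sum_vertex[OF b(1) S(1)] fa] ft by simp
          have "g f * G f * V b = 0" if "f \<in> S" for f
          proof (cases "tail E f = b")
            case True
            have fa: "f \<in> arcs E" using that S(3) by auto
            have "z * D f = r * D f + g f * V (head E f)" using zD[OF fa] that by simp
            moreover have "z * D f = 0" using nf fa by blast
            moreover have "r * D f = r * V b * D f" using True fa by (auto simp: mult.assoc V_D)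
            ultimately have "g f * V (head E f) = 0" using rb by simp
            then have "g f * V (head E f) * G f = 0" by simp
            then show ?thesis using True fa by (simp add: mult.assoc V_G G_V)
          next
            case False
            moreover have "f \<in> arcs E" using that S(3) by auto
            ultimately show ?thesis using b(1) by (simp add: mult.assoc G_V)
          qed
          then have "z * V b = 0" using rb by (simp add: S(5) distrib_right sum_distrib_right)
          then show ?thesis using b by simp
        qed
      qed
    qed
  qed
  then show ?thesis using that by blast
qed

text \<open>If a vertex occurs in \<open>y\<close>, the corner at this vertex isolates it. Otherwise
  some summand \<open>D f * g f\<close> is nonzero, and \<open>G f\<close> strips the first edge
  without killing \<open>y\<close>, as multiplying back by \<open>D f\<close> shows.\<close>

lemma reduce_to_vertex:
  assumes "path_sum n y" "y \<in> I" "y \<noteq> 0"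
    and left_ghost: "\<And>x f. x \<in> I \<Longrightarrow> f \<in> arcs E \<Longrightarrow> G f * x \<in> I"
    and left_vertex: "\<And>x u. x \<in> I \<Longrightarrow> u \<in> verts E \<Longrightarrow> V u * x \<in> I"
    and right_vertex: "\<And>x u. x \<in> I \<Longrightarrow> u \<in> verts E \<Longrightarrow> x * V u \<in> I"
  obtains a c r where "a \<in> verts E" "c \<noteq> 0" "r \<in> span paths_pos" "c *s V a + V a * (r * V a) \<in> I"
proof -
  have "\<exists>a c r. a \<in> verts E \<and> c \<noteq> 0 \<and> r \<in> span paths_pos \<and> c *s V a + V a * (r * V a) \<in> I"
    using assms(1-3)
  proof (induction n arbitrary: y rule: less_induct)
    case (less n)
    obtain k S g where S: "finite S" "S \<subseteq> arcs E" "\<forall>f\<in>S. \<exists>m<n. path_sum m (g f)"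
      "y = (\<Sum>u\<in>verts E. k u *s V u) + (\<Sum>f\<in>S. D f * g f)"
      by (rule path_sum_cases[OF less.prems(1)], rule that)
    show ?case
    proof (cases "\<exists>a\<in>verts E. k a \<noteq> 0")
      case True
      then obtain a where a: "a \<in> verts E" "k a \<noteq> 0" by blast
      have "V a * ((\<Sum>u\<in>verts E. k u *s V u) * V a) = k a *s V a"
        using finite_verts a
        by (simp add: sum_distrib_right sum_distrib_left rels if_distrib[of "\<lambda>x. _ *s x"] 
            if_distrib[of "\<lambda>x. _ * x"] cong: if_cong)
      then have "V a * (y * V a) = k a *s V a + V a * ((\<Sum>f\<in>S. D f * g f) * V a)"
        by (simp add: S(4) distrib_left distrib_right)
      moreover have "(\<Sum>f\<in>S. D f * g f) \<in> span paths_pos"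
        using S(2,3) by (intro span_sum span_base) (unfold paths_pos_def, blast)
      moreover have "V a * (y * V a) \<in> I"
        using less.prems(2) a left_vertex right_vertex by blast
      ultimately show ?thesis using a by metis
    next
      case False
      then have y: "y = (\<Sum>f\<in>S. D f * g f)" by (simp add: S(4))
      then obtain f where f: "f \<in> S" "D f * g f \<noteq> 0"
        using less.prems(3) by (meson sum.not_neutral_contains_not_neutral)
      then have fa: "f \<in> arcs E" using S(2) by auto
      have "G f * y = (\<Sum>f'\<in>S. if f = f' then V (head E f') * g f' else 0)"
        unfolding y sum_distrib_left using fa S(2) by (intro sum.cong) (auto simp: G_D_assoc)
      then have Gy: "G f * y = V (head E f) * g f" using S(1) f by (simp add: sum.delta)
      then have "D f * (G f * y) = D f * g f" using fa by (simp add: D_V_assoc)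
      then have "G f * y \<noteq> 0" using f by auto
      moreover obtain m where "m < n" "path_sum m (g f)" using f S(3) by blast
      ultimately show ?thesis
        using less.IH[of m "G f * y"] left_ghost[OF less.prems(2) fa] vertex_path_sum fa Gy
        by (metis head_in_verts)
    qed
  qed
  then show ?thesis using that by blast
qed

end

section \<open>Surjective endomorphisms fixing the vertices are injective\<close>

text \<open>The situation to which minimality leads in \<open>A_kernel_trivial\<close>. The
  inherited type variables now read \<open>'a\<close> for vertices, \<open>'b\<close> for edges,
  \<open>'c\<close> for scalars and \<open>'d\<close> for the ring.\<close>

locale no_exit_family = graded_leavitt_family +
  fixes \<Gamma> :: "'a set" and nx :: "'a \<Rightarrow> 'b"
  assumes \<Gamma>_verts: "b \<in> \<Gamma> \<Longrightarrow> b \<in> verts E"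
    and \<Gamma>_arcs: "b \<in> \<Gamma> \<Longrightarrow> out_arcs E b = {nx b}"
    and \<Gamma>_closed: "b \<in> \<Gamma> \<Longrightarrow> head E (nx b) \<in> \<Gamma>"
begin

section \<open>Walks along vertices that emit exactly one edge\<close>

abbreviation st :: "'a \<Rightarrow> 'a" where "st b \<equiv> head E (nx b)"

primrec W :: "'a \<Rightarrow> nat \<Rightarrow> 'd" where
  "W b 0 = V b"
| "W b (Suc j) = D (nx b) * W (st b) j"

primrec WG :: "'a \<Rightarrow> nat \<Rightarrow> 'd" where
  "WG b 0 = V b"
| "WG b (Suc j) = WG (st b) j * G (nx b)"

lemma nx: "b \<in> \<Gamma> \<Longrightarrow> nx b \<in> arcs E" "b \<in> \<Gamma> \<Longrightarrow> tail E (nx b) = b"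
  using \<Gamma>_arcs[of b] by (auto simp: out_arcs_def)

lemma nx_unique: "b \<in> \<Gamma> \<Longrightarrow> f \<in> arcs E \<Longrightarrow> tail E f = b \<Longrightarrow> f = nx b"
  using \<Gamma>_arcs[of b] by (auto simp: out_arcs_def)

text \<open>Only one edge leaves \<open>b\<close>, so the sum in \<open>CK\<close> has a single
  term. This is what turns the ghost walk \<open>WG\<close> into an inverse of the walk
  \<open>W\<close> from both sides.\<close>

lemma D_G_nx: "b \<in> \<Gamma> \<Longrightarrow> D (nx b) * G (nx b) = V b"
  using CK[of b] \<Gamma>_arcs[of b] \<Gamma>_verts[of b] by simp

lemma W_path_sum: "b \<in> \<Gamma> \<Longrightarrow> path_sum j (W b j)"
  by (induction j arbitrary: b) (auto intro: path_sum.intros \<Gamma>_verts nx \<Gamma>_closed)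

lemma WG_L: "b \<in> \<Gamma> \<Longrightarrow> WG b j \<in> L"
  by (induction j arbitrary: b) (auto intro: \<Gamma>_verts nx \<Gamma>_closed)

lemma W_L: "b \<in> \<Gamma> \<Longrightarrow> W b j \<in> L"
  using W_path_sum L_path_sum by blast

lemma V_W: "b \<in> \<Gamma> \<Longrightarrow> V b * W b j = W b j"
  by (cases j) (simp_all add: V_V \<Gamma>_verts V_D_assoc nx)

lemma W_V: "b \<in> \<Gamma> \<Longrightarrow> W b j * V ((st ^^ j) b) = W b j"
  by (induction j arbitrary: b)
    (simp_all add: V_V \<Gamma>_verts \<Gamma>_closed mult.assoc del: funpow.simps add: funpow_Suc_right)

lemma W_add: "b \<in> \<Gamma> \<Longrightarrow> W b (i + j) = W b i * W ((st ^^ i) b) j"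
  by (induction i arbitrary: b)
    (simp_all add: V_W \<Gamma>_closed mult.assoc del: funpow.simps add: funpow_Suc_right)

lemma WG_W: "b \<in> \<Gamma> \<Longrightarrow> WG b j * W b j = V ((st ^^ j) b)"
proof (induction j arbitrary: b)
  case (Suc j)
  then show ?case
    by (simp add: mult.assoc G_D_assoc nx V_W \<Gamma>_closed del: funpow.simps add: funpow_Suc_right)
qed (simp add: V_V \<Gamma>_verts)

lemma W_WG: "b \<in> \<Gamma> \<Longrightarrow> W b j * WG b j = V b"
proof (induction j arbitrary: b)
  case (Suc j)
  have "W b (Suc j) * WG b (Suc j) = D (nx b) * (W (st b) j * WG (st b) j) * G (nx b)"
    by (simp add: mult.assoc)
  also have "\<dots> = D (nx b) * G (nx b)"
    using Suc \<Gamma>_closed by (simp add: D_head nx)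
  finally show ?case using Suc D_G_nx by simp
qed (simp add: V_V \<Gamma>_verts)

text \<open>Each ghost meets an edge of the walk and either cancels or gives 0, so a walk as long as
  the ghost bound removes all ghosts.\<close>

lemma elem_W_path_sum: "elem m x \<Longrightarrow> b \<in> \<Gamma> \<Longrightarrow> \<exists>n. path_sum n (x * W b m)"
proof (induction arbitrary: b rule: elem.induct)
  case (path n x m)
  then show ?case using path_sum_mult W_path_sum by blast
next
  case (add m x y)
  obtain n n' where "path_sum n (x * W b m)" "path_sum n' (y * W b m)" using add by meson
  then have "path_sum (max n n') (x * W b m + y * W b m)"
    by (intro path_sum.add; elim path_sum_mono) auto
  then show ?case by (auto simp: distrib_right)
next
  case (ghost f m x)
  have "x * G f * W b (Suc m) = (if f = nx b then x * (V (st b) * W (st b) m) else 0)"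
    using ghost.hyps ghost.prems by (simp add: mult.assoc G_D_assoc nx)
  then show ?case
    using ghost.IH[of "st b"] ghost.prems path_sum.zero by (auto simp: V_W \<Gamma>_closed)
qed

text \<open>There is only one way to go on from \<open>b\<close>, so a path from \<open>b\<close> is
  determined by its length.\<close>

lemma path_sum_walk_span: "path_sum n y \<Longrightarrow> b \<in> \<Gamma> \<Longrightarrow> V b * y \<in> span (range (W b))"
proof (induction arbitrary: b rule: path_sum.induct)
  case (vertex u n)
  have "W b 0 \<in> range (W b)" by blast
  then show ?case using vertex by (auto simp: V_V \<Gamma>_verts intro: span_base span_zero)
next
  case (edge f n x)
  show ?case
  proof (cases "tail E f = b")
    case True
    then have f: "f = nx b" using edge nx_unique by blast
    have "D f * (V (st b) * x) \<in> span (range (W b))"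
    proof (rule span_map[where g = "\<lambda>x. D f * x"])
      show "V (st b) * x \<in> span (range (W (st b)))" using edge \<Gamma>_closed by blast
      fix y assume "y \<in> range (W (st b))"
      then obtain j where "y = W (st b) j" by blast
      then have "D f * y = W b (Suc j)" using f by simp
      then show "D f * y \<in> span (range (W b))" by (metis rangeI span_base)
    qed (auto simp: distrib_left scale_mult_right)
    then show ?thesis using True edge f nx by (simp add: V_D_assoc D_V_assoc \<Gamma>_verts)
  next
    case False
    then show ?thesis using edge by (auto simp: V_D_assoc \<Gamma>_verts span_zero)
  qed
qed (auto simp: distrib_left scale_mult_right intro: span_zero span_add span_scale)

lemma st_pow_closed: "(st ^^ d) a = a \<Longrightarrow> (st ^^ (j * d)) a = a"
proof (induction j)
  case (Suc j)
  have "(st ^^ (Suc j * d)) a = (st ^^ (j * d)) ((st ^^ d) a)"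
    by (metis add.commute comp_apply funpow_add mult_Suc)
  then show ?case using Suc by simp
qed simp

lemma W_pos: "b \<in> \<Gamma> \<Longrightarrow> j > 0 \<Longrightarrow> W b j \<in> paths_pos"
proof (cases j)
  case (Suc i)
  assume "b \<in> \<Gamma>"
  then have "nx b \<in> arcs E" "path_sum i (W (st b) i)" using nx W_path_sum \<Gamma>_closed by auto
  then show ?thesis unfolding paths_pos_def Suc W.simps by blast
qed simp

text \<open>Multiplying by the inverse of the lowest power still present turns this power into the
  vertex \<open>a\<close>, while all others keep positive length; so its coefficient
  vanishes.\<close>

lemma cycle_powers_linear:
  assumes a: "a \<in> \<Gamma>" "(st ^^ d) a = a" "d > 0"
    and "(\<Sum>j\<le>m. k j *s W a (j * d)) = 0" "i \<le> m"
  shows "k i = 0"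
  using assms(5)
proof (induction i rule: less_induct)
  case (less i)
  have ai: "(st ^^ (i * d)) a = a" using st_pow_closed a by blast
  have W: "WG a (i * d) * W a (j * d) = W a ((j - i) * d)" if "i \<le> j" for j
  proof -
    have "j * d = i * d + (j - i) * d" using that by (metis add_mult_distrib le_add_diff_inverse)
    then have "W a (j * d) = W a (i * d) * W a ((j - i) * d)" using W_add[OF a(1)] ai by metis
    then show ?thesis using WG_W[OF a(1)] ai V_W[OF a(1)] by (metis mult.assoc)
  qed
  have "(\<Sum>j\<le>m. k j *s W a (j * d)) = (\<Sum>j\<in>{i..m}. k j *s W a (j * d))"
    using less by (intro sum.mono_neutral_right) auto
  also have "\<dots> = k i *s W a (i * d) + (\<Sum>j\<in>{i<..m}. k j *s W a (j * d))"
    using less.prems by (subst sum.head) auto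
  finally have "k i *s W a (i * d) + (\<Sum>j\<in>{i<..m}. k j *s W a (j * d)) = 0" using assms(4) by simp
  then have "WG a (i * d) * (k i *s W a (i * d) + (\<Sum>j\<in>{i<..m}. k j *s W a (j * d))) = 0" by simp
  moreover have "WG a (i * d) * (k i *s W a (i * d) + (\<Sum>j\<in>{i<..m}. k j *s W a (j * d)))
     = k i *s V a + (\<Sum>j\<in>{i<..m}. k j *s W a ((j - i) * d))"
    using W[of i] by (simp add: distrib_left sum_distrib_left scale_mult_right W)
  moreover have "(\<Sum>j\<in>{i<..m}. k j *s W a ((j - i) * d)) \<in> span paths_pos"
    using a by (intro span_sum span_scale span_base W_pos) auto
  ultimately show ?case using vertex_not_paths_pos \<Gamma>_verts[OF a(1)] by metis
qed

lemma cycle_powers_independent: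
  assumes a: "a \<in> \<Gamma>" "(st ^^ d) a = a" "d > 0"
  shows "inj_on (\<lambda>j. W a (j * d)) {..m}" "independent ((\<lambda>j. W a (j * d)) ` {..m})"
proof -
  show inj: "inj_on (\<lambda>j. W a (j * d)) {..m}"
  proof (rule inj_onI, rule ccontr)
    fix i j assume ij: "i \<in> {..m}" "j \<in> {..m}" "W a (i * d) = W a (j * d)" "i \<noteq> j"
    \<comment> \<open>The coefficients of the relation "power \<open>i\<close> minus power
      \<open>j\<close>".\<close>
    define k :: "nat \<Rightarrow> 'c" where "k = (\<lambda>l. (if l = i then 1 else 0) - (if l = j then 1 else 0))"
    have "(\<Sum>l\<le>m. k l *s W a (l * d)) = 0"
      using ij by (simp add: k_def scale_left_diff_distrib sum_subtractf if_distrib[of "\<lambda>x. x *s _"] cong: if_cong)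
    then have "k i = 0" using cycle_powers_linear[OF a] ij by blast
    then show False using ij by (simp add: k_def)
  qed
  show "independent ((\<lambda>j. W a (j * d)) ` {..m})"
  proof (rule independent_if_scalars_zero)
    fix f x assume *: "(\<Sum>x\<in>(\<lambda>j. W a (j * d)) ` {..m}. f x *s x) = 0"
      "x \<in> (\<lambda>j. W a (j * d)) ` {..m}"
    from *(1) have "(\<Sum>j\<le>m. f (W a (j * d)) *s W a (j * d)) = 0"
      by (subst (asm) sum.reindex[OF inj]) simp
    then show "f x = 0" using cycle_powers_linear[OF a, where m = m and k = "\<lambda>j. f (W a (j * d))"] *(2) by auto
  qed simp
qed

end

text \<open>\<open>A\<close> will come from a map on cosets and is arbitrary outside
  \<open>L\<close>, which is why every law carries membership conditions.\<close>

locale leavitt_endo = graded_leavitt_family +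
  fixes A :: "'d \<Rightarrow> 'd"
  assumes A_L: "x \<in> L \<Longrightarrow> A x \<in> L"
    and A_add: "x \<in> L \<Longrightarrow> y \<in> L \<Longrightarrow> A (x + y) = A x + A y"
    and A_mult: "x \<in> L \<Longrightarrow> y \<in> L \<Longrightarrow> A (x * y) = A x * A y"
    and A_scale: "x \<in> L \<Longrightarrow> A (c *s x) = c *s A x"
    and A_V: "u \<in> verts E \<Longrightarrow> A (V u) = V u"
    and A_surj: "y \<in> L \<Longrightarrow> \<exists>x\<in>L. A x = y"
begin

lemma A_0: "A 0 = 0"
  using A_scale[of 0 0] by simp

lemma A_sum: "(\<And>i. i \<in> T \<Longrightarrow> g i \<in> L) \<Longrightarrow> A (\<Sum>i\<in>T. g i) = (\<Sum>i\<in>T. A (g i))"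
  by (induction T rule: infinite_finite_induct) (auto simp: A_0 A_add L_sum)

end

section \<open>A surjective endomorphism admits no relation on a cycle without exit\<close>

locale no_exit_endo = no_exit_family + leavitt_endo
begin

text \<open>Reduction of powers modulo a monic polynomial of degree \<open>d\<close>. The walks with
  lengths in \<open>T\<close> return to \<open>a\<close>, so that a further walk from
  \<open>a\<close> can be appended to each of them.\<close>

lemma A_walk_span:
  assumes a: "a \<in> \<Gamma>" "(st ^^ d) a = a"
    and T: "T \<subseteq> {..<d}" "\<And>l. l \<in> T \<Longrightarrow> (st ^^ l) a = a"
    and "A (W a d) = (\<Sum>l\<in>T. k l *s A (W a l))"
  shows "A (W a m) \<in> span ((\<lambda>l. A (W a l)) ` {..<d})"
proof (induction m rule: less_induct)
  case (less m)
  show ?case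
  proof (cases "m < d")
    case True
    then show ?thesis by (intro span_base) auto
  next
    case False
    have "A (W a m) = A (W a d) * A (W a (m - d))"
      using False W_add[OF a(1), of d "m - d"] a W_L A_mult by simp
    also have "\<dots> = (\<Sum>l\<in>T. k l *s A (W a (l + (m - d))))"
      unfolding assms(5) sum_distrib_right
      using T W_add[OF a(1)] W_L[OF a(1)] by (intro sum.cong) (auto simp: scale_mult_left A_mult)
    also have "\<dots> \<in> span ((\<lambda>l. A (W a l)) ` {..<d})"
      using T False by (intro span_sum span_scale less.IH) auto
    finally show ?thesis .
  qed
qed

text \<open>A dimension count: the \<open>d + 1\<close> independent elements
  \<open>W a (j * d)\<close> with \<open>j \<le> d\<close> would lie in a space spanned by
  \<open>d\<close> elements. Their preimages \<open>z j\<close> may contain ghosts. A long walk on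
  the right clears these and makes \<open>A_walk_span\<close> applicable; afterwards its image is
  removed again by means of the right inverse \<open>A (WG a M)\<close>.\<close>

lemma no_relation_on_cycle:
  assumes a: "a \<in> \<Gamma>" "(st ^^ d) a = a" "d > 0"
    and T: "T \<subseteq> {..<d}" "\<And>l. l \<in> T \<Longrightarrow> (st ^^ l) a = a"
  shows "A (W a d) \<noteq> (\<Sum>l\<in>T. k l *s A (W a l))"
proof
  assume *: "A (W a d) = (\<Sum>l\<in>T. k l *s A (W a l))"
  let ?U = "span ((\<lambda>l. A (W a l)) ` {..<d})"
  have "\<forall>j. \<exists>z. z \<in> L \<and> A z = W a (j * d)" using A_surj W_L[OF a(1)] by blast
  then obtain z where z: "\<And>j. z j \<in> L" "\<And>j. A (z j) = W a (j * d)" by metis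
  then have "\<forall>j. \<exists>m. elem m (z j)" by (auto simp: L_def)
  then obtain m where m: "\<And>j. elem (m j) (z j)" by metis
  \<comment> \<open>A common bound for the ghosts in all \<open>d + 1\<close> preimages, taken as a
    multiple of \<open>d\<close> so that the walk returns to \<open>a\<close>.\<close>
  define M where "M = Max (m ` {..d}) * d"
  have Ma: "(st ^^ M) a = a" unfolding M_def using st_pow_closed a by blast
  have mM: "m j \<le> M" if "j \<le> d" for j
  proof -
    have "m j \<le> Max (m ` {..d})" using that by auto
    also have "\<dots> \<le> Max (m ` {..d}) * d" using a(3) by (metis One_nat_def Suc_leI mult.right_neutral mult_le_mono order_refl)
    also have "\<dots> = M" unfolding M_def ..
    finally show ?thesis .
  qed
  have aL: "V a \<in> L" "W a M \<in> L" "WG a M \<in> L" using a \<Gamma>_verts W_L WG_L by auto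
  have AWG: "A (W a M) * A (WG a M) = V a"
    using W_WG[OF a(1)] A_mult[OF aL(2,3)] A_V[OF \<Gamma>_verts[OF a(1)]] by simp
  have "W a (j * d) \<in> span ((\<lambda>l. A (W a l) * A (WG a M)) ` {..<d})" if j: "j \<le> d" for j
  proof -
    obtain n where "path_sum n (z j * W a M)"
      using elem_W_path_sum[OF elem_mono[OF m mM[OF j]] a(1)] by blast
    then have "V a * (z j * W a M) \<in> span (range (W a))" using path_sum_walk_span a(1) by blast
    \<comment> \<open>Membership in \<open>L\<close> is proved along with the claim, because
      \<open>A\<close> is additive on \<open>L\<close> only.\<close>
    then have "V a * (z j * W a M) \<in> L \<and> A (V a * (z j * W a M)) \<in> ?U"
    proof (induction rule: span_induct_alt)
      case (step c x y)
      then obtain l where "x = W a l" by blast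
      then show ?case
        using step A_walk_span[OF a(1,2) T *, of l] W_L[OF a(1), of l]
        by (auto simp: A_add A_scale intro!: span_add span_scale)
    qed (simp add: A_0 span_zero)
    then have "A (V a * (z j * W a M)) \<in> ?U" by blast
    moreover have "A (V a * (z j * W a M)) = W a (j * d) * A (W a M)"
      using A_V[OF \<Gamma>_verts[OF a(1)]] z aL V_W[OF a(1)]
      by (simp add: A_mult mult.assoc[symmetric])
    ultimately have "W a (j * d) * A (W a M) \<in> ?U" by simp
    then have "(W a (j * d) * A (W a M)) * A (WG a M) \<in> span ((\<lambda>l. A (W a l) * A (WG a M)) ` {..<d})"
      by (rule span_map[where g = "\<lambda>x. x * A (WG a M)", rotated -1])
        (auto simp: distrib_right scale_mult_left intro: span_base)
    moreover have "(W a (j * d) * A (W a M)) * A (WG a M) = W a (j * d)"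
      using W_V[OF a(1), of "j * d"] st_pow_closed[OF a(2)] by (simp add: mult.assoc AWG)
    ultimately show ?thesis by simp
  qed
  then have "(\<lambda>j. W a (j * d)) ` {..d} \<subseteq> span ((\<lambda>l. A (W a l) * A (WG a M)) ` {..<d})" by auto
  then have "card ((\<lambda>j. W a (j * d)) ` {..d}) \<le> card ((\<lambda>l. A (W a l) * A (WG a M)) ` {..<d})"
    using independent_span_bound cycle_powers_independent(2)[OF a] by blast
  also have "\<dots> \<le> d" using card_image_le[of "{..<d}"] by simp
  finally show False using card_image[OF cycle_powers_independent(1)[OF a, of d]] by simp
qed

end

context no_exit_family
begin

primrec walk :: "'a \<Rightarrow> nat \<Rightarrow> 'b list" where
  "walk b 0 = []"
| "walk b (Suc j) = nx b # walk (st b) j"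

text \<open>Each edge is forced by the vertex reached before. Thus words with nonzero value are
  determined by their lengths, and a set of words becomes a set of exponents.\<close>

lemma path_mult_walk:
  assumes "b \<in> \<Gamma>" "u \<in> verts E" "set \<alpha> \<subseteq> arcs E" "V b * path_mult \<alpha> (V u) \<noteq> 0"
  shows "\<alpha> = walk b (length \<alpha>) \<and> V b * path_mult \<alpha> (V u) = W b (length \<alpha>) \<and>
    (st ^^ length \<alpha>) b = u"
  using assms
proof (induction \<alpha> arbitrary: b)
  case Nil
  then show ?case by (simp add: V_V \<Gamma>_verts split: if_splits)
next
  case (Cons f \<alpha>)
  then have fa: "f \<in> arcs E" by simp
  have "tail E f = b"
    using Cons.prems fa by (simp add: V_D_assoc \<Gamma>_verts split: if_splits)
  then have f: "f = nx b" using nx_unique fa Cons.prems(1) by blast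
  have b: "st b \<in> \<Gamma>" "st b \<in> verts E" using Cons.prems(1) \<Gamma>_closed \<Gamma>_verts by auto
  have eq: "V b * path_mult (f # \<alpha>) (V u) = D f * (V (st b) * path_mult \<alpha> (V u))"
    using f fa b Cons.prems(1) by (simp add: V_D_assoc D_V_assoc \<Gamma>_verts nx)
  then have "V (st b) * path_mult \<alpha> (V u) \<noteq> 0" using Cons.prems(4) by auto
  then have "\<alpha> = walk (st b) (length \<alpha>) \<and> V (st b) * path_mult \<alpha> (V u) = W (st b) (length \<alpha>) \<and>
    (st ^^ length \<alpha>) (st b) = u"
    using Cons.IH[of "st b"] Cons.prems b by simp
  then show ?case using f eq by (auto simp del: funpow.simps simp add: funpow_Suc_right)
qed

end

section \<open>Relations in the kernel with the least number of terms\<close>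

context leavitt_endo
begin

text \<open>Zero coefficients and words that are not closed paths at \<open>a\<close> are tolerated;
  both are ruled out when \<open>S\<close> has minimal size. The constant coefficient
  \<open>c\<close> is an argument because conjugation by an edge preserves it.\<close>

definition relation :: "'a \<Rightarrow> 'b list set \<Rightarrow> ('b list \<Rightarrow> 'c) \<Rightarrow> 'c \<Rightarrow> bool" where
  "relation a S k c \<longleftrightarrow> a \<in> verts E \<and> finite S \<and> (\<forall>\<alpha>\<in>S. \<alpha> \<noteq> [] \<and> set \<alpha> \<subseteq> arcs E) \<and> c \<noteq> 0 \<and>
    A (c *s V a + (\<Sum>\<alpha>\<in>S. k \<alpha> *s (V a * path_mult \<alpha> (V a)))) = 0"

lemma path_mult_L: "set \<alpha> \<subseteq> arcs E \<Longrightarrow> x \<in> L \<Longrightarrow> path_mult \<alpha> x \<in> L"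
  by (induction \<alpha>) auto

lemma exists_relation:
  assumes "z \<in> L" "z \<noteq> 0" "A z = 0"
  obtains a S k c where "relation a S k c"
proof -
  define I where "I = {x \<in> L. A x = 0}"
  have left: "y * x \<in> I" if "x \<in> I" "y \<in> L" for x y
    using that by (simp add: I_def A_mult)
  have right: "x * y \<in> I" if "x \<in> I" "y \<in> L" for x y
    using that by (simp add: I_def A_mult)
  obtain m where "elem m z" using assms(1) by (auto simp: L_def)
  moreover have "z \<in> I" using assms by (simp add: I_def)
  ultimately obtain n r where r: "path_sum n r" "r \<in> I" "r \<noteq> 0"
    using reduce_ghosts[of m z I] assms(2) right by blast
  obtain a c x where x: "a \<in> verts E" "c \<noteq> 0" "x \<in> span paths_pos" "c *s V a + V a * (x * V a) \<in> I"
    using reduce_to_vertex[OF r] left right by blast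
  obtain S k where S: "finite S" "S \<subseteq> {\<alpha>. \<alpha> \<noteq> [] \<and> set \<alpha> \<subseteq> arcs E}"
      "V a * (x * V a) = (\<Sum>\<alpha>\<in>S. k \<alpha> *s (V a * path_mult \<alpha> (V a)))"
    by (rule span_image_explicit[OF paths_pos_corner_span[OF x(3,1)]], rule that)
  have "relation a S k c"
    unfolding relation_def using x S unfolding I_def by auto
  then show ?thesis using that by blast
qed

text \<open>Passing from \<open>y\<close> to \<open>G f * (y * D f)\<close> kills the words that do
  not begin with \<open>f\<close> and rotates the others, so that closed paths at \<open>a\<close>
  become closed paths at \<open>head E f\<close>. The number of terms never grows, and it drops as
  soon as one word begins differently.\<close>

lemma relation_step:
  assumes "relation a S k c" "f \<in> arcs E" "tail E f = a"
  obtains k' where "relation (head E f) ((\<lambda>\<alpha>. tl \<alpha> @ [f]) ` {\<alpha> \<in> S. hd \<alpha> = f}) k' c"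
proof -
  define y where "y = c *s V a + (\<Sum>\<alpha>\<in>S. k \<alpha> *s (V a * path_mult \<alpha> (V a)))"
  have S: "a \<in> verts E" "finite S" "\<And>\<alpha>. \<alpha> \<in> S \<Longrightarrow> \<alpha> \<noteq> []" "\<And>\<alpha>. \<alpha> \<in> S \<Longrightarrow> set \<alpha> \<subseteq> arcs E"
    "c \<noteq> 0" "A y = 0"
    using assms(1) unfolding relation_def y_def by auto
  let ?w = "head E f" and ?S = "{\<alpha> \<in> S. hd \<alpha> = f}" and ?h = "\<lambda>\<alpha>. tl \<alpha> @ [f]"
  have w: "?w \<in> verts E" using assms(2) by simp
  have yL: "y \<in> L" unfolding y_def using S by (intro L_add L_scale L_sum L_mult path_mult_L) auto
  have summand: "G f * ((V a * path_mult \<alpha> (V a)) * D f) =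
      (if hd \<alpha> = f then V ?w * path_mult (?h \<alpha>) (V ?w) else 0)" if \<alpha>: "\<alpha> \<in> S" for \<alpha>
  proof -
    obtain g \<beta> where g: "\<alpha> = g # \<beta>" using S(3)[OF \<alpha>] by (cases \<alpha>) auto
    have ga: "g \<in> arcs E" using S(4)[OF \<alpha>] g by simp
    have "G f * ((V a * path_mult \<alpha> (V a)) * D f) = G f * (D g * path_mult \<beta> (V a * D f))"
      using S(1) assms(2,3) g by (simp add: mult.assoc G_V_assoc path_mult_mult)
    also have "V a * D f = D f * V ?w" using assms(2,3) by (simp add: tail_D[of f, simplified] D_head V_D S(1))
    finally show ?thesis
      using assms(2) ga g by (simp add: G_D_assoc path_mult_append)
  qed
  \<comment> \<open>All words in question begin with \<open>f\<close>, so the rotation can be undone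
    and no two terms are merged.\<close>
  have inj: "inj_on ?h ?S"
  proof (rule inj_onI)
    fix \<alpha> \<beta> assume *: "\<alpha> \<in> ?S" "\<beta> \<in> ?S" "?h \<alpha> = ?h \<beta>"
    then have "tl \<alpha> = tl \<beta>" "hd \<alpha> = hd \<beta>" by simp_all
    then show "\<alpha> = \<beta>" using *(1,2) S(3) by (metis (no_types, lifting) list.expand mem_Collect_eq)
  qed
  define k' where "k' = (\<lambda>\<beta>. k (inv_into ?S ?h \<beta>))"
  have "G f * (y * D f) = c *s V ?w + (\<Sum>\<alpha>\<in>S. k \<alpha> *s (G f * ((V a * path_mult \<alpha> (V a)) * D f)))"
    using assms(2,3) S(1)
    by (simp add: y_def distrib_left distrib_right sum_distrib_left sum_distrib_right rels)
  also have "(\<Sum>\<alpha>\<in>S. k \<alpha> *s (G f * ((V a * path_mult \<alpha> (V a)) * D f))) =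
      (\<Sum>\<alpha>\<in>S. if hd \<alpha> = f then k \<alpha> *s (V ?w * path_mult (?h \<alpha>) (V ?w)) else 0)"
    by (intro sum.cong refl) (simp only: summand, simp)
  also have "\<dots> = (\<Sum>\<alpha>\<in>?S. k \<alpha> *s (V ?w * path_mult (?h \<alpha>) (V ?w)))"
    using S(2) by (intro sum.mono_neutral_cong_right) auto
  also have "\<dots> = (\<Sum>\<beta>\<in>?h ` ?S. k' \<beta> *s (V ?w * path_mult \<beta> (V ?w)))"
    unfolding sum.reindex[OF inj] k'_def by (intro sum.cong refl) (simp only: o_def inv_into_f_f[OF inj])
  finally have "A (c *s V ?w + (\<Sum>\<beta>\<in>?h ` ?S. k' \<beta> *s (V ?w * path_mult \<beta> (V ?w)))) = A (G f * (y * D f))"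
    by simp
  also have "\<dots> = 0" using yL assms(2) S(6) by (simp add: A_mult)
  finally have "relation ?w (?h ` ?S) k' c"
    unfolding relation_def using w S assms(2) by (auto dest!: list.set_sel(2)[rotated])
  then show ?thesis using that by blast
qed

text \<open>\<open>N\<close> is the minimum over all vertices at once. Conjugation of a minimal
  relation at \<open>a\<close> therefore gives a minimal relation at the next vertex, and the set
  \<open>\<Gamma>\<close> of vertices that carry one is closed under successors.\<close>

theorem A_kernel_trivial:
  assumes "z \<in> L" "A z = 0"
  shows "z = 0"
proof (rule ccontr)
  assume "z \<noteq> 0"
  define ex where "ex = (\<lambda>a S. \<exists>k c. relation a S k c)"
  define N where "N = (LEAST n. \<exists>a S. ex a S \<and> card S = n)"
  define mn where "mn = (\<lambda>a S. ex a S \<and> card S = N)"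
  define \<Gamma> where "\<Gamma> = {a. \<exists>S. mn a S}"
  have "\<exists>n a S. ex a S \<and> card S = n"
    using exists_relation[OF assms(1) \<open>z \<noteq> 0\<close> assms(2)] unfolding ex_def by metis
  then have "\<exists>a S. ex a S \<and> card S = N" unfolding N_def by (rule LeastI_ex)
  then obtain a S where aS: "mn a S" unfolding mn_def by blast
  have least: "N \<le> card S" if "ex a S" for a S
    unfolding N_def using that by (intro Least_le) auto
  have rel: "a \<in> verts E" "finite S" "\<And>\<alpha>. \<alpha> \<in> S \<Longrightarrow> \<alpha> \<noteq> [] \<and> set \<alpha> \<subseteq> arcs E" if "mn a S" for a S
    using that unfolding mn_def ex_def relation_def by auto
  \<comment> \<open>A term with value 0 could be dropped, leaving a relation with fewer than
    \<open>N\<close> terms.\<close>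
  have nonzero: "k \<alpha> *s (V a * path_mult \<alpha> (V a)) \<noteq> 0"
    if "mn a S" "\<alpha> \<in> S" "relation a S k c" for a S \<alpha> k c
  proof
    assume 0: "k \<alpha> *s (V a * path_mult \<alpha> (V a)) = 0"
    have fin: "finite S" using rel that by blast
    have "(\<Sum>\<alpha>\<in>S. k \<alpha> *s (V a * path_mult \<alpha> (V a))) = (\<Sum>\<alpha>\<in>S - {\<alpha>}. k \<alpha> *s (V a * path_mult \<alpha> (V a)))"
      using 0 fin that(2) by (simp add: sum.remove)
    then have "relation a (S - {\<alpha>}) k c" using that(3) unfolding relation_def by auto
    then have "N \<le> card (S - {\<alpha>})" using least ex_def by blast
    then show False
      using that fin card_gt_0_iff[of S] unfolding mn_def by (auto simp: card_Diff_singleton)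
  qed
  \<comment> \<open>A nonzero multiple of a vertex is not in the kernel, because \<open>A\<close>
    fixes it.\<close>
  have nonempty: "S \<noteq> {}" if mn: "mn a S" for a S
  proof
    assume "S = {}"
    then obtain k c where "relation a {} k c" using mn unfolding mn_def ex_def by blast
    then have "c *s V a = 0" "c \<noteq> 0" "a \<in> verts E"
      unfolding relation_def by (auto simp: A_scale A_V)
    then show False using V_nonzero by simp
  qed
  \<comment> \<open>The words that begin with \<open>f\<close> form a subset of \<open>S\<close>
    which, after rotation, still has at least \<open>N\<close> elements; so it is all of
    \<open>S\<close>. As \<open>f\<close> is any edge leaving \<open>a\<close> and \<open>S\<close>
    is nonempty, there cannot be two such edges.\<close>
  have step: "(\<forall>\<alpha>\<in>S. hd \<alpha> = f) \<and> head E f \<in> \<Gamma>" if mn: "mn a S" "f \<in> out_arcs E a" for a S f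
  proof -
    have f: "f \<in> arcs E" "tail E f = a" using mn(2) by auto
    obtain k c where kc: "relation a S k c" using mn(1) unfolding mn_def ex_def by blast
    obtain k' where k': "relation (head E f) ((\<lambda>\<alpha>. tl \<alpha> @ [f]) ` {\<alpha> \<in> S. hd \<alpha> = f}) k' c"
      by (rule relation_step[OF kc f])
    then have ex: "ex (head E f) ((\<lambda>\<alpha>. tl \<alpha> @ [f]) ` {\<alpha> \<in> S. hd \<alpha> = f})" unfolding ex_def by blast
    have fin: "finite S" using rel mn by blast
    have "N \<le> card ((\<lambda>\<alpha>. tl \<alpha> @ [f]) ` {\<alpha> \<in> S. hd \<alpha> = f})" using least ex by blast
    moreover have "\<dots> \<le> card {\<alpha> \<in> S. hd \<alpha> = f}" using fin by (intro card_image_le) auto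
    moreover have "\<dots> \<le> N" using fin mn(1) unfolding mn_def by (metis (no_types, lifting) card_mono mem_Collect_eq subsetI)
    ultimately have "card {\<alpha> \<in> S. hd \<alpha> = f} = card S"
      "card ((\<lambda>\<alpha>. tl \<alpha> @ [f]) ` {\<alpha> \<in> S. hd \<alpha> = f}) = N"
      using mn(1) unfolding mn_def by linarith+
    then show ?thesis
      using card_subset_eq[OF fin, of "{\<alpha> \<in> S. hd \<alpha> = f}"] ex unfolding \<Gamma>_def mn_def by blast
  qed
  have hd_out: "hd \<alpha> \<in> out_arcs E a" if mn: "mn a S" "\<alpha> \<in> S" for a S \<alpha>
  proof -
    obtain k c where "relation a S k c" using mn(1) unfolding mn_def ex_def by blast
    then have nz: "V a * path_mult \<alpha> (V a) \<noteq> 0" using nonzero[OF mn] by fastforce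
    obtain f \<beta> where f: "\<alpha> = f # \<beta>" "f \<in> arcs E" using rel(3)[OF mn] by (cases \<alpha>) auto
    have "a = tail E f"
      using nz f rel(1)[OF mn(1)] by (simp add: V_D_assoc split: if_splits)
    then show ?thesis using f by simp
  qed
  have out: "\<exists>f. out_arcs E a = {f} \<and> head E f \<in> \<Gamma>" if a: "a \<in> \<Gamma>" for a
  proof -
    obtain S where S: "mn a S" using a unfolding \<Gamma>_def by blast
    then obtain \<alpha> where \<alpha>: "\<alpha> \<in> S" using nonempty by blast
    have "out_arcs E a \<subseteq> {hd \<alpha>}"
    proof
      fix f assume f: "f \<in> out_arcs E a"
      show "f \<in> {hd \<alpha>}" using step[OF S f] \<alpha> by simp
    qed
    then have "out_arcs E a = {hd \<alpha>}" using hd_out[OF S \<alpha>] by (metis subset_singletonD empty_iff)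
    then show ?thesis using step[OF S hd_out[OF S \<alpha>], THEN conjunct2] by blast
  qed
  define nx where "nx = (\<lambda>a. SOME f. out_arcs E a = {f})"
  have nx: "out_arcs E a = {nx a} \<and> head E (nx a) \<in> \<Gamma>" if "a \<in> \<Gamma>" for a
    using out[OF that] unfolding nx_def by (metis (mono_tags) singleton_inject someI_ex)
  interpret no_exit_endo E scale V D G \<Gamma> nx A
    by unfold_locales (use nx rel(1) \<Gamma>_def in blast)+
  have a: "a \<in> \<Gamma>" using aS unfolding \<Gamma>_def by blast
  obtain k c where kc: "relation a S k c" using aS unfolding mn_def ex_def by blast
  have fin: "finite S" using rel aS by blast
  have walk: "\<alpha> = walk a (length \<alpha>)" "V a * path_mult \<alpha> (V a) = W a (length \<alpha>)"
      "(st ^^ length \<alpha>) a = a" "k \<alpha> \<noteq> 0" if "\<alpha> \<in> S" for \<alpha>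
    using path_mult_walk[OF a \<Gamma>_verts[OF a], of \<alpha>] nonzero[OF aS that kc] rel(3)[OF aS that] by auto
  have "Max (length ` S) \<in> length ` S" using fin nonempty[OF aS] by (intro Max_in) auto
  then obtain \<alpha> where \<alpha>: "\<alpha> \<in> S" "length \<alpha> = Max (length ` S)" by auto
  define d where "d = length \<alpha>"
  \<comment> \<open>A word in \<open>S\<close> is determined by its length, so the longest one,
    \<open>\<alpha>\<close>, is strictly longer than the others.\<close>
  have le: "length \<beta> < d" if "\<beta> \<in> S - {\<alpha>}" for \<beta>
  proof -
    have "length \<beta> \<le> d" using that fin unfolding d_def \<alpha>(2) by auto
    moreover have "length \<beta> \<noteq> d" using walk(1)[of \<beta>] walk(1)[OF \<alpha>(1)] that unfolding d_def by auto
    ultimately show ?thesis by simp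
  qed
  have inj: "inj_on length (S - {\<alpha>})"
    by (rule inj_onI) (metis DiffD1 walk(1))
  have d: "d > 0" using rel(3)[OF aS \<alpha>(1)] unfolding d_def by simp
  let ?T = "length ` (S - {\<alpha>})"
  have T0: "0 \<notin> ?T" using rel(3)[OF aS] by auto
  \<comment> \<open>The relation solved for the longest walk. Exponent 0 is free for the constant
    coefficient \<open>c\<close>, since the words in \<open>S\<close> are nonempty.\<close>
  define k' where "k' = (\<lambda>l. - (inverse (k \<alpha>) * (if l = 0 then c else k (walk a l))))"
  have AW: "A (c *s V a + (\<Sum>\<beta>\<in>S. k \<beta> *s (V a * path_mult \<beta> (V a)))) =
      c *s A (W a 0) + (\<Sum>\<beta>\<in>S. k \<beta> *s A (W a (length \<beta>)))"
    using W_L[OF a] a by (simp add: A_add A_scale A_sum L_sum walk(2) \<Gamma>_verts cong: sum.cong)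
  have "c *s A (W a 0) + (\<Sum>\<beta>\<in>S. k \<beta> *s A (W a (length \<beta>))) = 0"
    using kc unfolding relation_def AW by simp
  then have "k \<alpha> *s A (W a d) = - (c *s A (W a 0) + (\<Sum>\<beta>\<in>S - {\<alpha>}. k \<beta> *s A (W a (length \<beta>))))"
    using fin \<alpha>(1) by (simp add: sum.remove d_def add_eq_0_iff algebra_simps)
  then have "inverse (k \<alpha>) *s (k \<alpha> *s A (W a d)) =
      inverse (k \<alpha>) *s (- (c *s A (W a 0) + (\<Sum>\<beta>\<in>S - {\<alpha>}. k \<beta> *s A (W a (length \<beta>)))))" by simp
  then have "A (W a d) = k' 0 *s A (W a 0) + (\<Sum>\<beta>\<in>S - {\<alpha>}. k' (length \<beta>) *s A (W a (length \<beta>)))"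
  proof -
    have "(\<Sum>\<beta>\<in>S - {\<alpha>}. k' (length \<beta>) *s A (W a (length \<beta>))) =
        (\<Sum>\<beta>\<in>S - {\<alpha>}. - (inverse (k \<alpha>) * k \<beta>) *s A (W a (length \<beta>)))"
      using walk(1) rel(3)[OF aS] by (intro sum.cong refl) (auto simp: k'_def)
    moreover have "inverse (k \<alpha>) *s (- (c *s A (W a 0) + (\<Sum>\<beta>\<in>S - {\<alpha>}. k \<beta> *s A (W a (length \<beta>)))))
      = k' 0 *s A (W a 0) + (\<Sum>\<beta>\<in>S - {\<alpha>}. - (inverse (k \<alpha>) * k \<beta>) *s A (W a (length \<beta>)))"
      by (simp add: k'_def scale_right_distrib scale_right_diff_distrib scale_sum_right sum_negf)
    ultimately show ?thesis
      using \<open>inverse (k \<alpha>) *s (k \<alpha> *s A (W a d)) = _\<close> walk(4)[OF \<alpha>(1)] by simp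
  qed
  also have "\<dots> = (\<Sum>l\<in>insert 0 ?T. k' l *s A (W a l))"
    using fin T0 by (simp add: sum.reindex[OF inj] del: W.simps)
  finally have "A (W a d) = (\<Sum>l\<in>insert 0 ?T. k' l *s A (W a l))" .
  moreover have "A (W a d) \<noteq> (\<Sum>l\<in>insert 0 ?T. k' l *s A (W a l))"
    using a walk(3)[OF \<alpha>(1)] d le walk(3) unfolding d_def[symmetric]
    by (intro no_relation_on_cycle) auto
  ultimately show False by contradiction
qed

end

section \<open>Twisting a Leavitt family by an invertible matrix\<close>

context leavitt_family
begin

definition unit :: 'a where
  "unit = (\<Sum>u\<in>verts E. V u)"

lemma unit_right [simp]: "x \<in> L \<Longrightarrow> x * unit = x"
  and unit_left [simp]: "x \<in> L \<Longrightarrow> unit * x = x"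
  by (simp_all add: unit_def V_unit_right V_unit_left)

text \<open>Associativity of the product of q, p and a column \<open>a\<close>. The column must lie
  in \<open>L\<close>, as \<open>unit\<close> acts as an identity only there.\<close>

lemma matrix_cancel_left:
  fixes n :: nat
  assumes "\<And>i j. i < n \<Longrightarrow> j < n \<Longrightarrow> (\<Sum>k<n. q i k * p k j) = (if i = j then unit else 0)"
    and "\<And>l. l < n \<Longrightarrow> a l \<in> L" and "i < n"
  shows "(\<Sum>k<n. q i k * (\<Sum>l<n. p k l * a l)) = a i"
proof -
  have "(\<Sum>k<n. q i k * (\<Sum>l<n. p k l * a l)) = (\<Sum>k<n. \<Sum>l<n. q i k * p k l * a l)"
    by (simp add: sum_distrib_left mult.assoc)
  also have "\<dots> = (\<Sum>l<n. \<Sum>k<n. q i k * p k l * a l)"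
    by (rule sum.swap)
  also have "\<dots> = (\<Sum>l<n. if i = l then a l else 0)"
    using assms by (intro sum.cong) (auto simp: sum_distrib_right[symmetric])
  also have "\<dots> = a i" using assms(3) by simp
  finally show ?thesis .
qed

lemma matrix_cancel_right:
  fixes n :: nat
  assumes "\<And>i j. i < n \<Longrightarrow> j < n \<Longrightarrow> (\<Sum>k<n. q i k * p k j) = (if i = j then unit else 0)"
    and "\<And>l. l < n \<Longrightarrow> a l \<in> L" and "i < n"
  shows "(\<Sum>k<n. (\<Sum>l<n. a l * q l k) * p k i) = a i"
proof -
  have "(\<Sum>k<n. (\<Sum>l<n. a l * q l k) * p k i) = (\<Sum>k<n. \<Sum>l<n. a l * (q l k * p k i))"
    by (simp add: sum_distrib_right mult.assoc)
  also have "\<dots> = (\<Sum>l<n. \<Sum>k<n. a l * (q l k * p k i))"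
    by (rule sum.swap)
  also have "\<dots> = (\<Sum>l<n. if l = i then a l else 0)"
    using assms by (intro sum.cong) (auto simp: sum_distrib_left[symmetric])
  also have "\<dots> = a i" using assms(3) by simp
  finally show ?thesis .
qed

end

locale leavitt_unit = leavitt_family +
  fixes n :: nat and e :: "nat \<Rightarrow> 'b" and v w :: 'a and p q :: "nat \<Rightarrow> nat \<Rightarrow> 'd"
  assumes v: "v \<in> verts E" and w: "w \<in> verts E" and inj_e: "inj_on e {..<n}"
    and e_arcs: "i < n \<Longrightarrow> e i \<in> arcs E"
    and e_tail: "i < n \<Longrightarrow> tail E (e i) = v" and e_head: "i < n \<Longrightarrow> head E (e i) = w"
    and p_L: "i < n \<Longrightarrow> j < n \<Longrightarrow> p i j \<in> L" and q_L: "i < n \<Longrightarrow> j < n \<Longrightarrow> q i j \<in> L"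
    and pq: "i < n \<Longrightarrow> j < n \<Longrightarrow> (\<Sum>k<n. p i k * q k j) = (if i = j then unit else 0)"
    and qp: "i < n \<Longrightarrow> j < n \<Longrightarrow> (\<Sum>k<n. q i k * p k j) = (if i = j then unit else 0)"
    and w_p: "i < n \<Longrightarrow> j < n \<Longrightarrow> V w * p i j = p i j * V w"
begin

text \<open>With w for \<open>V w\<close>, the usual computation for inverses: w q = q p w q = q w p
  q = q w.\<close>

lemma w_q:
  assumes "i < n" "j < n"
  shows "V w * q i j = q i j * V w"
proof -
  have "V w * q i j = (\<Sum>k<n. q i k * (\<Sum>l<n. p k l * (V w * q l j)))"
    using assms w q_L by (intro matrix_cancel_left[symmetric] qp) auto
  also have "\<dots> = (\<Sum>k<n. q i k * (V w * (\<Sum>l<n. p k l * q l j)))"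
    using w_p by (intro sum.cong refl) (simp add: sum_distrib_left mult.assoc[symmetric])
  also have "\<dots> = (\<Sum>k<n. if k = j then q i k * V w else 0)"
    using assms w by (intro sum.cong refl) (auto simp: pq)
  also have "\<dots> = q i j * V w" using assms by simp
  finally show ?thesis .
qed

definition edge_image :: "'b \<Rightarrow> 'd" where
  "edge_image f = (if f \<in> e ` {..<n} then \<Sum>k<n. D (e k) * p k (inv_into {..<n} e f) else D f)"

definition ghost_image :: "'b \<Rightarrow> 'd" where
  "ghost_image f = (if f \<in> e ` {..<n} then \<Sum>k<n. q (inv_into {..<n} e f) k * G (e k) else G f)"

lemma edge_image_e: "i < n \<Longrightarrow> edge_image (e i) = (\<Sum>k<n. D (e k) * p k i)"
  and ghost_image_e: "i < n \<Longrightarrow> ghost_image (e i) = (\<Sum>k<n. q i k * G (e k))"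
  by (simp_all add: edge_image_def ghost_image_def inv_into_f_f[OF inj_e])

lemma edge_image_other: "f \<notin> e ` {..<n} \<Longrightarrow> edge_image f = D f"
  and ghost_image_other: "f \<notin> e ` {..<n} \<Longrightarrow> ghost_image f = G f"
  by (simp_all add: edge_image_def ghost_image_def)

lemma edge_image_L: "f \<in> arcs E \<Longrightarrow> edge_image f \<in> L"
proof (cases "f \<in> e ` {..<n}")
  case True
  then obtain i where "i < n" "f = e i" by auto
  then show ?thesis using e_arcs p_L by (auto simp: edge_image_e)
qed (simp add: edge_image_other)

lemma ghost_image_L: "f \<in> arcs E \<Longrightarrow> ghost_image f \<in> L"
proof (cases "f \<in> e ` {..<n}")
  case True
  then obtain i where "i < n" "f = e i" by auto
  then show ?thesis using e_arcs q_L by (auto simp: ghost_image_e)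
qed (simp add: ghost_image_other)

text \<open>The products of ghosts and edges reduce to \<open>V w\<close>, which leaves an entry of
  q w p; moving w past p turns it into an entry of q p w.\<close>

lemma ghost_edge_image:
  assumes "i < n" "j < n"
  shows "ghost_image (e i) * edge_image (e j) = (if i = j then V w else 0)"
proof -
  have "ghost_image (e i) * edge_image (e j) =
      (\<Sum>k<n. q i k * (G (e k) * (\<Sum>l<n. D (e l) * p l j)))"
    using assms by (simp add: ghost_image_e edge_image_e sum_distrib_right mult.assoc)
  also have "\<dots> = (\<Sum>k<n. q i k * (V w * p k j))"
  proof (intro sum.cong refl)
    fix k assume "k \<in> {..<n}"
    then have k: "k < n" by simp
    have "G (e k) * (\<Sum>l<n. D (e l) * p l j) = (\<Sum>l<n. if k = l then V w * p l j else 0)"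
      unfolding sum_distrib_left
      using k inj_e by (intro sum.cong refl) (auto simp: G_D_assoc e_arcs e_head dest: inj_onD)
    also have "\<dots> = V w * p k j" using k by simp
    finally show "q i k * (G (e k) * (\<Sum>l<n. D (e l) * p l j)) = q i k * (V w * p k j)" by simp
  qed
  also have "\<dots> = (\<Sum>k<n. q i k * p k j) * V w"
    using assms w_p by (simp add: sum_distrib_right mult.assoc)
  also have "\<dots> = (if i = j then V w else 0)" using assms w by (simp add: qp)
  finally show ?thesis .
qed

text \<open>The matrices meet in the middle as p q = 1. The single summands change, but not their
  sum, and \<open>CK\<close> at \<open>v\<close> involves only the sum.\<close>

lemma sum_edge_ghost_image: "(\<Sum>i<n. edge_image (e i) * ghost_image (e i)) = (\<Sum>i<n. D (e i) * G (e i))"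
proof -
  have "(\<Sum>i<n. edge_image (e i) * ghost_image (e i)) =
      (\<Sum>i<n. \<Sum>k<n. D (e k) * (p k i * (\<Sum>l<n. q i l * G (e l))))"
    by (simp add: edge_image_e ghost_image_e sum_distrib_right mult.assoc)
  also have "\<dots> = (\<Sum>k<n. \<Sum>i<n. D (e k) * (p k i * (\<Sum>l<n. q i l * G (e l))))"
    by (rule sum.swap)
  also have "\<dots> = (\<Sum>k<n. D (e k) * (\<Sum>i<n. p k i * (\<Sum>l<n. q i l * G (e l))))"
    by (simp add: sum_distrib_left)
  also have "\<dots> = (\<Sum>k<n. D (e k) * G (e k))"
    by (intro sum.cong refl arg_cong2[where f = "(*)"] matrix_cancel_left pq) (auto simp: e_arcs)
  finally show ?thesis .
qed

text \<open>The condition that w commutes with P enters where the new edges must end at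
  \<open>w\<close>: \<open>V w\<close> is moved past the entry of p to the edge, which absorbs it.
  For ghosts \<open>w_q\<close> does the same.\<close>

lemma image_family: "leavitt_family E scale V edge_image ghost_image"
proof unfold_locales
  show "finite (verts E)" by (rule finite_verts)
  show "(c *s x) * y = c *s (x * y)" "x * (c *s y) = c *s (x * y)" for c x y
    by (simp_all add: scale_mult_left scale_mult_right)
  show "V u * V u' = (if u = u' then V u else 0)" if "u \<in> verts E" "u' \<in> verts E" for u u'
    using that by (rule V_V)
  fix f assume f: "f \<in> arcs E"
  show "V (tail E f) * edge_image f = edge_image f"
  proof (cases "f \<in> e ` {..<n}")
    case True
    then obtain i where i: "i < n" "f = e i" by auto
    have "V v * (\<Sum>k<n. D (e k) * p k i) = (\<Sum>k<n. D (e k) * p k i)"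
      unfolding sum_distrib_left
      by (intro sum.cong refl) (simp add: V_D_assoc v e_arcs e_tail)
    then show ?thesis using i by (simp add: edge_image_e e_tail)
  qed (simp add: edge_image_other tail_D f)
  show "edge_image f * V (head E f) = edge_image f"
  proof (cases "f \<in> e ` {..<n}")
    case True
    then obtain i where i: "i < n" "f = e i" by auto
    have "(\<Sum>k<n. D (e k) * p k i) * V w = (\<Sum>k<n. D (e k) * p k i)"
      unfolding sum_distrib_right
    proof (intro sum.cong refl)
      fix k assume "k \<in> {..<n}"
      then have "D (e k) * p k i * V w = D (e k) * (V w * p k i)"
        using w_p[of k i] i by (simp add: mult.assoc)
      then show "D (e k) * p k i * V w = D (e k) * p k i"
        using \<open>k \<in> {..<n}\<close> by (simp add: D_V_assoc w e_arcs e_head)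
    qed
    then show ?thesis using i by (simp add: edge_image_e e_head)
  qed (simp add: edge_image_other D_head f)
  show "ghost_image f * V (tail E f) = ghost_image f"
  proof (cases "f \<in> e ` {..<n}")
    case True
    then obtain i where i: "i < n" "f = e i" by auto
    have "(\<Sum>k<n. q i k * G (e k)) * V v = (\<Sum>k<n. q i k * G (e k))"
      unfolding sum_distrib_right
      by (intro sum.cong refl) (simp add: G_V v e_arcs e_tail mult.assoc)
    then show ?thesis using i by (simp add: ghost_image_e e_tail)
  qed (simp add: ghost_image_other G_tail f)
  show "V (head E f) * ghost_image f = ghost_image f"
  proof (cases "f \<in> e ` {..<n}")
    case True
    then obtain i where i: "i < n" "f = e i" by auto
    have "V w * (\<Sum>k<n. q i k * G (e k)) = (\<Sum>k<n. q i k * G (e k))"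
      unfolding sum_distrib_left
    proof (intro sum.cong refl)
      fix k assume "k \<in> {..<n}"
      then have "V w * (q i k * G (e k)) = q i k * (V w * G (e k))"
        using w_q[of i k] i by (simp add: mult.assoc[symmetric])
      then show "V w * (q i k * G (e k)) = q i k * G (e k)"
        using \<open>k \<in> {..<n}\<close> by (simp add: V_G w e_arcs e_head)
    qed
    then show ?thesis using i by (simp add: ghost_image_e e_head)
  qed (simp add: ghost_image_other head_G f)
  show "ghost_image f * edge_image f' = (if f = f' then V (head E f) else 0)" if f': "f' \<in> arcs E" for f'
  proof (cases "f \<in> e ` {..<n}"; cases "f' \<in> e ` {..<n}")
    assume "f \<in> e ` {..<n}" "f' \<in> e ` {..<n}"
    then obtain i j where ij: "i < n" "f = e i" "j < n" "f' = e j" by auto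
    then show ?thesis using inj_e by (auto simp: ghost_edge_image e_head dest: inj_onD)
  next
    assume *: "f \<in> e ` {..<n}" "f' \<notin> e ` {..<n}"
    then obtain i where i: "i < n" "f = e i" by auto
    have "(\<Sum>k<n. q i k * G (e k)) * D f' = 0"
      unfolding sum_distrib_right
      using *(2) f' by (intro sum.neutral) (auto simp: mult.assoc G_D e_arcs)
    then show ?thesis using i * by (auto simp: ghost_image_e edge_image_other)
  next
    assume *: "f \<notin> e ` {..<n}" "f' \<in> e ` {..<n}"
    then obtain i where i: "i < n" "f' = e i" by auto
    have "G f * (\<Sum>k<n. D (e k) * p k i) = 0"
      unfolding sum_distrib_left
      using *(1) f by (intro sum.neutral) (auto simp: G_D_assoc e_arcs)
    then show ?thesis using i * by (auto simp: edge_image_e ghost_image_other)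
  qed (simp add: edge_image_other ghost_image_other G_D f f')
next
  fix u assume u: "u \<in> verts E" "out_arcs E u \<noteq> {}" "finite (out_arcs E u)"
  let ?e = "e ` {..<n}"
  \<comment> \<open>All distinguished edges leave \<open>v\<close>, so they occur in the sum at
    \<open>u\<close> either together or not at all.\<close>
  have split: "(\<Sum>f\<in>out_arcs E u. h f) = (\<Sum>f\<in>out_arcs E u - ?e. h f) + (if u = v then \<Sum>i<n. h (e i) else 0)"
    for h :: "'b \<Rightarrow> 'd"
  proof (cases "u = v")
    case True
    have "?e \<subseteq> out_arcs E u" using True e_arcs e_tail by auto
    then have "(\<Sum>f\<in>out_arcs E u. h f) = (\<Sum>f\<in>out_arcs E u - ?e. h f) + (\<Sum>f\<in>?e. h f)"
      using u(3) by (rule sum.subset_diff)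
    then show ?thesis using True by (simp add: sum.reindex[OF inj_e])
  next
    case False
    then have "out_arcs E u - ?e = out_arcs E u" using e_tail by auto
    then show ?thesis using False by simp
  qed
  have "(\<Sum>f\<in>out_arcs E u. edge_image f * ghost_image f) = (\<Sum>f\<in>out_arcs E u. D f * G f)"
    unfolding split sum_edge_ghost_image
    by (intro arg_cong2[where f = "(+)"] sum.cong refl) (simp_all add: edge_image_other ghost_image_other)
  then show "(\<Sum>f\<in>out_arcs E u. edge_image f * ghost_image f) = V u" using CK[OF u] by simp
qed

end

text \<open>Makes every fact about \<open>\<phi>\<^sub>P\<close> available for the inverse matrix as
  well.\<close>

lemma (in leavitt_unit) swap: "leavitt_unit E scale V D G n e v w q p"
  by unfold_locales (use v w inj_e e_arcs e_tail e_head p_L q_L pq qp w_q in auto)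

text \<open>\<open>A\<close> maps q to an inverse of p, and inverses are unique: A(q) = q p A(q) = q
  A(p q) = q.\<close>

lemma (in leavitt_unit) fixes_inverse_matrix:
  assumes A_L: "\<And>x. x \<in> L \<Longrightarrow> A x \<in> L"
    and A_add: "\<And>x y. x \<in> L \<Longrightarrow> y \<in> L \<Longrightarrow> A (x + y) = A x + A y"
    and A_mult: "\<And>x y. x \<in> L \<Longrightarrow> y \<in> L \<Longrightarrow> A (x * y) = A x * A y"
    and A_0: "A 0 = 0" and A_unit: "A unit = unit"
    and A_p: "\<And>i j. i < n \<Longrightarrow> j < n \<Longrightarrow> A (p i j) = p i j"
    and ij: "i < n" "j < n"
  shows "A (q i j) = q i j"
proof -
  have A_sum: "A (\<Sum>i\<in>S. g i) = (\<Sum>i\<in>S. A (g i))" if "\<And>i. i \<in> S \<Longrightarrow> g i \<in> L" for S :: "nat set" and g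
    using that by (induction S rule: infinite_finite_induct) (auto simp: A_0 A_add L_sum)
  have "A (q i j) = (\<Sum>k<n. q i k * (\<Sum>l<n. p k l * A (q l j)))"
    using ij q_L A_L by (intro matrix_cancel_left[symmetric] qp) auto
  also have "\<dots> = (\<Sum>k<n. q i k * A (\<Sum>l<n. p k l * q l j))"
  proof (intro sum.cong refl arg_cong2[where f = "(*)"])
    fix k assume "k \<in> {..<n}"
    then show "(\<Sum>l<n. p k l * A (q l j)) = A (\<Sum>l<n. p k l * q l j)"
      using ij p_L q_L by (subst A_sum) (auto simp: A_mult A_p)
  qed
  also have "\<dots> = (\<Sum>k<n. if k = j then q i k else 0)"
    using ij q_L by (intro sum.cong refl) (auto simp: pq A_0 A_unit)
  also have "\<dots> = q i j" using ij by simp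
  finally show ?thesis .
qed

context leavitt_unit
begin

interpretation inverse: leavitt_unit E scale V D G n e v w q p
  by (rule swap)

text \<open>Since \<open>A\<close> fixes both matrices, it acts only on the edges and ghosts in
  these sums. In row and column notation, the row of edges times q goes to the row times p q, and p
  times the column of ghosts goes to p q times the column.\<close>

lemma hom_inverse_image:
  assumes A_add: "\<And>x y. x \<in> L \<Longrightarrow> y \<in> L \<Longrightarrow> A (x + y) = A x + A y"
    and A_mult: "\<And>x y. x \<in> L \<Longrightarrow> y \<in> L \<Longrightarrow> A (x * y) = A x * A y"
    and A_0: "A 0 = 0"
    and A_p: "\<And>i j. i < n \<Longrightarrow> j < n \<Longrightarrow> A (p i j) = p i j"
    and A_q: "\<And>i j. i < n \<Longrightarrow> j < n \<Longrightarrow> A (q i j) = q i j"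
    and A_D: "\<And>f. f \<in> arcs E \<Longrightarrow> A (D f) = edge_image f"
    and A_G: "\<And>f. f \<in> arcs E \<Longrightarrow> A (G f) = ghost_image f"
    and f: "f \<in> arcs E"
  shows "A (inverse.edge_image f) = D f" "A (inverse.ghost_image f) = G f"
proof -
  have A_sum: "A (\<Sum>i\<in>S. g i) = (\<Sum>i\<in>S. A (g i))" if "\<And>i. i \<in> S \<Longrightarrow> g i \<in> L" for S :: "nat set" and g
    using that by (induction S rule: infinite_finite_induct) (auto simp: A_0 A_add L_sum)
  have e: "A (inverse.edge_image (e i)) = D (e i)" "A (inverse.ghost_image (e i)) = G (e i)" if i: "i < n" for i
  proof -
    have "A (inverse.edge_image (e i)) = (\<Sum>k<n. A (D (e k)) * A (q k i))"
      using i q_L e_arcs by (subst inverse.edge_image_e, simp, subst A_sum) (auto simp: A_mult)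
    also have "\<dots> = (\<Sum>k<n. (\<Sum>l<n. D (e l) * p l k) * q k i)"
      using i by (intro sum.cong refl) (simp add: A_D A_q e_arcs edge_image_e)
    also have "\<dots> = D (e i)"
      using i e_arcs by (intro matrix_cancel_right pq) auto
    finally show "A (inverse.edge_image (e i)) = D (e i)" .
    have "A (inverse.ghost_image (e i)) = (\<Sum>k<n. A (p i k) * A (G (e k)))"
      using i p_L e_arcs by (subst inverse.ghost_image_e, simp, subst A_sum) (auto simp: A_mult)
    also have "\<dots> = (\<Sum>k<n. p i k * (\<Sum>l<n. q k l * G (e l)))"
      using i by (intro sum.cong refl) (simp add: A_G A_p e_arcs ghost_image_e)
    also have "\<dots> = G (e i)"
      using i e_arcs by (intro matrix_cancel_left pq) auto
    finally show "A (inverse.ghost_image (e i)) = G (e i)" .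
  qed
  show "A (inverse.edge_image f) = D f" "A (inverse.ghost_image f) = G f"
    using e f by (cases "f \<in> e ` {..<n}";
      auto simp: A_D A_G inverse.edge_image_other inverse.ghost_image_other edge_image_other ghost_image_other)+
qed

end

section \<open>Free algebras, their actions and their quotients\<close>

text \<open>A scalar is a multiple of the empty word, so laws of scalar multiplication become ring
  laws.\<close>

lemma free_scale_eq: "free_scale c p = Poly_Mapping.single 0 c * p"
  by (simp add: free_scale_def mult_map_scale_conv_mult)

lemma lookup_free_scale: "Poly_Mapping.lookup (free_scale c p) u = c * Poly_Mapping.lookup p u"
  by (simp add: free_scale_def Poly_Mapping.map.rep_eq when_def)

lemma free_scale_mult_left: "free_scale c p * q = free_scale c (p * q)"
  by (simp add: free_scale_eq mult.assoc)

lemma sum_single: "p = (\<Sum>u\<in>Poly_Mapping.keys p. Poly_Mapping.single u (Poly_Mapping.lookup p u))"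
  by (rule poly_mapping_eqI) (auto simp: lookup_sum lookup_single when_def in_keys_iff sum.delta')

lemma free_scale_mult_right: "p * free_scale c q = free_scale c (p * q)"
proof -
  have "Poly_Mapping.single 0 c * p = p * Poly_Mapping.single 0 c"
    by (subst (1 2) sum_single) (simp add: sum_distrib_left sum_distrib_right mult_single mult.commute)
  then show ?thesis by (simp add: free_scale_eq mult.assoc[symmetric])
qed

interpretation free_alg: vector_space "free_scale :: 'k::field \<Rightarrow> ('x, 'k) free_alg \<Rightarrow> _"
  by unfold_locales (auto intro!: poly_mapping_eqI simp: lookup_free_scale lookup_add algebra_simps)

lemma letters_zero [simp]: "letters 0 = []" and letters_plus [simp]: "letters (u + v) = letters u @ letters v"
  by (simp_all add: zero_word_def plus_word_def)

lemma free_carrier_0: "0 \<in> free_carrier X"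
  by (simp add: free_carrier_def)

lemma free_carrier_add: "p \<in> free_carrier X \<Longrightarrow> q \<in> free_carrier X \<Longrightarrow> p + q \<in> free_carrier X"
  unfolding free_carrier_def using keys_add[of p q] by auto

lemma free_carrier_diff: "p \<in> free_carrier X \<Longrightarrow> q \<in> free_carrier X \<Longrightarrow> p - q \<in> free_carrier X"
  unfolding free_carrier_def using keys_diff[of p q] by auto

lemma free_carrier_mult: "p \<in> free_carrier X \<Longrightarrow> q \<in> free_carrier X \<Longrightarrow> p * q \<in> free_carrier X"
  unfolding free_carrier_def using keys_mult[of p q] by fastforce

lemma free_carrier_scale: "p \<in> free_carrier X \<Longrightarrow> free_scale c p \<in> free_carrier X"
  unfolding free_carrier_def by (auto simp: in_keys_iff lookup_free_scale)

lemma free_carrier_gen: "x \<in> X \<Longrightarrow> free_gen x \<in> free_carrier X"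
  unfolding free_carrier_def free_gen_def by simp

lemma free_carrier_sum: "(\<And>i. i \<in> T \<Longrightarrow> g i \<in> free_carrier X) \<Longrightarrow> (\<Sum>i\<in>T. g i) \<in> free_carrier X"
  by (induction T rule: infinite_finite_induct) (auto simp: free_carrier_0 free_carrier_add)

text \<open>Every nonempty word is a product of letters, built up from its last letter. The empty
  word never arises, so there is no case for constants.\<close>

lemma free_carrier_induct [consumes 1, case_names zero gen add scale mult]:
  fixes p :: "('x, 'k::field) free_alg"
  assumes "p \<in> free_carrier X"
    and zero: "P 0" and gen: "\<And>x. x \<in> X \<Longrightarrow> P (free_gen x)"
    and add: "\<And>p q. P p \<Longrightarrow> P q \<Longrightarrow> p \<in> free_carrier X \<Longrightarrow> q \<in> free_carrier X \<Longrightarrow> P (p + q)"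
    and scale: "\<And>c p. P p \<Longrightarrow> p \<in> free_carrier X \<Longrightarrow> P (free_scale c p)"
    and mult: "\<And>p q. P p \<Longrightarrow> P q \<Longrightarrow> p \<in> free_carrier X \<Longrightarrow> q \<in> free_carrier X \<Longrightarrow> P (p * q)"
  shows "P p"
proof -
  have word: "P (Poly_Mapping.single (Word xs) (1::'k)) \<and> Poly_Mapping.single (Word xs) (1::'k) \<in> free_carrier X"
    if "xs \<noteq> []" "set xs \<subseteq> X" for xs
    using that
  proof (induction xs rule: list_nonempty_induct)
    case (single x)
    then show ?case using gen[of x] free_carrier_gen[of x X] by (simp add: free_gen_def)
  next
    case (cons x xs)
    have "Poly_Mapping.single (Word (x # xs)) 1 = free_gen x * Poly_Mapping.single (Word xs) (1::'k)"
      by (simp add: free_gen_def mult_single plus_word_def)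
    then show ?case
      using cons mult[OF gen[of x]] free_carrier_gen[of x X] by (auto intro: free_carrier_mult)
  qed
  have "P (\<Sum>u\<in>S. Poly_Mapping.single u (Poly_Mapping.lookup p u)) \<and>
      (\<Sum>u\<in>S. Poly_Mapping.single u (Poly_Mapping.lookup p u)) \<in> free_carrier X"
    if "finite S" "S \<subseteq> Poly_Mapping.keys p" for S
    using that
  proof (induction S rule: finite_induct)
    case (insert u S)
    have "Poly_Mapping.single u (Poly_Mapping.lookup p u) =
        free_scale (Poly_Mapping.lookup p u) (Poly_Mapping.single (Word (letters u)) 1)"
      by (simp add: free_scale_eq mult_single)
    moreover have "letters u \<noteq> []" "set (letters u) \<subseteq> X"
      using assms(1) insert unfolding free_carrier_def by auto
    ultimately have "P (Poly_Mapping.single u (Poly_Mapping.lookup p u)) \<and>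
        Poly_Mapping.single u (Poly_Mapping.lookup p u) \<in> free_carrier X"
      using word[of "letters u"] scale free_carrier_scale by metis
    then show ?case using insert add by (auto intro: free_carrier_add)
  qed (simp add: zero free_carrier_0)
  then show ?thesis using sum_single[of p] finite_keys by (metis order_refl)
qed

section \<open>Actions of the free algebra on a vector space, and evaluation in a ring\<close>

locale letter_action = vector_space scale
  for scale :: "'k::field \<Rightarrow> 'w::ab_group_add \<Rightarrow> 'w" (infixr "*s" 75) +
  fixes T :: "'x \<Rightarrow> 'w \<Rightarrow> 'w"
  assumes T_add: "T x (\<xi> + \<eta>) = T x \<xi> + T x \<eta>"
    and T_scale: "T x (c *s \<xi>) = c *s T x \<xi>"
begin

text \<open>By \<open>foldr\<close> the last letter of a word acts first, so that concatenation of
  words becomes composition of operators.\<close>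

definition act :: "('x, 'k) free_alg \<Rightarrow> 'w \<Rightarrow> 'w" where
  "act p \<xi> = (\<Sum>u\<in>Poly_Mapping.keys p. Poly_Mapping.lookup p u *s foldr T (letters u) \<xi>)"

lemma T_0 [simp]: "T x 0 = 0"
  using T_scale[of x 0 0] by simp

lemma foldr_add: "foldr T xs (\<xi> + \<eta>) = foldr T xs \<xi> + foldr T xs \<eta>"
  by (induction xs) (auto simp: T_add)

lemma foldr_scale: "foldr T xs (c *s \<xi>) = c *s foldr T xs \<xi>"
  by (induction xs) (auto simp: T_scale)

lemma act_superset:
  assumes "finite S" "Poly_Mapping.keys p \<subseteq> S"
  shows "act p \<xi> = (\<Sum>u\<in>S. Poly_Mapping.lookup p u *s foldr T (letters u) \<xi>)"
  unfolding act_def using assms by (intro sum.mono_neutral_left) (auto simp: in_keys_iff)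

lemma act_0 [simp]: "act 0 \<xi> = 0"
  by (simp add: act_def)

lemma act_add: "act (p + q) \<xi> = act p \<xi> + act q \<xi>"
  using keys_add[of p q]
  by (simp add: act_superset[of "Poly_Mapping.keys p \<union> Poly_Mapping.keys q"]
      lookup_add scale_left_distrib sum.distrib)

lemma act_scale: "act (free_scale c p) \<xi> = c *s act p \<xi>"
  by (subst act_superset[of "Poly_Mapping.keys p"])
    (auto simp: lookup_free_scale in_keys_iff act_def scale_sum_right)

lemma act_minus: "act (- p) \<xi> = - act p \<xi>"
  using act_add[of p "- p" \<xi>] by (simp add: add_eq_0_iff)

lemma act_diff: "act (p - q) \<xi> = act p \<xi> - act q \<xi>"
  using act_add[of p "- q" \<xi>] by (simp add: act_minus)

lemma act_sum: "act (\<Sum>i\<in>S. g i) \<xi> = (\<Sum>i\<in>S. act (g i) \<xi>)"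
  by (induction S rule: infinite_finite_induct) (auto simp: act_add)

lemma act_single: "act (Poly_Mapping.single u c) \<xi> = c *s foldr T (letters u) \<xi>"
  by (cases "c = 0") (auto simp: act_def)

lemma act_gen [simp]: "act (free_gen x) \<xi> = T x \<xi>"
  by (simp add: free_gen_def act_single)

lemma act_vec_add: "act p (\<xi> + \<eta>) = act p \<xi> + act p \<eta>"
  by (simp add: act_def foldr_add scale_right_distrib sum.distrib)

lemma act_vec_scale: "act p (c *s \<xi>) = c *s act p \<xi>"
  by (simp add: act_def foldr_scale scale_sum_right mult.commute)

lemma act_vec_0 [simp]: "act p 0 = 0"
  using act_vec_scale[of p 0 0] by simp

lemma act_vec_sum: "act p (\<Sum>i\<in>S. g i) = (\<Sum>i\<in>S. act p (g i))"
  by (induction S rule: infinite_finite_induct) (auto simp: act_vec_add)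

lemma act_mult: "act (p * q) \<xi> = act p (act q \<xi>)"
proof -
  let ?m = "\<lambda>p u. Poly_Mapping.single u (Poly_Mapping.lookup p u)"
  have "p * q = (\<Sum>u\<in>Poly_Mapping.keys p. \<Sum>v\<in>Poly_Mapping.keys q. ?m p u * ?m q v)"
    unfolding sum_product[symmetric] by (simp only: sum_single[symmetric])
  then have "act (p * q) \<xi> = (\<Sum>u\<in>Poly_Mapping.keys p. \<Sum>v\<in>Poly_Mapping.keys q. act (?m p u * ?m q v) \<xi>)"
    by (simp add: act_sum)
  also have "\<dots> = (\<Sum>u\<in>Poly_Mapping.keys p. \<Sum>v\<in>Poly_Mapping.keys q. act (?m p u) (act (?m q v) \<xi>))"
    by (simp add: mult_single act_single foldr_scale)
  also have "\<dots> = act p (act q \<xi>)"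
    by (subst (3) sum_single[of p], subst (3) sum_single[of q]) (simp only: act_sum act_vec_sum, rule sum.swap)
  finally show ?thesis .
qed

lemma act_free_ideal:
  assumes "p \<in> free_ideal X R" "\<And>r \<xi>. r \<in> R \<Longrightarrow> act r \<xi> = 0"
  shows "act p \<xi> = 0"
  using assms(1)
  by (induction arbitrary: \<xi> rule: free_ideal.induct) (simp_all add: assms(2) act_add act_scale act_mult)

end

text \<open>Substitution is treated as the action by left multiplication, applied to 1; the laws of
  \<open>ev\<close> are then instances of those of \<open>act\<close>.\<close>

locale letter_substitution = vector_space scale
  for scale :: "'k::field \<Rightarrow> 'w::ring_1 \<Rightarrow> 'w" (infixr "*s" 75) +
  fixes s :: "'x \<Rightarrow> 'w"
  assumes scale_mult_left: "(c *s a) * b = c *s (a * b)"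
    and scale_mult_right: "a * (c *s b) = c *s (a * b)"
begin

sublocale letter_action scale "\<lambda>x \<xi>. s x * \<xi>"
  by unfold_locales (simp_all add: distrib_left scale_mult_right)

definition ev :: "('x, 'k) free_alg \<Rightarrow> 'w" where
  "ev p = act p 1"

lemma act_ev: "act p \<xi> = ev p * \<xi>"
proof -
  have "foldr (\<lambda>x \<xi>. s x * \<xi>) xs \<xi> = foldr (\<lambda>x \<xi>. s x * \<xi>) xs 1 * \<xi>" for xs
    by (induction xs) (simp_all add: mult.assoc)
  then show ?thesis
    unfolding ev_def act_def sum_distrib_right scale_mult_left by (intro sum.cong refl) metis
qed

lemma ev_0 [simp]: "ev 0 = 0"
  by (simp add: ev_def)

lemma ev_add: "ev (p + q) = ev p + ev q"
  by (simp add: ev_def act_add)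

lemma ev_diff: "ev (p - q) = ev p - ev q"
  by (simp add: ev_def act_diff)

lemma ev_sum: "ev (\<Sum>i\<in>S. g i) = (\<Sum>i\<in>S. ev (g i))"
  by (simp add: ev_def act_sum)

lemma ev_scale: "ev (free_scale c p) = c *s ev p"
  by (simp add: ev_def act_scale)

lemma ev_gen [simp]: "ev (free_gen x) = s x"
  by (simp add: ev_def)

lemma ev_mult: "ev (p * q) = ev p * ev q"
  by (simp only: ev_def[of "p * q"] act_mult act_ev[of p], simp only: ev_def)

lemma ev_free_ideal:
  assumes "p \<in> free_ideal X R" "\<And>r. r \<in> R \<Longrightarrow> ev r = 0"
  shows "ev p = 0"
  unfolding ev_def by (rule act_free_ideal[OF assms(1)]) (simp add: act_ev assms(2))

end

section \<open>A ring type that contains all quotients of a given ring\<close>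

definition two_sided_ideal :: "'r::ring_1 set \<Rightarrow> bool" where
  "two_sided_ideal J \<longleftrightarrow> 0 \<in> J \<and> (\<forall>a\<in>J. \<forall>b\<in>J. a + b \<in> J) \<and> (\<forall>a\<in>J. \<forall>r. r * a \<in> J \<and> a * r \<in> J)"

lemma two_sided_ideal_minus: "two_sided_ideal J \<Longrightarrow> a \<in> J \<Longrightarrow> - a \<in> J"
  unfolding two_sided_ideal_def by (metis mult_minus_left mult_1)

definition all_ideals_rel :: "('r::ring_1 set \<Rightarrow> 'r) \<Rightarrow> ('r set \<Rightarrow> 'r) \<Rightarrow> bool" where
  "all_ideals_rel f g \<longleftrightarrow> (\<forall>J. two_sided_ideal J \<longrightarrow> f J - g J \<in> J)"

text \<open>
  A quotient by an ideal that is a free variable of a statement cannot be a type. This type is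
  the product of the quotients of \<open>'r\<close> by all its ideals, so it contains each of them as a factor.
\<close>

quotient_type (overloaded) 'r ideal_quotients = "'r::ring_1 set \<Rightarrow> 'r" / all_ideals_rel
proof (rule equivpI)
  show "reflp (all_ideals_rel :: ('r set \<Rightarrow> 'r) \<Rightarrow> _)"
    by (auto simp: reflp_def all_ideals_rel_def two_sided_ideal_def)
  show "symp (all_ideals_rel :: ('r set \<Rightarrow> 'r) \<Rightarrow> _)"
    unfolding symp_def all_ideals_rel_def by (metis two_sided_ideal_minus minus_diff_eq)
  show "transp (all_ideals_rel :: ('r set \<Rightarrow> 'r) \<Rightarrow> _)"
  proof (unfold transp_def all_ideals_rel_def, intro allI impI)
    fix f g h :: "'r set \<Rightarrow> 'r" and J :: "'r set"
    assume *: "\<forall>J. two_sided_ideal J \<longrightarrow> f J - g J \<in> J" "\<forall>J. two_sided_ideal J \<longrightarrow> g J - h J \<in> J"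
      "two_sided_ideal J"
    then have "(f J - g J) + (g J - h J) \<in> J" unfolding two_sided_ideal_def by blast
    then show "f J - h J \<in> J" by simp
  qed
qed

instantiation ideal_quotients :: (ring_1) ring_1
begin

lift_definition zero_ideal_quotients :: "'a ideal_quotients" is "\<lambda>_. 0" .

lift_definition one_ideal_quotients :: "'a ideal_quotients" is "\<lambda>_. 1" .

lift_definition plus_ideal_quotients :: "'a ideal_quotients \<Rightarrow> 'a ideal_quotients \<Rightarrow> 'a ideal_quotients"
  is "\<lambda>f g J. f J + g J"
  unfolding all_ideals_rel_def two_sided_ideal_def by (metis add_diff_add)

lift_definition uminus_ideal_quotients :: "'a ideal_quotients \<Rightarrow> 'a ideal_quotients"
  is "\<lambda>f J. - f J"
  unfolding all_ideals_rel_def by (metis minus_diff_minus two_sided_ideal_minus)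

lift_definition minus_ideal_quotients :: "'a ideal_quotients \<Rightarrow> 'a ideal_quotients \<Rightarrow> 'a ideal_quotients"
  is "\<lambda>f g J. f J - g J"
proof (unfold all_ideals_rel_def, intro allI impI)
  fix f f' g g' :: "'a set \<Rightarrow> 'a" and J :: "'a set"
  assume *: "\<forall>J. two_sided_ideal J \<longrightarrow> f J - f' J \<in> J" "\<forall>J. two_sided_ideal J \<longrightarrow> g J - g' J \<in> J"
    "two_sided_ideal J"
  then have "(f J - f' J) + - (g J - g' J) \<in> J"
    using two_sided_ideal_minus unfolding two_sided_ideal_def by blast
  then show "f J - g J - (f' J - g' J) \<in> J" by (simp add: algebra_simps)
qed

lift_definition times_ideal_quotients :: "'a ideal_quotients \<Rightarrow> 'a ideal_quotients \<Rightarrow> 'a ideal_quotients"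
  is "\<lambda>f g J. f J * g J"
proof (unfold all_ideals_rel_def, intro allI impI)
  fix f f' g g' :: "'a set \<Rightarrow> 'a" and J :: "'a set"
  assume *: "\<forall>J. two_sided_ideal J \<longrightarrow> f J - f' J \<in> J" "\<forall>J. two_sided_ideal J \<longrightarrow> g J - g' J \<in> J"
    "two_sided_ideal J"
  then have "f J * (g J - g' J) + (f J - f' J) * g' J \<in> J"
    unfolding two_sided_ideal_def by blast
  then show "f J * g J - f' J * g' J \<in> J" by (simp add: algebra_simps)
qed

instance
proof
  show "(0::'a ideal_quotients) \<noteq> 1"
  proof (transfer, unfold all_ideals_rel_def, intro notI)
    assume "\<forall>J. two_sided_ideal J \<longrightarrow> (0::'a) - 1 \<in> J"
    moreover have "two_sided_ideal {0::'a}" by (simp add: two_sided_ideal_def)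
    ultimately show False by fastforce
  qed
qed (transfer; simp add: all_ideals_rel_def two_sided_ideal_def algebra_simps)+

end

text \<open>The inclusion of the factor that belongs to \<open>J\<close>. It is additive and
  multiplicative and, for an ideal \<open>J\<close>, has kernel \<open>J\<close>; the coordinates 0
  elsewhere make it non-unital in general.\<close>

lift_definition in_quotient :: "'r::ring_1 set \<Rightarrow> 'r \<Rightarrow> 'r ideal_quotients"
  is "\<lambda>J r J'. if J' = J then r else 0" .

lemma in_quotient_eq_iff: "two_sided_ideal J \<Longrightarrow> in_quotient J a = in_quotient J b \<longleftrightarrow> a - b \<in> J"
  by transfer (auto simp: all_ideals_rel_def two_sided_ideal_def)

lemma in_quotient_add: "in_quotient J (a + b) = in_quotient J a + in_quotient J b"
  by transfer (auto simp: all_ideals_rel_def two_sided_ideal_def)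

lemma in_quotient_diff: "in_quotient J (a - b) = in_quotient J a - in_quotient J b"
  by transfer (auto simp: all_ideals_rel_def two_sided_ideal_def)

lemma in_quotient_mult: "in_quotient J (a * b) = in_quotient J a * in_quotient J b"
  by transfer (auto simp: all_ideals_rel_def two_sided_ideal_def)

lemma in_quotient_0: "in_quotient J 0 = 0"
  by transfer (auto simp: all_ideals_rel_def two_sided_ideal_def)

lemma in_quotient_sum: "in_quotient J (\<Sum>i\<in>S. g i) = (\<Sum>i\<in>S. in_quotient J (g i))"
  by (induction S rule: infinite_finite_induct) (auto simp: in_quotient_0 in_quotient_add)

text \<open>The diagonal map, which unlike \<open>in_quotient\<close> is unital. Through it scalars
  act on all coordinates, and the whole type becomes a vector space.\<close>

lift_definition const_quotient :: "'r::ring_1 \<Rightarrow> 'r ideal_quotients" is "\<lambda>r _. r" .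

lemma const_quotient_1: "const_quotient 1 = 1"
  by transfer (auto simp: all_ideals_rel_def two_sided_ideal_def)

lemma const_quotient_add: "const_quotient (a + b) = const_quotient a + const_quotient b"
  by transfer (auto simp: all_ideals_rel_def two_sided_ideal_def)

lemma const_quotient_mult: "const_quotient (a * b) = const_quotient a * const_quotient b"
  by transfer (auto simp: all_ideals_rel_def two_sided_ideal_def)

lemma const_quotient_commute:
  assumes "\<And>x. r * x = x * r"
  shows "const_quotient r * a = a * const_quotient r"
  using assms by transfer (simp add: all_ideals_rel_def two_sided_ideal_def)

lemma in_quotient_const_mult: "in_quotient J (r * a) = const_quotient r * in_quotient J a"
  by transfer (auto simp: all_ideals_rel_def two_sided_ideal_def)

definition quotient_scale ::
  "'k::field \<Rightarrow> ('x, 'k) free_alg ideal_quotients \<Rightarrow> ('x, 'k) free_alg ideal_quotients" where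
  "quotient_scale c q = const_quotient (Poly_Mapping.single 0 c) * q"

lemma in_quotient_scale: "in_quotient J (free_scale c a) = quotient_scale c (in_quotient J a)"
  by (simp add: quotient_scale_def free_scale_eq in_quotient_const_mult)

lemma quotient_scale_mult_left: "quotient_scale c a * b = quotient_scale c (a * b)"
  by (simp add: quotient_scale_def mult.assoc)

lemma quotient_scale_mult_right:
  fixes a b :: "('x, 'k::field) free_alg ideal_quotients"
  shows "a * quotient_scale c b = quotient_scale c (a * b)"
proof -
  have "Poly_Mapping.single 0 c * x = x * Poly_Mapping.single 0 c" for x :: "('x, 'k) free_alg"
    using free_scale_mult_right[of x c 1] by (simp add: free_scale_eq)
  then have "const_quotient (Poly_Mapping.single 0 c) * a = a * const_quotient (Poly_Mapping.single 0 c)"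
    by (rule const_quotient_commute)
  then show ?thesis by (simp add: quotient_scale_def mult.assoc[symmetric])
qed

interpretation quotient: vector_space "quotient_scale :: 'k::field \<Rightarrow> ('x, 'k) free_alg ideal_quotients \<Rightarrow> _"
  by unfold_locales
    (simp_all add: quotient_scale_def distrib_left distrib_right single_add const_quotient_add
      const_quotient_1 mult.assoc[symmetric] const_quotient_mult[symmetric] mult_single)

section \<open>The Leavitt path algebra as a subring of a type\<close>

lemma letter_substitution_free_alg:
  "letter_substitution (free_scale :: 'k::field \<Rightarrow> ('x, 'k) free_alg \<Rightarrow> _)"
  by unfold_locales (simp_all add: free_scale_mult_left free_scale_mult_right)

lemma letter_substitution_quotient:
  "letter_substitution (quotient_scale :: 'k::field \<Rightarrow> ('x, 'k) free_alg ideal_quotients \<Rightarrow> _)"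
  by unfold_locales (simp_all add: quotient_scale_mult_left quotient_scale_mult_right)

lemma free_ideal_sum: "(\<And>i. i \<in> T \<Longrightarrow> g i \<in> free_ideal X R) \<Longrightarrow> (\<Sum>i\<in>T. g i) \<in> free_ideal X R"
  by (induction T rule: infinite_finite_induct) (auto intro: free_ideal.zero free_ideal.add)

text \<open>A homomorphism of the unital free algebra which kills the letters outside
  \<open>X\<close>. Its values are constants plus elements of \<open>free_carrier X\<close>, and it
  is the identity on the latter.\<close>

definition forget_letters :: "'x set \<Rightarrow> ('x, 'k::field) free_alg \<Rightarrow> ('x, 'k) free_alg" where
  "forget_letters X = letter_substitution.ev free_scale (\<lambda>x. if x \<in> X then free_gen x else 0)"

text \<open>
  \<^const>\<open>free_ideal\<close> is an ideal of the non-unital algebra on the letters in \<open>X\<close> only. The following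
  ideal of the whole unital free algebra meets that subalgebra in \<^const>\<open>free_ideal\<close>.
\<close>

definition ideal_extension :: "'x set \<Rightarrow> ('x, 'k::field) free_alg set \<Rightarrow> ('x, 'k) free_alg set" where
  "ideal_extension X R = {p. forget_letters X p \<in> free_ideal X R}"

lemma forget_letters_id:
  assumes "p \<in> free_carrier X"
  shows "forget_letters X p = p"
proof -
  interpret letter_substitution free_scale "\<lambda>x. if x \<in> X then free_gen x else (0 :: ('a, 'b) free_alg)"
    by (rule letter_substitution_free_alg)
  show ?thesis
    using assms unfolding forget_letters_def
    by (induction rule: free_carrier_induct) (simp_all add: ev_add ev_scale ev_mult)
qed

text \<open>The factor \<open>ev p\<close> may have a constant term, whereas
  \<open>mult_left\<close> and \<open>mult_right\<close> admit only elements of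
  \<open>free_carrier X\<close>. Each word is therefore multiplied on letter by letter; the empty
  word changes nothing, and coefficients are handled by \<open>free_ideal.scale\<close>.\<close>

lemma two_sided_ideal_extension: "two_sided_ideal (ideal_extension X R)"
proof -
  interpret letter_substitution free_scale "\<lambda>x. if x \<in> X then free_gen x else (0 :: ('a, 'b) free_alg)"
    by (rule letter_substitution_free_alg)
  let ?T = "\<lambda>x. (*) (if x \<in> X then free_gen x else (0 :: ('a, 'b) free_alg))"
  have left: "ev p * a \<in> free_ideal X R" if "a \<in> free_ideal X R" for p a
  proof -
    have "foldr ?T xs a \<in> free_ideal X R" for xs
      using that by (induction xs) (auto intro: free_ideal.mult_left free_ideal.zero free_carrier_gen)
    then show ?thesis
      unfolding act_ev[symmetric] act_def by (intro free_ideal_sum free_ideal.scale)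
  qed
  have right: "a * ev p \<in> free_ideal X R" if "a \<in> free_ideal X R" for p a
  proof -
    have "a * foldr ?T xs 1 \<in> free_ideal X R" for xs
      using that
    proof (induction xs arbitrary: a)
      case (Cons x xs)
      have "a * (if x \<in> X then free_gen x else 0) \<in> free_ideal X R"
        using Cons.prems by (auto intro: free_ideal.mult_right free_ideal.zero free_carrier_gen)
      from Cons.IH[OF this] show ?case by (simp add: mult.assoc)
    qed simp
    then show ?thesis
      unfolding ev_def act_def sum_distrib_left free_scale_mult_right
      by (intro free_ideal_sum free_ideal.scale)
  qed
  show ?thesis
    unfolding two_sided_ideal_def ideal_extension_def forget_letters_def
    using left right by (auto simp: ev_add ev_mult intro: free_ideal.zero free_ideal.add)
qed

lemma in_ideal_extension_iff: "p \<in> free_carrier X \<Longrightarrow> p \<in> ideal_extension X R \<longleftrightarrow> p \<in> free_ideal X R"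
  by (simp add: ideal_extension_def forget_letters_id)

type_synonym ('v, 'e, 'k) lpa_quotient = "(('v, 'e) lpa_letter, 'k) free_alg ideal_quotients"

definition lpa_class ::
  "('v, 'e) pre_digraph \<Rightarrow> (('v, 'e) lpa_letter, 'k::field) free_alg \<Rightarrow> ('v, 'e, 'k) lpa_quotient" where
  "lpa_class E = in_quotient (ideal_extension (lpa_letters E) (lpa_relators E))"

lemma lpa_class_0: "lpa_class E 0 = 0"
  by (simp add: lpa_class_def in_quotient_0)

lemma lpa_class_add: "lpa_class E (p + q) = lpa_class E p + lpa_class E q"
  by (simp add: lpa_class_def in_quotient_add)

lemma lpa_class_diff: "lpa_class E (p - q) = lpa_class E p - lpa_class E q"
  by (simp add: lpa_class_def in_quotient_diff)

lemma lpa_class_mult: "lpa_class E (p * q) = lpa_class E p * lpa_class E q"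
  by (simp add: lpa_class_def in_quotient_mult)

lemma lpa_class_sum: "lpa_class E (\<Sum>i\<in>S. g i) = (\<Sum>i\<in>S. lpa_class E (g i))"
  by (simp add: lpa_class_def in_quotient_sum)

lemma lpa_class_scale: "lpa_class E (free_scale c p) = quotient_scale c (lpa_class E p)"
  by (simp add: lpa_class_def in_quotient_scale)

lemma lpa_class_eq_iff:
  assumes "p \<in> free_carrier (lpa_letters E)" "q \<in> free_carrier (lpa_letters E)"
  shows "lpa_class E p = lpa_class E q \<longleftrightarrow> p - q \<in> free_ideal (lpa_letters E) (lpa_relators E)"
  using assms by (simp add: lpa_class_def in_quotient_eq_iff two_sided_ideal_extension
      in_ideal_extension_iff free_carrier_diff)

lemma vertex_carrier: "u \<in> verts E \<Longrightarrow> free_gen (Vertex u) \<in> free_carrier (lpa_letters E)"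
  and edge_carrier: "f \<in> arcs E \<Longrightarrow> free_gen (Edge f) \<in> free_carrier (lpa_letters E)"
  and ghost_carrier: "f \<in> arcs E \<Longrightarrow> free_gen (Ghost f) \<in> free_carrier (lpa_letters E)"
  by (auto intro!: free_carrier_gen simp: lpa_letters_def)

lemma (in wf_digraph) lpa_relators_carrier:
  "r \<in> lpa_relators G \<Longrightarrow> r \<in> free_carrier (lpa_letters G)"
  by (induction rule: lpa_relators.induct)
    (auto intro!: free_carrier_diff free_carrier_mult free_carrier_sum vertex_carrier edge_carrier
      ghost_carrier free_carrier_0 simp: regular_vertex_def)

lemma (in wf_digraph) lpa_class_relator: "r \<in> lpa_relators G \<Longrightarrow> lpa_class G r = 0"
  using lpa_class_eq_iff[OF lpa_relators_carrier free_carrier_0]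
  by (auto simp: lpa_class_0 intro: free_ideal.base)

section \<open>A graded representation on functions of boundary paths\<close>

lemma sum_fun_apply: "(\<Sum>i\<in>S. g i) x = (\<Sum>i\<in>S. g i x)"
  by (induction S rule: infinite_finite_induct) auto

interpretation fun_space: vector_space "\<lambda>c \<xi> x. c * \<xi> x :: 'k::field"
  by unfold_locales (auto simp: algebra_simps)

text \<open>
  A boundary path records vertex and next edge at each position; \<^const>\<open>None\<close> means that the path
  has stopped there, which is allowed only at vertices that are not regular.
\<close>

definition boundary_step :: "('v, 'e) pre_digraph \<Rightarrow> 'v \<times> 'e option \<Rightarrow> 'v \<times> 'e option \<Rightarrow> bool" where
  "boundary_step E a b \<longleftrightarrow> fst a \<in> verts E \<and> (case snd a of None \<Rightarrow> \<not> regular_vertex E (fst a)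
     | Some f \<Rightarrow> f \<in> arcs E \<and> tail E f = fst a \<and> head E f = fst b)"

text \<open>After \<open>None\<close> the sequence continues with entries that are not linked to the
  stopped path. This keeps paths total functions, and the relations are not affected, since the
  letters test only the first entry of a boundary path.\<close>

definition boundary_path :: "('v, 'e) pre_digraph \<Rightarrow> (nat \<Rightarrow> 'v \<times> 'e option) \<Rightarrow> bool" where
  "boundary_path E s \<longleftrightarrow> (\<forall>i. boundary_step E (s i) (s (Suc i)))"

abbreviation prepend :: "('v, 'e) pre_digraph \<Rightarrow> 'e \<Rightarrow> (nat \<Rightarrow> 'v \<times> 'e option) \<Rightarrow> nat \<Rightarrow> 'v \<times> 'e option" where
  "prepend E f s \<equiv> case_nat (tail E f, Some f) s"

text \<open>The integer coordinate makes the representation graded: edges raise it, ghost edges lower it.\<close>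

fun boundary_rep :: "('v, 'e) pre_digraph \<Rightarrow> ('v, 'e) lpa_letter \<Rightarrow>
    ((nat \<Rightarrow> 'v \<times> 'e option) \<times> int \<Rightarrow> 'k::field) \<Rightarrow> (nat \<Rightarrow> 'v \<times> 'e option) \<times> int \<Rightarrow> 'k" where
  "boundary_rep E (Vertex u) \<xi> (s, m) = (if boundary_path E s \<and> fst (s 0) = u then \<xi> (s, m) else 0)"
| "boundary_rep E (Edge f) \<xi> (s, m) =
    (if boundary_path E s \<and> snd (s 0) = Some f then \<xi> (s \<circ> Suc, m - 1) else 0)"
| "boundary_rep E (Ghost f) \<xi> (s, m) =
    (if boundary_path E s \<and> fst (s 0) = head E f then \<xi> (prepend E f s, m + 1) else 0)"

context wf_digraph
begin

lemma boundary_path_Suc: "boundary_path G s \<Longrightarrow> boundary_path G (s \<circ> Suc)"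
  by (simp add: boundary_path_def)

lemma boundary_path_prepend:
  "f \<in> arcs G \<Longrightarrow> boundary_path G s \<Longrightarrow> fst (s 0) = head G f \<Longrightarrow> boundary_path G (prepend G f s)"
  by (auto simp: boundary_path_def boundary_step_def split: nat.split)

lemma boundary_path_edge:
  assumes "boundary_path G s" "snd (s 0) = Some f"
  shows "f \<in> arcs G" "fst (s 0) = tail G f" "fst (s (Suc 0)) = head G f"
  using assms spec[of "\<lambda>i. boundary_step G (s i) (s (Suc i))" 0]
  by (auto simp: boundary_path_def boundary_step_def)

lemma prepend_Suc: "prepend G f s \<circ> Suc = s"
  by auto

lemma prepend_shift:
  assumes "boundary_path G s" "snd (s 0) = Some f"
  shows "prepend G f (s \<circ> Suc) = s"
  using boundary_path_edge[OF assms] assms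
  by (auto intro!: ext simp: prod_eq_iff split: nat.split)

lemma boundary_rep_action:
  "letter_action (\<lambda>c \<xi> x. c * \<xi> x :: 'k::field) (boundary_rep G)"
proof
  fix x :: "('a, 'b) lpa_letter" and \<xi> \<eta> :: "(nat \<Rightarrow> 'a \<times> 'b option) \<times> int \<Rightarrow> 'k" and c
  show "boundary_rep G x (\<xi> + \<eta>) = boundary_rep G x \<xi> + boundary_rep G x \<eta>"
    by (rule ext, cases x) auto
  show "boundary_rep G x (\<lambda>y. c * \<xi> y) = (\<lambda>y. c * boundary_rep G x \<xi> y)"
    by (rule ext, cases x) auto
qed

text \<open>The relation with content is \<open>CK2\<close>: a boundary path that begins at a
  regular vertex cannot stop there, so its first edge selects exactly one summand.\<close>

lemma boundary_rep_relator:
  assumes "r \<in> lpa_relators G"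
  shows "letter_action.act (\<lambda>c \<xi> x. c * \<xi> x :: 'k::field) (boundary_rep G) r \<xi> = 0"
proof -
  interpret letter_action "\<lambda>c \<xi> x. c * \<xi> x :: 'k" "boundary_rep G"
    by (rule boundary_rep_action)
  have "act r \<xi> (s, m) = 0" for s m
    using assms
  proof cases
    case (vertices v w)
    then show ?thesis by (auto simp: act_diff act_mult)
  next
    case (tail_edge f)
    then show ?thesis by (auto simp: act_diff act_mult boundary_path_edge)
  next
    case (edge_head f)
    then show ?thesis by (auto simp: act_diff act_mult boundary_path_edge boundary_path_Suc)
  next
    case (ghost_tail f)
    then show ?thesis by (auto simp: act_diff act_mult boundary_path_prepend)
  next
    case (head_ghost f)
    then show ?thesis by (auto simp: act_diff act_mult)
  next
    case (CK1 f f')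
    then show ?thesis by (auto simp: act_diff act_mult boundary_path_prepend prepend_Suc)
  next
    case (CK2 v)
    \<comment> \<open>Removing the first edge \<open>f\<close> and putting it back restores both the
      path and the integer, so edge times ghost is the projection to the paths that begin with
      \<open>f\<close>.\<close>
    have "boundary_rep G (Edge f) (boundary_rep G (Ghost f) \<xi>) (s, m) =
        (if boundary_path G s \<and> snd (s 0) = Some f then \<xi> (s, m) else 0)" for f
      by (auto simp: boundary_path_edge boundary_path_Suc prepend_shift)
    then have "act r \<xi> (s, m) = (if boundary_path G s \<and> fst (s 0) = v then \<xi> (s, m) else 0) -
        (\<Sum>f\<in>out_arcs G v. if boundary_path G s \<and> snd (s 0) = Some f then \<xi> (s, m) else 0)"
      unfolding CK2 by (simp add: act_diff act_sum act_mult sum_fun_apply del: boundary_rep.simps(2,3))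
    moreover have "(\<Sum>f\<in>out_arcs G v. if boundary_path G s \<and> snd (s 0) = Some f then \<xi> (s, m) else 0) =
        (if boundary_path G s \<and> fst (s 0) = v then \<xi> (s, m) else 0)"
    proof (cases "boundary_path G s \<and> fst (s 0) = v")
      case True
      then have "boundary_step G (s 0) (s (Suc 0))" by (simp add: boundary_path_def)
      then obtain f where f: "snd (s 0) = Some f" "f \<in> out_arcs G v"
        using True CK2 by (auto simp: boundary_step_def split: option.splits)
      have "(\<Sum>f'\<in>out_arcs G v. if boundary_path G s \<and> snd (s 0) = Some f' then \<xi> (s, m) else 0) =
          (\<Sum>f'\<in>out_arcs G v. if f = f' then \<xi> (s, m) else 0)"
        using True f by (intro sum.cong) auto
      also have "\<dots> = \<xi> (s, m)" using f CK2 by (simp add: sum.delta regular_vertex_def)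
      finally show ?thesis using True by simp
    next
      case False
      then show ?thesis by (intro trans[OF sum.neutral]) (auto dest: boundary_path_edge)
    qed
    ultimately show ?thesis by simp
  qed
  then show ?thesis by (auto intro!: ext)
qed

text \<open>Follow a chosen edge as long as there is one, at infinite emitters too; at a sink, which
  is not regular, stop and repeat the entry forever.\<close>

lemma boundary_path_exists:
  assumes "u \<in> verts G"
  obtains s where "boundary_path G s" "fst (s 0) = u"
proof -
  define st where "st u = (u, if out_arcs G u = {} then None else Some (SOME f. f \<in> out_arcs G u))" for u
  define nxt where "nxt a = (case snd a of None \<Rightarrow> a | Some f \<Rightarrow> st (head G f))" for a
  define s where "s i = (nxt ^^ i) (st u)" for i
  have st: "fst (st u) = u" "snd (st u) = None \<Longrightarrow> out_arcs G u = {}"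
    "snd (st u) = Some f \<Longrightarrow> f \<in> out_arcs G u" for u f
    unfolding st_def using some_in_eq[of "out_arcs G u"] by (simp_all split: if_splits)
  have s: "s i = st (fst (s i)) \<and> fst (s i) \<in> verts G" for i
  proof (induction i)
    case (Suc i)
    show ?case
    proof (cases "snd (s i)")
      case None
      then have "s (Suc i) = s i" by (simp add: s_def nxt_def)
      then show ?thesis using Suc by simp
    next
      case (Some f)
      then have "s (Suc i) = st (head G f)" by (simp add: s_def nxt_def)
      moreover have "f \<in> arcs G" using Some Suc st(3)[of "fst (s i)" f] by auto
      ultimately show ?thesis by (simp add: st(1))
    qed
  qed (simp add: s_def st(1) assms)
  have "boundary_step G (s i) (s (Suc i))" for i
  proof (cases "snd (s i)")
    case None
    then have "out_arcs G (fst (s i)) = {}" using s[of i] st(2)[of "fst (s i)"] by metis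
    then show ?thesis using None s[of i] by (simp add: boundary_step_def regular_vertex_def)
  next
    case (Some f)
    then have "f \<in> out_arcs G (fst (s i))" using s[of i] st(3)[of "fst (s i)" f] by metis
    moreover have "fst (s (Suc i)) = head G f" using Some by (simp add: s_def nxt_def st(1))
    ultimately show ?thesis using Some s[of i] unfolding boundary_step_def by auto
  qed
  moreover have "fst (s 0) = u" by (simp add: s_def st(1))
  ultimately show ?thesis using that[of s] by (simp only: boundary_path_def simp_thms)
qed

end

section \<open>The subalgebra of classes: grading and universal property\<close>

definition lpa_image :: "('v, 'e) pre_digraph \<Rightarrow> ('v, 'e, 'k::field) lpa_quotient set" where
  "lpa_image E = lpa_class E ` free_carrier (lpa_letters E)"

lemma lpa_image_class: "p \<in> free_carrier (lpa_letters E) \<Longrightarrow> lpa_class E p \<in> lpa_image E"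
  unfolding lpa_image_def by (rule imageI)

lemma lpa_image_0: "0 \<in> lpa_image E"
  unfolding lpa_image_def by (intro image_eqI[of _ _ 0]) (simp_all add: lpa_class_0 free_carrier_0)

lemma lpa_image_add: "x \<in> lpa_image E \<Longrightarrow> y \<in> lpa_image E \<Longrightarrow> x + y \<in> lpa_image E"
  unfolding lpa_image_def by (auto simp: lpa_class_add[symmetric] intro: free_carrier_add)

lemma lpa_image_mult: "x \<in> lpa_image E \<Longrightarrow> y \<in> lpa_image E \<Longrightarrow> x * y \<in> lpa_image E"
  unfolding lpa_image_def by (auto simp: lpa_class_mult[symmetric] intro: free_carrier_mult)

lemma lpa_image_scale: "x \<in> lpa_image E \<Longrightarrow> quotient_scale c x \<in> lpa_image E"
  unfolding lpa_image_def by (auto simp: lpa_class_scale[symmetric] intro: free_carrier_scale)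

lemma lpa_image_sum: "(\<And>i. i \<in> S \<Longrightarrow> g i \<in> lpa_image E) \<Longrightarrow> (\<Sum>i\<in>S. g i) \<in> lpa_image E"
  by (induction S rule: infinite_finite_induct) (auto simp: lpa_image_0 lpa_image_add)

lemma lpa_image_induct [consumes 1, case_names zero gen add scale mult]:
  fixes x :: "('v, 'e, 'k::field) lpa_quotient"
  assumes "x \<in> lpa_image E" and "P 0"
    and "\<And>l. l \<in> lpa_letters E \<Longrightarrow> P (lpa_class E (free_gen l))"
    and "\<And>x y. P x \<Longrightarrow> P y \<Longrightarrow> x \<in> lpa_image E \<Longrightarrow> y \<in> lpa_image E \<Longrightarrow> P (x + y)"
    and "\<And>c x. P x \<Longrightarrow> x \<in> lpa_image E \<Longrightarrow> P (quotient_scale c x)"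
    and "\<And>x y. P x \<Longrightarrow> P y \<Longrightarrow> x \<in> lpa_image E \<Longrightarrow> y \<in> lpa_image E \<Longrightarrow> P (x * y)"
  shows "P x"
proof -
  have "P (lpa_class E p)" if "p \<in> free_carrier (lpa_letters E)" for p
    using that
    by (induction rule: free_carrier_induct)
      (simp_all add: lpa_class_0 lpa_class_add lpa_class_scale lpa_class_mult assms(2-6) lpa_image_class)
  then show ?thesis using assms(1) unfolding lpa_image_def by blast
qed

lemma lpa_leavitt_family:
  assumes "wf_digraph E" "finite (verts E)"
  shows "leavitt_family E (quotient_scale :: 'k::field \<Rightarrow> ('v, 'e, 'k) lpa_quotient \<Rightarrow> _)
    (\<lambda>u. lpa_class E (free_gen (Vertex u))) (\<lambda>f. lpa_class E (free_gen (Edge f)))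
    (\<lambda>f. lpa_class E (free_gen (Ghost f)))"
proof -
  interpret wf_digraph E by fact
  have 1: "lpa_class E (free_gen (Vertex u)) * lpa_class E (free_gen (Vertex u')) =
      (if u = u' then lpa_class E (free_gen (Vertex u)) else (0 :: ('v, 'e, 'k) lpa_quotient))"
    if "u \<in> verts E" "u' \<in> verts E" for u u'
    using lpa_class_relator[OF lpa_relators.vertices[OF that]]
    by (auto simp: lpa_class_diff lpa_class_mult lpa_class_0 split: if_splits)
  have 2: "lpa_class E (free_gen (Vertex (tail E f))) * lpa_class E (free_gen (Edge f)) =
      (lpa_class E (free_gen (Edge f)) :: ('v, 'e, 'k) lpa_quotient)" if "f \<in> arcs E" for f
    using lpa_class_relator[OF lpa_relators.tail_edge[OF that]]
    by (simp add: lpa_class_diff lpa_class_mult)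
  have 3: "lpa_class E (free_gen (Edge f)) * lpa_class E (free_gen (Vertex (head E f))) =
      (lpa_class E (free_gen (Edge f)) :: ('v, 'e, 'k) lpa_quotient)" if "f \<in> arcs E" for f
    using lpa_class_relator[OF lpa_relators.edge_head[OF that]]
    by (simp add: lpa_class_diff lpa_class_mult)
  have 4: "lpa_class E (free_gen (Ghost f)) * lpa_class E (free_gen (Vertex (tail E f))) =
      (lpa_class E (free_gen (Ghost f)) :: ('v, 'e, 'k) lpa_quotient)" if "f \<in> arcs E" for f
    using lpa_class_relator[OF lpa_relators.ghost_tail[OF that]]
    by (simp add: lpa_class_diff lpa_class_mult)
  have 5: "lpa_class E (free_gen (Vertex (head E f))) * lpa_class E (free_gen (Ghost f)) =
      (lpa_class E (free_gen (Ghost f)) :: ('v, 'e, 'k) lpa_quotient)" if "f \<in> arcs E" for f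
    using lpa_class_relator[OF lpa_relators.head_ghost[OF that]]
    by (simp add: lpa_class_diff lpa_class_mult)
  have 6: "lpa_class E (free_gen (Ghost f)) * lpa_class E (free_gen (Edge f')) =
      (if f = f' then lpa_class E (free_gen (Vertex (head E f))) else (0 :: ('v, 'e, 'k) lpa_quotient))"
    if "f \<in> arcs E" "f' \<in> arcs E" for f f'
    using lpa_class_relator[OF lpa_relators.CK1[OF that]]
    by (auto simp: lpa_class_diff lpa_class_mult lpa_class_0 split: if_splits)
  have 7: "(\<Sum>f\<in>out_arcs E u. lpa_class E (free_gen (Edge f)) * lpa_class E (free_gen (Ghost f))) =
      (lpa_class E (free_gen (Vertex u)) :: ('v, 'e, 'k) lpa_quotient)"
    if "u \<in> verts E" "out_arcs E u \<noteq> {}" "finite (out_arcs E u)" for u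
  proof -
    have "lpa_class E (free_gen (Vertex u) - (\<Sum>f\<in>out_arcs E u. free_gen (Edge f) * free_gen (Ghost f))) =
        (0 :: ('v, 'e, 'k) lpa_quotient)"
      using that by (intro lpa_class_relator lpa_relators.CK2) (simp add: regular_vertex_def)
    then show ?thesis by (simp add: lpa_class_diff lpa_class_mult lpa_class_sum)
  qed
  show ?thesis
    by unfold_locales
      (fact quotient_scale_mult_left quotient_scale_mult_right assms(2) 1 2 3 4 5 6 7
       | rule quotient_scale_mult_left quotient_scale_mult_right assms(2) 1 2 3 4 5 6 7; assumption)+
qed

lemma lpa_family_L:
  assumes "wf_digraph E" "finite (verts E)"
  shows "leavitt_family.L E (quotient_scale :: 'k::field \<Rightarrow> ('v, 'e, 'k) lpa_quotient \<Rightarrow> _)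
    (\<lambda>u. lpa_class E (free_gen (Vertex u))) (\<lambda>f. lpa_class E (free_gen (Edge f)))
    (\<lambda>f. lpa_class E (free_gen (Ghost f))) = lpa_image E"
proof -
  let ?V = "\<lambda>u. lpa_class E (free_gen (Vertex u)) :: ('v, 'e, 'k) lpa_quotient"
  let ?D = "\<lambda>f. lpa_class E (free_gen (Edge f)) :: ('v, 'e, 'k) lpa_quotient"
  let ?G = "\<lambda>f. lpa_class E (free_gen (Ghost f)) :: ('v, 'e, 'k) lpa_quotient"
  interpret leavitt_family E quotient_scale ?V ?D ?G by (rule lpa_leavitt_family[OF assms])
  have V: "?V u \<in> lpa_image E" if "u \<in> verts E" for u
    by (intro lpa_image_class vertex_carrier that)
  have D: "?D f \<in> lpa_image E" and G: "?G f \<in> lpa_image E" if "f \<in> arcs E" for f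
    by (intro lpa_image_class edge_carrier ghost_carrier that)+
  have path: "x \<in> lpa_image E" if "path_sum n x" for n x
    using that by induction (auto intro: lpa_image_0 V D lpa_image_add lpa_image_scale lpa_image_mult)
  have "x \<in> lpa_image E" if "elem m x" for m x
    using that by induction (auto intro: path G lpa_image_add lpa_image_mult)
  moreover have "x \<in> L" if "x \<in> lpa_image E" for x
    using that by (induction rule: lpa_image_induct) (auto simp: lpa_letters_def)
  ultimately show ?thesis unfolding L_def by auto
qed

text \<open>A vertex preserves the integer coordinate, whereas positive paths push the support of a
  function upwards by at least 1. Hence only the vertex term contributes in degree 0.\<close>

lemma lpa_graded_leavitt_family:
  assumes "wf_digraph E" "finite (verts E)"
  shows "graded_leavitt_family E (quotient_scale :: 'k::field \<Rightarrow> ('v, 'e, 'k) lpa_quotient \<Rightarrow> _)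
    (\<lambda>u. lpa_class E (free_gen (Vertex u))) (\<lambda>f. lpa_class E (free_gen (Edge f)))
    (\<lambda>f. lpa_class E (free_gen (Ghost f)))"
proof -
  let ?V = "\<lambda>u. lpa_class E (free_gen (Vertex u)) :: ('v, 'e, 'k) lpa_quotient"
  let ?D = "\<lambda>f. lpa_class E (free_gen (Edge f)) :: ('v, 'e, 'k) lpa_quotient"
  let ?G = "\<lambda>f. lpa_class E (free_gen (Ghost f)) :: ('v, 'e, 'k) lpa_quotient"
  interpret Q: leavitt_family E quotient_scale ?V ?D ?G by (rule lpa_leavitt_family[OF assms])
  interpret B: letter_action "\<lambda>c \<xi> x. c * \<xi> x :: 'k" "boundary_rep E" by (rule Q.boundary_rep_action)
  let ?F = "free_carrier (lpa_letters E) :: (('v, 'e) lpa_letter, 'k) free_alg set"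
  define low :: "int \<Rightarrow> ((nat \<Rightarrow> 'v \<times> 'e option) \<times> int \<Rightarrow> 'k) \<Rightarrow> bool"
    where "low d \<xi> \<longleftrightarrow> (\<forall>s m. m < d \<longrightarrow> \<xi> (s, m) = 0)" for d \<xi>
  \<comment> \<open>One suitable representative is enough: the action is defined on the free
    algebra, and two representatives of a class differ by an element of \<open>free_ideal\<close>,
    which acts as 0.\<close>
  define raises where "raises d x \<longleftrightarrow> (\<exists>p\<in>?F. lpa_class E p = x \<and> (\<forall>\<xi>. low 0 \<xi> \<longrightarrow> low d (B.act p \<xi>)))" for d x
  have raises_0: "raises d 0" for d
    unfolding raises_def low_def by (intro bexI[of _ 0]) (auto simp: free_carrier_0 lpa_class_0)
  have raises_add: "raises d (x + y)" if xy: "raises d x" "raises d y" for d x y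
  proof -
    obtain p q where p: "p \<in> ?F" "lpa_class E p = x" "\<forall>\<xi>. low 0 \<xi> \<longrightarrow> low d (B.act p \<xi>)"
      and q: "q \<in> ?F" "lpa_class E q = y" "\<forall>\<xi>. low 0 \<xi> \<longrightarrow> low d (B.act q \<xi>)"
      using xy unfolding raises_def by blast
    then show ?thesis
      unfolding raises_def low_def
      by (intro bexI[of _ "p + q"]) (auto simp: free_carrier_add lpa_class_add B.act_add)
  qed
  have raises_scale: "raises d (quotient_scale c x)" if x: "raises d x" for d c x
  proof -
    obtain p where p: "p \<in> ?F" "lpa_class E p = x" "\<forall>\<xi>. low 0 \<xi> \<longrightarrow> low d (B.act p \<xi>)"
      using x unfolding raises_def by blast
    then show ?thesis
      unfolding raises_def low_def
      by (intro bexI[of _ "free_scale c p"]) (auto simp: free_carrier_scale lpa_class_scale B.act_scale)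
  qed
  have raises_D: "raises 1 (?D f * x)" if x: "raises 0 x" "f \<in> arcs E" for f x
  proof -
    obtain p where p: "p \<in> ?F" "lpa_class E p = x" "\<forall>\<xi>. low 0 \<xi> \<longrightarrow> low 0 (B.act p \<xi>)"
      using x unfolding raises_def by blast
    then show ?thesis
      unfolding raises_def low_def using x(2)
      by (intro bexI[of _ "free_gen (Edge f) * p"])
        (auto simp: lpa_class_mult B.act_mult intro: free_carrier_mult edge_carrier)
  qed
  have raises_mono: "raises 0 x" if "raises 1 x" for x
    using that unfolding raises_def low_def by force
  have path: "raises 0 x" if "Q.path_sum n x" for n x
    using that
  proof induction
    case (vertex u n)
    then show ?case
      unfolding raises_def low_def
      by (intro bexI[of _ "free_gen (Vertex u)"]) (auto intro: vertex_carrier)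
  qed (auto intro: raises_0 raises_add raises_scale raises_D raises_mono)
  have pos: "raises 1 r" if "r \<in> quotient.span Q.paths_pos" for r
    using that
    by (induction rule: quotient.span_induct_alt)
      (auto simp: Q.paths_pos_def intro!: raises_0 raises_add raises_scale raises_D path)
  show ?thesis
  proof unfold_locales
    fix u r and c :: 'k
    assume u: "u \<in> verts E" and r: "r \<in> quotient.span Q.paths_pos" and eq: "quotient_scale c (?V u) + r = 0"
    obtain p where p: "p \<in> ?F" "lpa_class E p = r" "\<forall>\<xi>. low 0 \<xi> \<longrightarrow> low 1 (B.act p \<xi>)"
      using pos[OF r] unfolding raises_def by blast
    let ?q = "free_scale c (free_gen (Vertex u)) + p"
    have q: "?q \<in> ?F" using u p(1) by (intro free_carrier_add free_carrier_scale vertex_carrier)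
    have "lpa_class E ?q = lpa_class E 0"
      using eq p(2) by (simp add: lpa_class_add lpa_class_scale lpa_class_0)
    then have "?q \<in> free_ideal (lpa_letters E) (lpa_relators E)"
      using lpa_class_eq_iff[OF q free_carrier_0] by simp
    then have act: "B.act ?q \<xi> = 0" for \<xi>
      using B.act_free_ideal Q.boundary_rep_relator by blast
    obtain s where s: "boundary_path E s" "fst (s 0) = u" using Q.boundary_path_exists[OF u] by blast
    \<comment> \<open>A test function concentrated in degree 0. At a boundary path that begins at
      \<open>u\<close>, the vertex term has value \<open>c\<close> and the term from
      \<open>p\<close> has value 0.\<close>
    define \<xi> :: "(nat \<Rightarrow> 'v \<times> 'e option) \<times> int \<Rightarrow> 'k" where "\<xi> = (\<lambda>(s, m). if m = 0 then 1 else 0)"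
    have "low 0 \<xi>" by (simp add: low_def \<xi>_def)
    then have "B.act p \<xi> (s, 0) = 0" using p(3) by (simp add: low_def)
    moreover have "B.act ?q \<xi> (s, 0) = c + B.act p \<xi> (s, 0)"
      using s by (simp add: B.act_add B.act_scale \<xi>_def)
    ultimately show "c = 0" using act[of \<xi>] by simp
  qed
qed

lemma lpa_endo_kernel_trivial:
  fixes A :: "('v, 'e, 'k::field) lpa_quotient \<Rightarrow> ('v, 'e, 'k) lpa_quotient"
  assumes "wf_digraph E" "finite (verts E)"
    and "\<And>x. x \<in> lpa_image E \<Longrightarrow> A x \<in> lpa_image E"
    and "\<And>x y. x \<in> lpa_image E \<Longrightarrow> y \<in> lpa_image E \<Longrightarrow> A (x + y) = A x + A y"
    and "\<And>x y. x \<in> lpa_image E \<Longrightarrow> y \<in> lpa_image E \<Longrightarrow> A (x * y) = A x * A y"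
    and "\<And>c x. x \<in> lpa_image E \<Longrightarrow> A (quotient_scale c x) = quotient_scale c (A x)"
    and "\<And>u. u \<in> verts E \<Longrightarrow> A (lpa_class E (free_gen (Vertex u))) = lpa_class E (free_gen (Vertex u))"
    and "\<And>y. y \<in> lpa_image E \<Longrightarrow> \<exists>x\<in>lpa_image E. A x = y"
    and "z \<in> lpa_image E" "A z = 0"
  shows "z = 0"
proof -
  let ?V = "\<lambda>u. lpa_class E (free_gen (Vertex u)) :: ('v, 'e, 'k) lpa_quotient"
  let ?D = "\<lambda>f. lpa_class E (free_gen (Edge f)) :: ('v, 'e, 'k) lpa_quotient"
  let ?G = "\<lambda>f. lpa_class E (free_gen (Ghost f)) :: ('v, 'e, 'k) lpa_quotient"
  interpret graded_leavitt_family E quotient_scale ?V ?D ?G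
    by (rule lpa_graded_leavitt_family[OF assms(1,2)])
  have L: "L = lpa_image E" by (rule lpa_family_L[OF assms(1,2)])
  interpret leavitt_endo E quotient_scale ?V ?D ?G A
    by unfold_locales (simp_all add: L assms(3-8))
  show ?thesis using A_kernel_trivial assms(9,10) by (simp add: L)
qed

text \<open>\<open>A\<close> evaluates a chosen representative in the given family; the choice does
  not matter because all relators evaluate to 0.\<close>

lemma lpa_universal:
  fixes V D G :: "_ \<Rightarrow> ('v, 'e, 'k::field) lpa_quotient"
  assumes "wf_digraph E" "leavitt_family E quotient_scale V D G"
    and "\<And>u. u \<in> verts E \<Longrightarrow> V u \<in> lpa_image E"
    and "\<And>f. f \<in> arcs E \<Longrightarrow> D f \<in> lpa_image E" "\<And>f. f \<in> arcs E \<Longrightarrow> G f \<in> lpa_image E"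
  obtains A where "\<And>x. x \<in> lpa_image E \<Longrightarrow> A x \<in> lpa_image E"
    and "\<And>x y. x \<in> lpa_image E \<Longrightarrow> y \<in> lpa_image E \<Longrightarrow> A (x + y) = A x + A y"
    and "\<And>x y. x \<in> lpa_image E \<Longrightarrow> y \<in> lpa_image E \<Longrightarrow> A (x * y) = A x * A y"
    and "\<And>c x. x \<in> lpa_image E \<Longrightarrow> A (quotient_scale c x) = quotient_scale c (A x)"
    and "\<And>u. u \<in> verts E \<Longrightarrow> A (lpa_class E (free_gen (Vertex u))) = V u"
    and "\<And>f. f \<in> arcs E \<Longrightarrow> A (lpa_class E (free_gen (Edge f))) = D f"
    and "\<And>f. f \<in> arcs E \<Longrightarrow> A (lpa_class E (free_gen (Ghost f))) = G f"
proof -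
  let ?F = "free_carrier (lpa_letters E) :: (('v, 'e) lpa_letter, 'k) free_alg set"
  interpret Q: leavitt_family E quotient_scale V D G by fact
  define s where "s = case_lpa_letter V D G"
  interpret letter_substitution quotient_scale s by (rule letter_substitution_quotient)
  have s: "s (Vertex u) = V u" "s (Edge f) = D f" "s (Ghost f) = G f" for u f
    by (simp_all add: s_def)
  have relator: "ev r = 0" if "r \<in> lpa_relators E" for r
    using that
  proof cases
    case (CK2 v)
    then show ?thesis
      using Q.CK[of v] by (simp add: regular_vertex_def ev_diff ev_sum ev_mult s)
  qed (auto simp: ev_diff ev_mult s Q.V_V Q.tail_D Q.D_head Q.G_tail Q.head_G Q.G_D)
  have ev_eq: "ev p = ev p'" if "p \<in> ?F" "p' \<in> ?F" "lpa_class E p = lpa_class E p'" for p p'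
  proof -
    have "p - p' \<in> free_ideal (lpa_letters E) (lpa_relators E)"
      using lpa_class_eq_iff[OF that(1,2)] that(3) by simp
    then have "ev (p - p') = 0" by (rule ev_free_ideal[OF _ relator])
    then show ?thesis by (simp add: ev_diff)
  qed
  define A where "A x = ev (SOME p. p \<in> ?F \<and> lpa_class E p = x)" for x
  have A: "A (lpa_class E p) = ev p" if "p \<in> ?F" for p
  proof -
    have "(SOME q. q \<in> ?F \<and> lpa_class E q = lpa_class E p) \<in> ?F \<and>
        lpa_class E (SOME q. q \<in> ?F \<and> lpa_class E q = lpa_class E p) = lpa_class E p"
      by (rule someI[of _ p]) (use that in simp)
    then show ?thesis unfolding A_def using ev_eq that by blast
  qed
  have ev_image: "ev p \<in> lpa_image E" if "p \<in> ?F" for p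
    using that
    by (induction rule: free_carrier_induct)
      (auto simp: ev_add ev_scale ev_mult lpa_letters_def s assms(3-5)
        intro: lpa_image_0 lpa_image_add lpa_image_scale lpa_image_mult)
  show ?thesis
  proof (rule that[of A])
    show "A x \<in> lpa_image E" if "x \<in> lpa_image E" for x
      using that A ev_image unfolding lpa_image_def[of E] by force
    show "A (x + y) = A x + A y" "A (x * y) = A x * A y"
      if "x \<in> lpa_image E" "y \<in> lpa_image E" for x y
      using that unfolding lpa_image_def
      by (auto simp: lpa_class_add[symmetric] lpa_class_mult[symmetric] A ev_add ev_mult
          free_carrier_add free_carrier_mult)
    show "A (quotient_scale c x) = quotient_scale c (A x)" if "x \<in> lpa_image E" for c x
      using that unfolding lpa_image_def
      by (auto simp: lpa_class_scale[symmetric] A ev_scale free_carrier_scale)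
  qed (simp_all add: A vertex_carrier edge_carrier ghost_carrier s)
qed

section \<open>The ring record and its matrix rings\<close>

text \<open>The coset itself, that is, the element of the record that corresponds to the class
  \<open>x\<close>. Together with \<open>to_class\<close> it translates between the ring type and
  the record.\<close>

definition of_class :: "('v, 'e) pre_digraph \<Rightarrow> ('v, 'e, 'k::field) lpa_quotient \<Rightarrow> ('v, 'e, 'k) lpa_elem" where
  "of_class E x = {p \<in> free_carrier (lpa_letters E). lpa_class E p = x}"

definition to_class :: "('v, 'e) pre_digraph \<Rightarrow> ('v, 'e, 'k::field) lpa_elem \<Rightarrow> ('v, 'e, 'k) lpa_quotient" where
  "to_class E = inv_into (lpa_image E) (of_class E)"

definition unit_class :: "('v, 'e) pre_digraph \<Rightarrow> ('v, 'e, 'k::field) lpa_quotient" where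
  "unit_class E = (\<Sum>u\<in>verts E. lpa_class E (free_gen (Vertex u)))"

lemma lpa_rel_class:
  assumes "p \<in> free_carrier (lpa_letters E)"
  shows "lpa_rel E `` {p} = of_class E (lpa_class E p)"
  using assms unfolding lpa_rel_def of_class_def
  by (auto simp: lpa_class_eq_iff[symmetric])

lemma inj_of_class: "inj_on (of_class E) (lpa_image E)"
proof (rule inj_onI)
  fix x y assume x: "x \<in> lpa_image E" and eq: "of_class E x = of_class E y"
  then obtain p where "p \<in> of_class E x" unfolding lpa_image_def of_class_def by blast
  then have "lpa_class E p = x" "lpa_class E p = y"
    using eq unfolding of_class_def by auto
  then show "x = y" by simp
qed

lemma of_class_eq_iff: "x \<in> lpa_image E \<Longrightarrow> y \<in> lpa_image E \<Longrightarrow> of_class E x = of_class E y \<longleftrightarrow> x = y"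
  using inj_of_class by (rule inj_on_eq_iff)

lemma to_of_class [simp]: "x \<in> lpa_image E \<Longrightarrow> to_class E (of_class E x) = x"
  unfolding to_class_def by (rule inv_into_f_f[OF inj_of_class])

lemma carrier_lpa: "carrier (lpa E) = of_class E ` lpa_image E"
  unfolding lpa_def lpa_image_def quotient_def by (auto simp: lpa_rel_class image_image)

lemma of_class_carrier: "x \<in> lpa_image E \<Longrightarrow> of_class E x \<in> carrier (lpa E)"
  by (simp add: carrier_lpa)

lemma to_class_image: "X \<in> carrier (lpa E) \<Longrightarrow> to_class E X \<in> lpa_image E"
  and of_to_class: "X \<in> carrier (lpa E) \<Longrightarrow> of_class E (to_class E X) = X"
  by (auto simp: carrier_lpa)

lemma of_class_nonempty: "x \<in> lpa_image E \<Longrightarrow> of_class E x \<noteq> {}"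
  unfolding lpa_image_def of_class_def by blast

text \<open>The operations of the record are unions over representatives. Once the value is
  independent of the representatives, such a union is this one value.\<close>

lemma UN_constant2: "A \<noteq> {} \<Longrightarrow> B \<noteq> {} \<Longrightarrow> (\<And>a b. a \<in> A \<Longrightarrow> b \<in> B \<Longrightarrow> h a b = C) \<Longrightarrow>
    (\<Union>a\<in>A. \<Union>b\<in>B. h a b) = C"
  by fastforce

lemma lpa_mult:
  assumes "x \<in> lpa_image E" "y \<in> lpa_image E"
  shows "of_class E x \<otimes>\<^bsub>lpa E\<^esub> of_class E y = of_class E (x * y)"
proof -
  have "(\<Union>a\<in>of_class E x. \<Union>b\<in>of_class E y. lpa_rel E `` {a * b}) = of_class E (x * y)"
    using assms
    by (intro UN_constant2 of_class_nonempty)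
      (auto simp: of_class_def[of E x] of_class_def[of E y] lpa_rel_class free_carrier_mult lpa_class_mult)
  then show ?thesis by (simp add: lpa_def)
qed

lemma lpa_add:
  assumes "x \<in> lpa_image E" "y \<in> lpa_image E"
  shows "of_class E x \<oplus>\<^bsub>lpa E\<^esub> of_class E y = of_class E (x + y)"
proof -
  have "(\<Union>a\<in>of_class E x. \<Union>b\<in>of_class E y. lpa_rel E `` {a + b}) = of_class E (x + y)"
    using assms
    by (intro UN_constant2 of_class_nonempty)
      (auto simp: of_class_def[of E x] of_class_def[of E y] lpa_rel_class free_carrier_add lpa_class_add)
  then show ?thesis by (simp add: lpa_def)
qed

lemma lpa_smult:
  assumes "x \<in> lpa_image E"
  shows "c \<odot>\<^bsub>lpa E\<^esub> of_class E x = of_class E (quotient_scale c x)"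
proof -
  \<comment> \<open>The one-point second index brings a unary operation into the form of
    \<open>UN_constant2\<close>.\<close>
  have "(\<Union>a\<in>of_class E x. \<Union>b\<in>{()}. lpa_rel E `` {free_scale c a}) = of_class E (quotient_scale c x)"
    using assms
    by (intro UN_constant2 of_class_nonempty)
      (auto simp: of_class_def[of E x] lpa_rel_class free_carrier_scale lpa_class_scale)
  then show ?thesis by (simp add: lpa_def)
qed

lemma lpa_zero: "\<zero>\<^bsub>lpa E\<^esub> = of_class E 0"
  by (simp add: lpa_def lpa_rel_class free_carrier_0 lpa_class_0)

lemma lpa_one: "\<one>\<^bsub>lpa E\<^esub> = of_class E (unit_class E)"
  by (simp add: lpa_def unit_class_def lpa_rel_class free_carrier_sum vertex_carrier lpa_class_sum)

lemma lpa_gen_class: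
  "l \<in> lpa_letters E \<Longrightarrow> lpa_gen E l = of_class E (lpa_class E (free_gen l))"
  by (simp add: lpa_gen_def lpa_rel_class free_carrier_gen)

lemma unit_class_image: "unit_class E \<in> lpa_image E"
  unfolding unit_class_def by (intro lpa_image_sum lpa_image_class vertex_carrier)

lemma unit_class_mult:
  fixes x :: "('v, 'e, 'k::field) lpa_quotient"
  assumes "wf_digraph E" "finite (verts E)" "x \<in> lpa_image E"
  shows "unit_class E * x = x" "x * unit_class E = x"
proof -
  interpret leavitt_family E "quotient_scale :: 'k \<Rightarrow> ('v, 'e, 'k) lpa_quotient \<Rightarrow> _"
    "\<lambda>u. lpa_class E (free_gen (Vertex u))" "\<lambda>f. lpa_class E (free_gen (Edge f))"
    "\<lambda>f. lpa_class E (free_gen (Ghost f))"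
    by (rule lpa_leavitt_family[OF assms(1,2)])
  show "unit_class E * x = x" "x * unit_class E = x"
    using assms(3) V_unit_left V_unit_right
    by (simp_all add: unit_class_def lpa_family_L[OF assms(1,2)])
qed

lemma lpa_ring:
  assumes "wf_digraph E" "finite (verts E)"
  shows "Ring.ring (lpa E :: ('k::field, ('v, 'e, 'k) lpa_elem) module)"
proof -
  let ?L = "lpa E :: ('k, ('v, 'e, 'k) lpa_elem) module"
  note ops = lpa_add lpa_mult lpa_zero lpa_one lpa_image_add lpa_image_mult lpa_image_0
    unit_class_image unit_class_mult[OF assms]
  have "abelian_group ?L"
  proof (rule abelian_groupI)
    fix X assume "X \<in> carrier ?L"
    then obtain x where x: "x \<in> lpa_image E" "X = of_class E x" by (auto simp: carrier_lpa)
    have "quotient_scale (- 1) x \<in> lpa_image E" using x lpa_image_scale by blast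
    moreover have "quotient_scale (- 1) x + x = 0"
      by (simp add: quotient.scale_minus_left)
    ultimately show "\<exists>Y\<in>carrier ?L. Y \<oplus>\<^bsub>?L\<^esub> X = \<zero>\<^bsub>?L\<^esub>"
      using x by (intro bexI[of _ "of_class E (quotient_scale (- 1) x)"]) (auto simp: ops carrier_lpa)
  qed (auto simp: carrier_lpa ops ac_simps)
  moreover have "Group.monoid ?L"
    by (rule monoidI) (auto simp: carrier_lpa ops mult.assoc)
  ultimately show ?thesis
    by (rule ringI) (auto simp: carrier_lpa ops distrib_left distrib_right)
qed

lemma lpa_finsum:
  fixes g :: "'i \<Rightarrow> ('v, 'e, 'k::field) lpa_quotient"
  assumes "wf_digraph E" "finite (verts E)" "finite S"
    and "\<And>k. k \<in> S \<Longrightarrow> g k \<in> lpa_image E" "\<And>k. k \<in> S \<Longrightarrow> h k = of_class E (g k)"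
  shows "(\<Oplus>\<^bsub>lpa E\<^esub>k\<in>S. h k) = of_class E (\<Sum>k\<in>S. g k)"
proof -
  interpret ring "lpa E :: ('k, ('v, 'e, 'k) lpa_elem) module" by (rule lpa_ring[OF assms(1,2)])
  show ?thesis
    using assms(3-5)
  proof (induction S rule: finite_induct)
    case (insert k S)
    have "(\<Oplus>\<^bsub>lpa E\<^esub>i\<in>insert k S. h i) = h k \<oplus>\<^bsub>lpa E\<^esub> (\<Oplus>\<^bsub>lpa E\<^esub>i\<in>S. h i)"
      using insert by (intro finsum_insert) (auto simp: carrier_lpa)
    also have "\<dots> = of_class E (g k + (\<Sum>i\<in>S. g i))"
      using insert by (simp add: lpa_add lpa_image_sum)
    finally show ?case using insert by simp
  qed (simp add: lpa_zero)
qed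

section \<open>Matrices over the algebra\<close>

definition class_mat :: "('v, 'e) pre_digraph \<Rightarrow> nat \<Rightarrow> (nat \<Rightarrow> nat \<Rightarrow> ('v, 'e, 'k::field) lpa_quotient) \<Rightarrow>
    ('v, 'e, 'k) lpa_elem mat" where
  "class_mat E n p = mat n n (\<lambda>(i, j). of_class E (p i j))"

lemma class_mat_entry [simp]: "i < n \<Longrightarrow> j < n \<Longrightarrow> class_mat E n p $$ (i, j) = of_class E (p i j)"
  by (simp add: class_mat_def)

lemma class_mat_carrier:
  "(\<And>i j. i < n \<Longrightarrow> j < n \<Longrightarrow> p i j \<in> lpa_image E) \<Longrightarrow> class_mat E n p \<in> carrier (mat_ring n (lpa E))"
  by (auto simp: mat_ring_def class_mat_def of_class_carrier)

lemma mat_ring_carrierE: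
  assumes "M \<in> carrier (mat_ring n (lpa E))"
  obtains p where "\<And>i j. i < n \<Longrightarrow> j < n \<Longrightarrow> p i j \<in> lpa_image E" "M = class_mat E n p"
proof (rule that[of "\<lambda>i j. to_class E (M $$ (i, j))"])
  show "M = class_mat E n (\<lambda>i j. to_class E (M $$ (i, j)))"
    using assms by (intro eq_matI) (auto simp: mat_ring_def class_mat_def of_to_class)
qed (use assms in \<open>auto simp: mat_ring_def to_class_image\<close>)

lemma class_mat_eq_iff:
  assumes "\<And>i j. i < n \<Longrightarrow> j < n \<Longrightarrow> p i j \<in> lpa_image E" "\<And>i j. i < n \<Longrightarrow> j < n \<Longrightarrow> q i j \<in> lpa_image E"
  shows "class_mat E n p = class_mat E n q \<longleftrightarrow> (\<forall>i<n. \<forall>j<n. p i j = q i j)"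
proof
  assume "class_mat E n p = class_mat E n q"
  then have "of_class E (p i j) = of_class E (q i j)" if "i < n" "j < n" for i j
    using that by (metis class_mat_entry)
  then show "\<forall>i<n. \<forall>j<n. p i j = q i j" using assms by (simp add: of_class_eq_iff)
qed (auto simp: class_mat_def intro!: cong_mat)

lemma class_mat_mult:
  assumes "wf_digraph E" "finite (verts E)"
    and "\<And>i j. i < n \<Longrightarrow> j < n \<Longrightarrow> p i j \<in> lpa_image E" "\<And>i j. i < n \<Longrightarrow> j < n \<Longrightarrow> q i j \<in> lpa_image E"
  shows "class_mat E n p \<otimes>\<^bsub>mat_ring n (lpa E)\<^esub> class_mat E n q =
    class_mat E n (\<lambda>i j. \<Sum>k<n. p i k * q k j)"
proof (rule eq_matI)
  fix i j assume "i < dim_row (class_mat E n (\<lambda>i j. \<Sum>k<n. p i k * q k j))"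
    "j < dim_col (class_mat E n (\<lambda>i j. \<Sum>k<n. p i k * q k j))"
  then have ij: "i < n" "j < n" by (simp_all add: class_mat_def)
  have "(\<Oplus>\<^bsub>lpa E\<^esub>k\<in>{..<n}. class_mat E n p $$ (i, k) \<otimes>\<^bsub>lpa E\<^esub> class_mat E n q $$ (k, j)) =
      of_class E (\<Sum>k<n. p i k * q k j)"
    using ij assms by (intro lpa_finsum) (auto simp: lpa_mult lpa_image_mult)
  then show "(class_mat E n p \<otimes>\<^bsub>mat_ring n (lpa E)\<^esub> class_mat E n q) $$ (i, j) =
      class_mat E n (\<lambda>i j. \<Sum>k<n. p i k * q k j) $$ (i, j)"
    using ij by (simp add: mat_ring_def)
qed (simp_all add: mat_ring_def class_mat_def)

lemma class_mat_one: "\<one>\<^bsub>mat_ring n (lpa E)\<^esub> = class_mat E n (\<lambda>i j. if i = j then unit_class E else 0)"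
  unfolding mat_ring_def class_mat_def by (auto simp: lpa_one lpa_zero intro!: cong_mat)

text \<open>The multiplicative structure is what makes inverses unique, and so identifies
  \<open>inv\<close> with an inverse given by its entries.\<close>

lemma mat_ring_monoid:
  assumes "wf_digraph E" "finite (verts E)"
  shows "Group.monoid (mat_ring n (lpa E :: ('k::field, ('v, 'e, 'k) lpa_elem) module))"
proof (rule monoidI)
  let ?M = "mat_ring n (lpa E :: ('k, ('v, 'e, 'k) lpa_elem) module)"
  show "\<one>\<^bsub>?M\<^esub> \<in> carrier ?M"
    unfolding class_mat_one by (intro class_mat_carrier) (auto simp: unit_class_image lpa_image_0)
  fix A assume "A \<in> carrier ?M"
  then obtain a where a: "\<And>i j. i < n \<Longrightarrow> j < n \<Longrightarrow> a i j \<in> lpa_image E" "A = class_mat E n a"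
    using mat_ring_carrierE by blast
  show "\<one>\<^bsub>?M\<^esub> \<otimes>\<^bsub>?M\<^esub> A = A"
  proof -
    have "(\<Sum>k<n. (if i = k then unit_class E else 0) * a k j) = a i j" if "i < n" "j < n" for i j
    proof -
      have "(\<Sum>k<n. (if i = k then unit_class E else 0) * a k j) = (\<Sum>k<n. if i = k then a k j else 0)"
        using that a by (intro sum.cong) (auto simp: unit_class_mult[OF assms])
      then show ?thesis using that by simp
    qed
    then show ?thesis
      unfolding a(2) class_mat_one
      using a by (subst class_mat_mult[OF assms]) (auto simp: unit_class_image lpa_image_0 class_mat_def intro!: cong_mat)
  qed
  show "A \<otimes>\<^bsub>?M\<^esub> \<one>\<^bsub>?M\<^esub> = A"
  proof -
    have "(\<Sum>k<n. a i k * (if k = j then unit_class E else 0)) = a i j" if "i < n" "j < n" for i j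
    proof -
      have "(\<Sum>k<n. a i k * (if k = j then unit_class E else 0)) = (\<Sum>k<n. if k = j then a i k else 0)"
        using that a by (intro sum.cong) (auto simp: unit_class_mult[OF assms])
      then show ?thesis using that by simp
    qed
    then show ?thesis
      unfolding a(2) class_mat_one
      using a by (subst class_mat_mult[OF assms]) (auto simp: unit_class_image lpa_image_0 class_mat_def intro!: cong_mat)
  qed
  fix B assume "B \<in> carrier ?M"
  then obtain b where b: "\<And>i j. i < n \<Longrightarrow> j < n \<Longrightarrow> b i j \<in> lpa_image E" "B = class_mat E n b"
    using mat_ring_carrierE by blast
  have ab: "(\<Sum>k<n. a i k * b k j) \<in> lpa_image E" if "i < n" "j < n" for i j
    using a b that by (intro lpa_image_sum lpa_image_mult) auto
  show "A \<otimes>\<^bsub>?M\<^esub> B \<in> carrier ?M"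
    unfolding a(2) b(2) using a b ab by (subst class_mat_mult[OF assms]) (auto intro: class_mat_carrier)
  fix C assume "C \<in> carrier ?M"
  then obtain c where c: "\<And>i j. i < n \<Longrightarrow> j < n \<Longrightarrow> c i j \<in> lpa_image E" "C = class_mat E n c"
    using mat_ring_carrierE by blast
  have bc: "(\<Sum>k<n. b i k * c k j) \<in> lpa_image E" if "i < n" "j < n" for i j
    using b c that by (intro lpa_image_sum lpa_image_mult) auto
  have "(\<Sum>k<n. (\<Sum>l<n. a i l * b l k) * c k j) = (\<Sum>l<n. a i l * (\<Sum>k<n. b l k * c k j))" for i j
  proof -
    have "(\<Sum>k<n. (\<Sum>l<n. a i l * b l k) * c k j) = (\<Sum>k<n. \<Sum>l<n. a i l * (b l k * c k j))"
      by (simp add: sum_distrib_right mult.assoc)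
    also have "\<dots> = (\<Sum>l<n. \<Sum>k<n. a i l * (b l k * c k j))" by (rule sum.swap)
    finally show ?thesis by (simp add: sum_distrib_left)
  qed
  then show "A \<otimes>\<^bsub>?M\<^esub> B \<otimes>\<^bsub>?M\<^esub> C = A \<otimes>\<^bsub>?M\<^esub> (B \<otimes>\<^bsub>?M\<^esub> C)"
    unfolding a(2) b(2) c(2) using a b c ab bc by (simp add: class_mat_mult[OF assms])
qed

section \<open>The endomorphisms of the Leavitt path algebra\<close>

text \<open>Conjugation by \<open>of_class\<close> turns an endomorphism of the record into a map to
  which the results about Leavitt families apply.\<close>

lemma alg_hom_classE:
  fixes \<phi> :: "('v, 'e, 'k::field) lpa_elem \<Rightarrow> ('v, 'e, 'k) lpa_elem"
  assumes "\<phi> \<in> alg_hom (lpa E) (lpa E)"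
  obtains A where "\<And>x. x \<in> lpa_image E \<Longrightarrow> A x \<in> lpa_image E"
    and "\<And>x y. x \<in> lpa_image E \<Longrightarrow> y \<in> lpa_image E \<Longrightarrow> A (x + y) = A x + A y"
    and "\<And>x y. x \<in> lpa_image E \<Longrightarrow> y \<in> lpa_image E \<Longrightarrow> A (x * y) = A x * A y"
    and "\<And>c x. x \<in> lpa_image E \<Longrightarrow> A (quotient_scale c x) = quotient_scale c (A x)"
    and "A 0 = 0" and "A (unit_class E) = unit_class E"
    and "\<And>x. x \<in> lpa_image E \<Longrightarrow> \<phi> (of_class E x) = of_class E (A x)"
proof -
  let ?L = "lpa E :: ('k, ('v, 'e, 'k) lpa_elem) module"
  define A where "A x = to_class E (\<phi> (of_class E x))" for x
  have hom: "\<phi> \<in> Ring.ring_hom ?L ?L" and smult: "\<And>c X. X \<in> carrier ?L \<Longrightarrow> \<phi> (c \<odot>\<^bsub>?L\<^esub> X) = c \<odot>\<^bsub>?L\<^esub> \<phi> X"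
    using assms by (auto simp: alg_hom_def)
  have closed: "\<phi> (of_class E x) \<in> carrier ?L" if "x \<in> lpa_image E" for x
    using ring_hom_closed[OF hom] that of_class_carrier by blast
  have im: "A x \<in> lpa_image E" if "x \<in> lpa_image E" for x
    unfolding A_def using closed[OF that] by (rule to_class_image)
  have \<phi>: "\<phi> (of_class E x) = of_class E (A x)" if "x \<in> lpa_image E" for x
    unfolding A_def using of_to_class[OF closed[OF that]] by simp
  have add: "A (x + y) = A x + A y" if "x \<in> lpa_image E" "y \<in> lpa_image E" for x y
  proof -
    have "of_class E (A (x + y)) = of_class E (A x + A y)"
      using ring_hom_add[OF hom of_class_carrier[OF that(1)] of_class_carrier[OF that(2)]] that
      by (simp add: lpa_add \<phi> lpa_image_add im)
    then show ?thesis using that by (simp add: of_class_eq_iff lpa_image_add im)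
  qed
  have mult: "A (x * y) = A x * A y" if "x \<in> lpa_image E" "y \<in> lpa_image E" for x y
  proof -
    have "of_class E (A (x * y)) = of_class E (A x * A y)"
      using ring_hom_mult[OF hom of_class_carrier[OF that(1)] of_class_carrier[OF that(2)]] that
      by (simp add: lpa_mult \<phi> lpa_image_mult im)
    then show ?thesis using that by (simp add: of_class_eq_iff lpa_image_mult im)
  qed
  have scale: "A (quotient_scale c x) = quotient_scale c (A x)" if "x \<in> lpa_image E" for c x
  proof -
    have "of_class E (A (quotient_scale c x)) = of_class E (quotient_scale c (A x))"
      using smult[OF of_class_carrier[OF that]] that by (simp add: lpa_smult \<phi> lpa_image_scale im)
    then show ?thesis using that by (simp add: of_class_eq_iff lpa_image_scale im)
  qed
  have zero: "A 0 = 0"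
    using scale[OF lpa_image_0, of 0] by simp
  have "of_class E (A (unit_class E)) = of_class E (unit_class E)"
    using ring_hom_one[OF hom] by (simp add: lpa_one \<phi> unit_class_image)
  then have one: "A (unit_class E) = unit_class E"
    by (simp add: of_class_eq_iff unit_class_image im)
  show ?thesis by (rule that[of A]) (fact im add mult scale zero one \<phi> | rule im add mult scale \<phi>; assumption)+
qed

text \<open>The way back. That the unit is preserved follows from the fixed vertices, whose sum it
  is.\<close>

lemma alg_homI_class:
  fixes A :: "('v, 'e, 'k::field) lpa_quotient \<Rightarrow> ('v, 'e, 'k) lpa_quotient"
  assumes "\<And>x. x \<in> lpa_image E \<Longrightarrow> A x \<in> lpa_image E"
    and "\<And>x y. x \<in> lpa_image E \<Longrightarrow> y \<in> lpa_image E \<Longrightarrow> A (x + y) = A x + A y"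
    and "\<And>x y. x \<in> lpa_image E \<Longrightarrow> y \<in> lpa_image E \<Longrightarrow> A (x * y) = A x * A y"
    and "\<And>c x. x \<in> lpa_image E \<Longrightarrow> A (quotient_scale c x) = quotient_scale c (A x)"
    and "\<And>u. u \<in> verts E \<Longrightarrow> A (lpa_class E (free_gen (Vertex u))) = lpa_class E (free_gen (Vertex u))"
    and "\<And>x. x \<in> lpa_image E \<Longrightarrow> \<phi> (of_class E x) = of_class E (A x)"
  shows "\<phi> \<in> alg_hom (lpa E) (lpa E)"
proof -
  have zero: "A 0 = 0" using assms(4)[OF lpa_image_0, of 0] by simp
  have sum: "A (\<Sum>i\<in>S. g i) = (\<Sum>i\<in>S. A (g i))" if "\<And>i. i \<in> S \<Longrightarrow> g i \<in> lpa_image E" for S :: "'v set" and g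
    using that by (induction S rule: infinite_finite_induct) (auto simp: zero assms(2) lpa_image_sum)
  have "A (unit_class E) = unit_class E"
    unfolding unit_class_def
    by (subst sum) (auto simp: assms(5) intro: lpa_image_class vertex_carrier)
  then show ?thesis
    unfolding alg_hom_def Ring.ring_hom_def
    by (auto simp: carrier_lpa lpa_add lpa_mult lpa_smult lpa_one assms(1-4,6) lpa_image_add
        lpa_image_mult lpa_image_scale unit_class_image)
qed

lemma alg_hom_eqI:
  fixes \<phi> \<psi> :: "('v, 'e, 'k::field) lpa_elem \<Rightarrow> ('v, 'e, 'k) lpa_elem"
  assumes "\<phi> \<in> alg_hom (lpa E) (lpa E)" "\<psi> \<in> alg_hom (lpa E) (lpa E)"
    and "\<And>l. l \<in> lpa_letters E \<Longrightarrow> \<phi> (of_class E (lpa_class E (free_gen l))) = \<psi> (of_class E (lpa_class E (free_gen l)))"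
    and "X \<in> carrier (lpa E)"
  shows "\<phi> X = \<psi> X"
proof -
  obtain A where A: "\<And>x. x \<in> lpa_image E \<Longrightarrow> A x \<in> lpa_image E"
    "\<And>x y. x \<in> lpa_image E \<Longrightarrow> y \<in> lpa_image E \<Longrightarrow> A (x + y) = A x + A y"
    "\<And>x y. x \<in> lpa_image E \<Longrightarrow> y \<in> lpa_image E \<Longrightarrow> A (x * y) = A x * A y"
    "\<And>c x. x \<in> lpa_image E \<Longrightarrow> A (quotient_scale c x) = quotient_scale c (A x)"
    "A 0 = 0" "A (unit_class E) = unit_class E"
    "\<And>x. x \<in> lpa_image E \<Longrightarrow> \<phi> (of_class E x) = of_class E (A x)"
    by (rule alg_hom_classE[OF assms(1)], rule that)
  obtain B where B: "\<And>x. x \<in> lpa_image E \<Longrightarrow> B x \<in> lpa_image E"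
    "\<And>x y. x \<in> lpa_image E \<Longrightarrow> y \<in> lpa_image E \<Longrightarrow> B (x + y) = B x + B y"
    "\<And>x y. x \<in> lpa_image E \<Longrightarrow> y \<in> lpa_image E \<Longrightarrow> B (x * y) = B x * B y"
    "\<And>c x. x \<in> lpa_image E \<Longrightarrow> B (quotient_scale c x) = quotient_scale c (B x)"
    "B 0 = 0" "B (unit_class E) = unit_class E"
    "\<And>x. x \<in> lpa_image E \<Longrightarrow> \<psi> (of_class E x) = of_class E (B x)"
    by (rule alg_hom_classE[OF assms(2)], rule that)
  have "A x = B x" if "x \<in> lpa_image E" for x
    using that
  proof (induction rule: lpa_image_induct)
    case (gen l)
    have "lpa_class E (free_gen l) \<in> (lpa_image E :: ('v, 'e, 'k) lpa_quotient set)"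
      using gen by (intro lpa_image_class free_carrier_gen)
    then show ?case using assms(3)[OF gen] A(1,7) B(1,7) by (simp add: of_class_eq_iff)
  qed (simp_all add: A B)
  then show ?thesis using assms(4) A(7) B(7) by (auto simp: carrier_lpa)
qed

lemma class_mat_cong:
  "(\<And>i j. i < n \<Longrightarrow> j < n \<Longrightarrow> p i j = q i j) \<Longrightarrow> class_mat E n p = class_mat E n q"
  by (auto simp: class_mat_def intro!: cong_mat)

text \<open>The hypotheses of the theorem after translation, with P and its inverse given by
  classes. Exchanging \<open>p\<close> and \<open>q\<close> gives another instance, which provides
  the homomorphism for the inverse matrix.\<close>

locale lpa_unit_matrix =
  fixes E :: "('v, 'e) pre_digraph" and n :: nat and e :: "nat \<Rightarrow> 'e" and v w :: 'v
    and p q :: "nat \<Rightarrow> nat \<Rightarrow> ('v, 'e, 'k::field) lpa_quotient"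
  assumes wf: "wf_digraph E" and fin: "finite (verts E)"
    and v_vert: "v \<in> verts E" and w_vert: "w \<in> verts E" and e_inj: "inj_on e {..<n}"
    and e_arc: "\<forall>i<n. e i \<in> arcs E \<and> tail E (e i) = v \<and> head E (e i) = w"
    and p_image: "\<And>i j. i < n \<Longrightarrow> j < n \<Longrightarrow> p i j \<in> lpa_image E"
    and q_image: "\<And>i j. i < n \<Longrightarrow> j < n \<Longrightarrow> q i j \<in> lpa_image E"
    and p_q: "\<And>i j. i < n \<Longrightarrow> j < n \<Longrightarrow> (\<Sum>k<n. p i k * q k j) = (if i = j then unit_class E else 0)"
    and q_p: "\<And>i j. i < n \<Longrightarrow> j < n \<Longrightarrow> (\<Sum>k<n. q i k * p k j) = (if i = j then unit_class E else 0)"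
    and w_p_commute: "\<And>i j. i < n \<Longrightarrow> j < n \<Longrightarrow>
      lpa_class E (free_gen (Vertex w)) * p i j = p i j * lpa_class E (free_gen (Vertex w))"
begin

abbreviation "Vx \<equiv> \<lambda>u. lpa_class E (free_gen (Vertex u)) :: ('v, 'e, 'k) lpa_quotient"
abbreviation "Dx \<equiv> \<lambda>f. lpa_class E (free_gen (Edge f)) :: ('v, 'e, 'k) lpa_quotient"
abbreviation "Gx \<equiv> \<lambda>f. lpa_class E (free_gen (Ghost f)) :: ('v, 'e, 'k) lpa_quotient"

sublocale fam: leavitt_family E quotient_scale Vx Dx Gx
  by (rule lpa_leavitt_family[OF wf fin])

lemma fam_L: "fam.L = lpa_image E"
  by (rule lpa_family_L[OF wf fin])

lemma fam_unit: "fam.unit = unit_class E"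
  by (simp add: fam.unit_def unit_class_def)

sublocale fam: leavitt_unit E quotient_scale Vx Dx Gx n e v w p q
  by unfold_locales
    (use v_vert w_vert e_inj e_arc p_image q_image p_q q_p w_p_commute in \<open>simp_all add: fam_L fam_unit\<close>)

lemma gen_image:
  "u \<in> verts E \<Longrightarrow> Vx u \<in> lpa_image E" "f \<in> arcs E \<Longrightarrow> Dx f \<in> lpa_image E"
  "f \<in> arcs E \<Longrightarrow> Gx f \<in> lpa_image E"
  by (auto intro: lpa_image_class vertex_carrier edge_carrier ghost_carrier)

lemma lpa_gen_of_class:
  "u \<in> verts E \<Longrightarrow> lpa_gen E (Vertex u) = of_class E (Vx u)"
  "f \<in> arcs E \<Longrightarrow> lpa_gen E (Edge f) = of_class E (Dx f)"
  "f \<in> arcs E \<Longrightarrow> lpa_gen E (Ghost f) = of_class E (Gx f)"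
  by (simp_all add: lpa_gen_class lpa_letters_def)

lemma inv_class_mat: "inv\<^bsub>mat_ring n (lpa E)\<^esub> (class_mat E n p) = class_mat E n q"
proof -
  interpret Group.monoid "mat_ring n (lpa E :: ('k, ('v, 'e, 'k) lpa_elem) module)"
    by (rule mat_ring_monoid[OF wf fin])
  have carrier: "class_mat E n p \<in> carrier (mat_ring n (lpa E))"
    "class_mat E n q \<in> carrier (mat_ring n (lpa E))"
    using p_image q_image by (auto intro: class_mat_carrier)
  have "class_mat E n p \<otimes>\<^bsub>mat_ring n (lpa E)\<^esub> class_mat E n q = class_mat E n (\<lambda>i j. \<Sum>k<n. p i k * q k j)"
    using p_image q_image by (rule class_mat_mult[OF wf fin])
  also have "\<dots> = \<one>\<^bsub>mat_ring n (lpa E)\<^esub>"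
    unfolding class_mat_one by (intro class_mat_cong p_q)
  finally have pq: "class_mat E n p \<otimes>\<^bsub>mat_ring n (lpa E)\<^esub> class_mat E n q = \<one>\<^bsub>mat_ring n (lpa E)\<^esub>" .
  have "class_mat E n q \<otimes>\<^bsub>mat_ring n (lpa E)\<^esub> class_mat E n p = class_mat E n (\<lambda>i j. \<Sum>k<n. q i k * p k j)"
    using q_image p_image by (rule class_mat_mult[OF wf fin])
  also have "\<dots> = \<one>\<^bsub>mat_ring n (lpa E)\<^esub>"
    unfolding class_mat_one by (intro class_mat_cong q_p)
  finally show ?thesis using carrier pq by (metis inv_char)
qed

text \<open>Distinguished and other edges are merged into \<open>edge_image\<close> and
  \<open>ghost_image\<close>, and the inverse in the matrix ring disappears, so that existence and
  uniqueness concern the values on generators only.\<close>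

lemma is_lpa_phi_iff:
  "is_lpa_phi E n e (class_mat E n p) \<phi> \<longleftrightarrow>
    \<phi> \<in> extensional (carrier (lpa E)) \<and> \<phi> \<in> alg_hom (lpa E) (lpa E) \<and>
    (\<forall>u\<in>verts E. \<phi> (of_class E (Vx u)) = of_class E (Vx u)) \<and>
    (\<forall>f\<in>arcs E. \<phi> (of_class E (Dx f)) = of_class E (fam.edge_image f) \<and>
      \<phi> (of_class E (Gx f)) = of_class E (fam.ghost_image f))"
proof -
  have D: "(\<Oplus>\<^bsub>lpa E\<^esub>k\<in>{..<n}. lpa_gen E (Edge (e k)) \<otimes>\<^bsub>lpa E\<^esub> class_mat E n p $$ (k, i)) =
      of_class E (fam.edge_image (e i))" if "i < n" for i
    using that e_arc p_image unfolding fam.edge_image_e[OF that]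
    by (intro lpa_finsum[OF wf fin]) (auto simp: lpa_gen_of_class lpa_mult gen_image lpa_image_mult)
  have G: "(\<Oplus>\<^bsub>lpa E\<^esub>k\<in>{..<n}. class_mat E n q $$ (i, k) \<otimes>\<^bsub>lpa E\<^esub> lpa_gen E (Ghost (e k))) =
      of_class E (fam.ghost_image (e i))" if "i < n" for i
    using that e_arc q_image unfolding fam.ghost_image_e[OF that]
    by (intro lpa_finsum[OF wf fin]) (auto simp: lpa_gen_of_class lpa_mult gen_image lpa_image_mult)
  have split: "(\<forall>f\<in>arcs E. Q f) \<longleftrightarrow> (\<forall>f\<in>arcs E - e ` {..<n}. Q f) \<and> (\<forall>i<n. Q (e i))" for Q
    using e_arc by auto
  show ?thesis
    unfolding is_lpa_phi_def Let_def inv_class_mat split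
    using e_arc
    by (simp add: D G lpa_gen_of_class fam.edge_image_other fam.ghost_image_other cong: conj_cong)
qed

lemma ex1_phi: "\<exists>!\<phi>. is_lpa_phi E n e (class_mat E n p) \<phi>"
proof -
  obtain A where A: "\<And>x. x \<in> lpa_image E \<Longrightarrow> A x \<in> lpa_image E"
    "\<And>x y. x \<in> lpa_image E \<Longrightarrow> y \<in> lpa_image E \<Longrightarrow> A (x + y) = A x + A y"
    "\<And>x y. x \<in> lpa_image E \<Longrightarrow> y \<in> lpa_image E \<Longrightarrow> A (x * y) = A x * A y"
    "\<And>c x. x \<in> lpa_image E \<Longrightarrow> A (quotient_scale c x) = quotient_scale c (A x)"
    "\<And>u. u \<in> verts E \<Longrightarrow> A (Vx u) = Vx u" "\<And>f. f \<in> arcs E \<Longrightarrow> A (Dx f) = fam.edge_image f"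
    "\<And>f. f \<in> arcs E \<Longrightarrow> A (Gx f) = fam.ghost_image f"
    by (rule lpa_universal[OF wf fam.image_family gen_image(1)
          fam.edge_image_L[unfolded fam_L] fam.ghost_image_L[unfolded fam_L]], assumption, assumption,
        assumption, rule that)
  \<comment> \<open>The restriction provides the extensionality that makes the homomorphism unique
    as a function.\<close>
  define \<phi> where "\<phi> = restrict (\<lambda>X. of_class E (A (to_class E X))) (carrier (lpa E))"
  have \<phi>: "\<phi> (of_class E x) = of_class E (A x)" if "x \<in> lpa_image E" for x
    using that by (simp add: \<phi>_def of_class_carrier)
  have "\<phi> \<in> alg_hom (lpa E) (lpa E)"
    by (rule alg_homI_class[of E A]) (simp_all add: A \<phi>)
  then have "is_lpa_phi E n e (class_mat E n p) \<phi>"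
    unfolding is_lpa_phi_iff using A(5-7) by (simp add: \<phi> gen_image) (simp add: \<phi>_def)
  moreover have "\<psi> = \<phi>'" if phis: "is_lpa_phi E n e (class_mat E n p) \<psi>" "is_lpa_phi E n e (class_mat E n p) \<phi>'" for \<psi> \<phi>'
  proof (rule extensionalityI)
    show "\<psi> \<in> extensional (carrier (lpa E))" "\<phi>' \<in> extensional (carrier (lpa E))"
      using phis unfolding is_lpa_phi_iff by blast+
    have hom: "\<psi> \<in> alg_hom (lpa E) (lpa E)" "\<phi>' \<in> alg_hom (lpa E) (lpa E)"
      using phis unfolding is_lpa_phi_iff by blast+
    fix X :: "('v, 'e, 'k) lpa_elem" assume X: "X \<in> carrier (lpa E)"
    show "\<psi> X = \<phi>' X"
    proof (rule alg_hom_eqI[OF hom _ X])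
      fix l assume "l \<in> lpa_letters E"
      then consider u where "u \<in> verts E" "l = Vertex u" | f where "f \<in> arcs E" "l = Edge f"
        | f where "f \<in> arcs E" "l = Ghost f"
        unfolding lpa_letters_def by blast
      then show "\<psi> (of_class E (lpa_class E (free_gen l))) = \<phi>' (of_class E (lpa_class E (free_gen l)))"
        by cases (use phis in \<open>simp_all only: is_lpa_phi_iff\<close>)
    qed
  qed
  ultimately show ?thesis by blast
qed

lemma lpa_phi: "is_lpa_phi E n e (class_mat E n p) (lpa_phi E n e (class_mat E n p))"
  unfolding lpa_phi_def using ex1_phi by (rule theI')

lemma swap_matrices: "lpa_unit_matrix E n e v w q p"
  by unfold_locales
    (use wf fin v_vert w_vert e_inj e_arc p_image q_image p_q q_p fam.w_q in auto)

interpretation inverse: lpa_unit_matrix E n e v w q p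
  by (rule swap_matrices)

text \<open>\<open>A\<close> and \<open>B\<close> are the two homomorphisms on classes. From
  \<open>A (B x) = x\<close> follows surjectivity of \<open>A\<close>, from this injectivity by
  \<open>lpa_endo_kernel_trivial\<close>, and a right inverse of a bijection is its inverse.\<close>

lemma phi_of_fixed_matrix:
  assumes fixed: "\<forall>i<n. \<forall>j<n. lpa_phi E n e (class_mat E n p) (of_class E (p i j)) = of_class E (p i j)"
  defines "\<phi> \<equiv> lpa_phi E n e (class_mat E n p)" and "\<psi> \<equiv> lpa_phi E n e (class_mat E n q)"
  shows "\<phi> \<in> alg_iso (lpa E) (lpa E)"
    and "restrict (inv_into (carrier (lpa E)) \<phi>) (carrier (lpa E)) = \<psi>"
proof -
  let ?L = "lpa E :: ('k, ('v, 'e, 'k) lpa_elem) module"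
  have \<phi>: "\<phi> \<in> alg_hom ?L ?L" "\<And>u. u \<in> verts E \<Longrightarrow> \<phi> (of_class E (Vx u)) = of_class E (Vx u)"
    "\<And>f. f \<in> arcs E \<Longrightarrow> \<phi> (of_class E (Dx f)) = of_class E (fam.edge_image f)"
    "\<And>f. f \<in> arcs E \<Longrightarrow> \<phi> (of_class E (Gx f)) = of_class E (fam.ghost_image f)"
    using lpa_phi unfolding is_lpa_phi_iff \<phi>_def by blast+
  have \<psi>: "\<psi> \<in> extensional (carrier ?L)" "\<psi> \<in> alg_hom ?L ?L"
    "\<And>u. u \<in> verts E \<Longrightarrow> \<psi> (of_class E (Vx u)) = of_class E (Vx u)"
    "\<And>f. f \<in> arcs E \<Longrightarrow> \<psi> (of_class E (Dx f)) = of_class E (inverse.fam.edge_image f)"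
    "\<And>f. f \<in> arcs E \<Longrightarrow> \<psi> (of_class E (Gx f)) = of_class E (inverse.fam.ghost_image f)"
    using inverse.lpa_phi unfolding inverse.is_lpa_phi_iff \<psi>_def by blast+
  obtain A where A: "\<And>x. x \<in> lpa_image E \<Longrightarrow> A x \<in> lpa_image E"
    "\<And>x y. x \<in> lpa_image E \<Longrightarrow> y \<in> lpa_image E \<Longrightarrow> A (x + y) = A x + A y"
    "\<And>x y. x \<in> lpa_image E \<Longrightarrow> y \<in> lpa_image E \<Longrightarrow> A (x * y) = A x * A y"
    "\<And>c x. x \<in> lpa_image E \<Longrightarrow> A (quotient_scale c x) = quotient_scale c (A x)"
    "A 0 = 0" "A (unit_class E) = unit_class E"
    "\<And>x. x \<in> lpa_image E \<Longrightarrow> \<phi> (of_class E x) = of_class E (A x)"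
    by (rule alg_hom_classE[OF \<phi>(1)], rule that)
  have A_eq: "A x = y" if "x \<in> lpa_image E" "y \<in> lpa_image E" "\<phi> (of_class E x) = of_class E y" for x y
    using that A(1,7) by (simp add: of_class_eq_iff)
  have A_V: "A (Vx u) = Vx u" if "u \<in> verts E" for u
    using that \<phi>(2) gen_image by (intro A_eq) auto
  have A_D: "A (Dx f) = fam.edge_image f" and A_G: "A (Gx f) = fam.ghost_image f" if "f \<in> arcs E" for f
    using that \<phi>(3,4) gen_image fam.edge_image_L fam.ghost_image_L by (auto intro!: A_eq simp: fam_L)
  have A_p: "A (p i j) = p i j" if "i < n" "j < n" for i j
    using that fixed p_image by (intro A_eq) (auto simp: \<phi>_def)
  have A_q: "A (q i j) = q i j" if "i < n" "j < n" for i j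
    using fam.fixes_inverse_matrix[of A i j] A(1-3,5,6) A_p that by (simp add: fam_L fam_unit)
  have inverse_image: "A (inverse.fam.edge_image f) = Dx f" "A (inverse.fam.ghost_image f) = Gx f"
    if "f \<in> arcs E" for f
    using fam.hom_inverse_image[of A f] A(2,3,5) A_p A_q A_D A_G that by (simp_all add: fam_L)
  obtain B where B: "\<And>x. x \<in> lpa_image E \<Longrightarrow> B x \<in> lpa_image E"
    "\<And>x y. x \<in> lpa_image E \<Longrightarrow> y \<in> lpa_image E \<Longrightarrow> B (x + y) = B x + B y"
    "\<And>x y. x \<in> lpa_image E \<Longrightarrow> y \<in> lpa_image E \<Longrightarrow> B (x * y) = B x * B y"
    "\<And>c x. x \<in> lpa_image E \<Longrightarrow> B (quotient_scale c x) = quotient_scale c (B x)"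
    "B 0 = 0" "B (unit_class E) = unit_class E"
    "\<And>x. x \<in> lpa_image E \<Longrightarrow> \<psi> (of_class E x) = of_class E (B x)"
    by (rule alg_hom_classE[OF \<psi>(2)], rule that)
  have B_eq: "B x = y" if "x \<in> lpa_image E" "y \<in> lpa_image E" "\<psi> (of_class E x) = of_class E y" for x y
    using that B(1,7) by (simp add: of_class_eq_iff)
  have B_V: "B (Vx u) = Vx u" if "u \<in> verts E" for u
    using that \<psi>(3) gen_image by (intro B_eq) auto
  have B_D: "B (Dx f) = inverse.fam.edge_image f" and B_G: "B (Gx f) = inverse.fam.ghost_image f"
    if "f \<in> arcs E" for f
    using that \<psi>(4,5) gen_image inverse.fam.edge_image_L inverse.fam.ghost_image_L
    by (auto intro!: B_eq simp: fam_L)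
  have AB: "A (B x) = x" if "x \<in> lpa_image E" for x
    using that
  proof (induction rule: lpa_image_induct)
    case (gen l)
    then show ?case
      by (auto simp: lpa_letters_def A_V B_V B_D B_G inverse_image)
  qed (simp_all add: A B)
  have A_surj: "\<exists>x\<in>lpa_image E. A x = y" if "y \<in> lpa_image E" for y
    using AB B(1) that by blast
  have A_inj: "x = y" if "x \<in> lpa_image E" "y \<in> lpa_image E" "A x = A y" for x y
  proof -
    \<comment> \<open>Differences are formed with the scalar -1, since \<open>lpa_image\<close> and
      \<open>A\<close> are known to be compatible with addition and scalars.\<close>
    have y: "quotient_scale (- 1) y \<in> lpa_image E" using that(2) by (rule lpa_image_scale)
    have "A (x + quotient_scale (- 1) y) = A x + quotient_scale (- 1) (A y)"
      by (simp only: A(2)[OF that(1) y] A(4)[OF that(2)])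
    also have "\<dots> = 0" using that(3) by (simp add: quotient.scale_minus_left)
    finally have 0: "A (x + quotient_scale (- 1) y) = 0" .
    have "x + quotient_scale (- 1) y = 0"
    proof (rule lpa_endo_kernel_trivial[OF wf fin, of A])
      show "x + quotient_scale (- 1) y \<in> lpa_image E" using that(1) y by (rule lpa_image_add)
      show "A (x + quotient_scale (- 1) y) = 0" by (rule 0)
    qed (simp_all only: A(1-4) A_V A_surj)
    then show ?thesis by (simp add: quotient.scale_minus_left)
  qed
  have inv: "\<phi> (\<psi> X) = X" "\<psi> X \<in> carrier ?L" if "X \<in> carrier ?L" for X
    using that AB A(7) B(1,7) by (auto simp: carrier_lpa)
  have inj: "inj_on \<phi> (carrier ?L)"
  proof (rule inj_onI)
    fix X Y assume X: "X \<in> carrier ?L" and Y: "Y \<in> carrier ?L" and eq: "\<phi> X = \<phi> Y"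
    obtain x y where x: "x \<in> lpa_image E" "X = of_class E x" and y: "y \<in> lpa_image E" "Y = of_class E y"
      using X Y unfolding carrier_lpa by blast
    have "A x = A y" using eq x y A(1,7) by (simp add: of_class_eq_iff)
    then show "X = Y" using A_inj x y by blast
  qed
  have "\<phi> X \<in> carrier ?L" if "X \<in> carrier ?L" for X
    using that A(1,7) by (auto simp: carrier_lpa)
  then have "\<phi> ` carrier ?L = carrier ?L"
    using inv by (metis image_eqI image_subsetI subsetI subset_antisym)
  then show "\<phi> \<in> alg_iso ?L ?L"
    using \<phi>(1) inj unfolding alg_iso_def ring_iso_def alg_hom_def bij_betw_def by blast
  show "restrict (inv_into (carrier ?L) \<phi>) (carrier ?L) = \<psi>"
  proof (rule extensionalityI)
    show "restrict (inv_into (carrier ?L) \<phi>) (carrier ?L) \<in> extensional (carrier ?L)" by simp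
    show "\<psi> \<in> extensional (carrier ?L)" by (rule \<psi>(1))
    show "restrict (inv_into (carrier ?L) \<phi>) (carrier ?L) X = \<psi> X" if "X \<in> carrier ?L" for X
      using that inv[OF that] inv_into_f_f[OF inj inv(2)[OF that]] by simp
  qed
qed

end

theorem corollary2p3:
  fixes E :: "('v, 'e) pre_digraph"
    and n :: nat
    and v w :: 'v
    and e :: "nat \<Rightarrow> 'e"
    and P :: "('v, 'e, 'k::field) lpa_elem mat"
  assumes "wf_digraph E" and "finite (verts E)" and "0 < n"
    and "v \<in> verts E" and "w \<in> verts E"
    and "inj_on e {..<n}"
    and "\<forall>i<n. e i \<in> arcs E \<and> tail E (e i) = v \<and> head E (e i) = w"
    and "P \<in> Units (mat_ring n (lpa E))"
    and "map_mat (\<lambda>x. lpa_gen E (Vertex w) \<otimes>\<^bsub>lpa E\<^esub> x) P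
       = map_mat (\<lambda>x. x \<otimes>\<^bsub>lpa E\<^esub> lpa_gen E (Vertex w)) P"
  shows "(\<exists>!\<phi>. is_lpa_phi E n e P \<phi>) \<and>
    ((\<forall>i<n. \<forall>j<n. lpa_phi E n e P (P $$ (i, j)) = P $$ (i, j)) \<longrightarrow>
      lpa_phi E n e P \<in> alg_iso (lpa E) (lpa E) \<and>
      restrict (inv_into (carrier (lpa E)) (lpa_phi E n e P)) (carrier (lpa E))
        = lpa_phi E n e (inv\<^bsub>mat_ring n (lpa E)\<^esub> P))"
proof -
  let ?M = "mat_ring n (lpa E :: ('k, ('v, 'e, 'k) lpa_elem) module)"
  obtain Q where Q: "P \<in> carrier ?M" "Q \<in> carrier ?M" "Q \<otimes>\<^bsub>?M\<^esub> P = \<one>\<^bsub>?M\<^esub>" "P \<otimes>\<^bsub>?M\<^esub> Q = \<one>\<^bsub>?M\<^esub>"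
    using assms(8) unfolding Units_def by blast
  obtain p where p: "\<And>i j. i < n \<Longrightarrow> j < n \<Longrightarrow> p i j \<in> lpa_image E" "P = class_mat E n p"
    using mat_ring_carrierE[OF Q(1)] by blast
  obtain q where q: "\<And>i j. i < n \<Longrightarrow> j < n \<Longrightarrow> q i j \<in> lpa_image E" "Q = class_mat E n q"
    using mat_ring_carrierE[OF Q(2)] by blast
  let ?w = "lpa_class E (free_gen (Vertex w)) :: ('v, 'e, 'k) lpa_quotient"
  have w: "?w \<in> lpa_image E" "lpa_gen E (Vertex w) = of_class E ?w"
    using assms(5) by (auto intro: lpa_image_class vertex_carrier simp: lpa_gen_class lpa_letters_def)
  have "?w * p i j = p i j * ?w" if ij: "i < n" "j < n" for i j
  proof -
    have "map_mat (\<lambda>x. lpa_gen E (Vertex w) \<otimes>\<^bsub>lpa E\<^esub> x) P $$ (i, j) =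
        map_mat (\<lambda>x. x \<otimes>\<^bsub>lpa E\<^esub> lpa_gen E (Vertex w)) P $$ (i, j)"
      by (simp only: assms(9))
    then have "of_class E (?w * p i j) = of_class E (p i j * ?w)"
      using ij p(1) w by (simp add: p(2) class_mat_def lpa_mult)
    then show ?thesis using ij p(1) w(1) by (simp add: of_class_eq_iff lpa_image_mult)
  qed
  \<comment> \<open>Stated for arbitrary factors, because it is applied to both P Q = 1 and Q P =
    1.\<close>
  moreover have product: "(\<Sum>k<n. a i k * b k j) = (if i = j then unit_class E else 0)"
    if "class_mat E n a \<otimes>\<^bsub>?M\<^esub> class_mat E n b = \<one>\<^bsub>?M\<^esub>" and ij: "i < n" "j < n"
      and ab: "\<And>i j. i < n \<Longrightarrow> j < n \<Longrightarrow> a i j \<in> lpa_image E" "\<And>i j. i < n \<Longrightarrow> j < n \<Longrightarrow> b i j \<in> lpa_image E"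
    for a b i j
  proof -
    have "class_mat E n (\<lambda>i j. \<Sum>k<n. a i k * b k j) =
        class_mat E n (\<lambda>i j. if i = j then unit_class E else 0)"
      using that(1) class_mat_mult[OF assms(1,2) ab] by (simp add: class_mat_one)
    moreover have "(\<Sum>k<n. a i k * b k j) \<in> lpa_image E" if "i < n" "j < n" for i j
      using that ab by (intro lpa_image_sum lpa_image_mult) auto
    ultimately have "\<forall>i<n. \<forall>j<n. (\<Sum>k<n. a i k * b k j) = (if i = j then unit_class E else 0)"
      by (subst (asm) class_mat_eq_iff) (simp_all add: unit_class_image lpa_image_0)
    then show ?thesis using ij by blast
  qed
  ultimately have "lpa_unit_matrix E n e v w p q"
    using Q(3,4) p q assms(1,2,4-7) by (intro lpa_unit_matrix.intro) simp_all
  then interpret lpa_unit_matrix E n e v w p q .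
  show ?thesis
    using ex1_phi phi_of_fixed_matrix unfolding p(2) inv_class_mat by simp
qed

end
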